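(* Let $\mathbb{K}$ be a locally compact topological field, $k\in\mathbb{N}_0\cup\{\infty\}$, $M$ a finite-dimensional $C^k_{\mathbb{K}}$-manifold, and $E$ a topological $\mathbb{K}$-vector space. Then the evaluation map $$\varepsilon\colon C^k(M,E)\times M\to E,\qquad\varepsilon(\gamma,x):=\gamma(x)$$ is of class $C^k_{\mathbb{K}}$.
   Context: All topological spaces, fields and topological vector spaces are Hausdorff; topological fields are non-discrete. Differential calculus over a topological field $\mathbb{K}$: For a topological $\mathbb{K}$-vector space $E$ and $U\subseteq E$ open, put $U^{[0]}:=U$, $U^{[1]}:=\{(x,y,t)\in U\times E\times\mathbb{K}: x+ty\in U\}$ and $U^{[j+1]}:=(U^{[j]})^{[1]}$. A map $f\colon U\to F$ into a topological $\mathbb{K}$-vector space is $C^0_{\mathbb{K}}$ if it is continuous ($f^{[0]}:=f$); it is $C^1_{\mathbb{K}}$ if it is continuous and there is a (necessarily unique) continuous map $f^{[1]}\colon U^{[1]}\to F$ with $f^{[1]}(x,y,t)=\frac1t(f(x+ty)-f(x))$ for all $(x,y,t)\in U^{[1]}$ with $t\neq0$; for $k\ge2$ it is $C^k_{\mathbb{K}}$ if it is $C^{k-1}_{\mathbb{K}}$ and $f^{[k-1]}$ is $C^1_{\mathbb{K}}$, and then $f^{[k]}:=(f^{[k-1]})^{[1]}$; it is $C^\infty_{\mathbb{K}}$ if it is $C^k_{\mathbb{K}}$ for all $k$. Manifolds modeled on topological vector spaces and $C^k$-maps between them are defined as usual via charts. Function spaces: For $V$ open in a topological $\mathbb{K}$-vector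 space, $C^k(V,E)$ is the space of $C^k_{\mathbb{K}}$-maps $V\to E$ with the initial topology with respect to the maps $\gamma\mapsto\gamma^{[j]}\in C(V^{[j]},E)$ (compact-open topology), $j\in\mathbb{N}_0$, $j\le k$. $C^k(M,E)$ is the space of $C^k_{\mathbb{K}}$-maps $M\to E$ with the initial topology with respect to the maps $\gamma\mapsto\gamma|_U\circ\kappa^{-1}\in C^k(V,E)$, for $\kappa\colon U\to V$ ranging through the charts of $M$. *)

theory Defs
  imports
    "HOL-Analysis.Analysis"
    "HOL-Algebra.Algebraic_Closure_Type"
    "HOL-Algebra.Module"
    "HOL-Library.Extended_Nat"
begin

section \<open>Topological fields and topological vector spaces\<close>

class topological_field =
  field + t2_space + topological_ab_group_add + topological_semigroup_mult +
  assumes tendsto_inverse_nhds: "x \<noteq> 0 \<Longrightarrow> filterlim inverse (nhds (inverse x)) (nhds x)"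
    and not_discrete: "\<exists>S. \<not> open S"

text \<open>
  Vector spaces carry an explicit carrier set and an explicit topology, since the function
  spaces below are not whole types. The ring components \<open>mult\<close> and \<open>one\<close> inherited from
  \<open>module\<close> play no role and are left undefined.
\<close>

record ('k, 'v) tvs = "('k, 'v) module" +
  vtop :: "'v topology"

locale topological_vector_space = Module.module "ring_of_type_algebra :: 'k ring" V
  for V :: "('k::topological_field, 'v) tvs" (structure) +
  assumes topspace_vtop: "topspace (vtop V) = carrier V"
    and Hausdorff_vtop: "Hausdorff_space (vtop V)"
    and continuous_add:
      "continuous_map (prod_topology (vtop V) (vtop V)) (vtop V) (\<lambda>(x, y). x \<oplus>\<^bsub>V\<^esub> y)"
    and continuous_smult:
      "continuous_map (prod_topology euclidean (vtop V)) (vtop V) (\<lambda>(c, x). c \<odot>\<^bsub>V\<^esub> x)"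

definition finite_dimensional_tvs :: "('k::topological_field, 'v) tvs \<Rightarrow> bool" where
  "finite_dimensional_tvs V \<longleftrightarrow>
     (\<exists>B. finite B \<and> B \<subseteq> carrier V \<and>
        (\<forall>x\<in>carrier V. \<exists>c :: 'v \<Rightarrow> 'k. x = (\<Oplus>\<^bsub>V\<^esub>b\<in>B. c b \<odot>\<^bsub>V\<^esub> b)))"

definition scalar_tvs :: "('k::topological_field, 'k) tvs" where
  "scalar_tvs =
     \<lparr>carrier = UNIV, monoid.mult = undefined, one = undefined,
      ring.zero = 0, add = (+), smult = (*), vtop = euclidean\<rparr>"

definition prod_tvs ::
    "('k, 'v) tvs \<Rightarrow> ('k, 'w) tvs \<Rightarrow> ('k, 'v \<times> 'w) tvs" where
  "prod_tvs V W =
     \<lparr>carrier = carrier V \<times> carrier W, monoid.mult = undefined, one = undefined,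
      ring.zero = (\<zero>\<^bsub>V\<^esub>, \<zero>\<^bsub>W\<^esub>),
      add = (\<lambda>(x, y) (x', y'). (x \<oplus>\<^bsub>V\<^esub> x', y \<oplus>\<^bsub>W\<^esub> y')),
      smult = (\<lambda>c (x, y). (c \<odot>\<^bsub>V\<^esub> x, c \<odot>\<^bsub>W\<^esub> y)),
      vtop = prod_topology (vtop V) (vtop W)\<rparr>"

text \<open>Transport of structure along an injective map of types.\<close>

definition map_tvs :: "('v \<Rightarrow> 'w) \<Rightarrow> ('k, 'v) tvs \<Rightarrow> ('k, 'w) tvs" where
  "map_tvs h V =
     \<lparr>carrier = h ` carrier V, monoid.mult = undefined, one = undefined,
      ring.zero = h \<zero>\<^bsub>V\<^esub>,
      add = (\<lambda>x y. h (inv_into UNIV h x \<oplus>\<^bsub>V\<^esub> inv_into UNIV h y)),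
      smult = (\<lambda>c x. h (c \<odot>\<^bsub>V\<^esub> inv_into UNIV h x)),
      vtop = pullback_topology (h ` carrier V) (inv_into UNIV h) (vtop V)\<rparr>"


section \<open>Differential calculus\<close>

definition dom1 :: "('k, 'v) tvs \<Rightarrow> 'v set \<Rightarrow> ('v \<times> 'v \<times> 'k) set" where
  "dom1 V U = {(x, y, t). x \<in> U \<and> y \<in> carrier V \<and> x \<oplus>\<^bsub>V\<^esub> t \<odot>\<^bsub>V\<^esub> y \<in> U}"

definition is_bracket1 ::
    "('k::topological_field, 'v) tvs \<Rightarrow> 'v set \<Rightarrow> ('k, 'f) tvs \<Rightarrow> ('v \<Rightarrow> 'f)
      \<Rightarrow> ('v \<times> 'v \<times> 'k \<Rightarrow> 'f) \<Rightarrow> bool" where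
  "is_bracket1 V U F f g \<longleftrightarrow>
     g \<in> extensional (dom1 V U) \<and>
     continuous_map
       (subtopology (vtop (prod_tvs V (prod_tvs V scalar_tvs))) (dom1 V U)) (vtop F) g \<and>
     (\<forall>(x, y, t)\<in>dom1 V U. t \<noteq> 0 \<longrightarrow>
        g (x, y, t) = inverse t \<odot>\<^bsub>F\<^esub> (f (x \<oplus>\<^bsub>V\<^esub> t \<odot>\<^bsub>V\<^esub> y) \<ominus>\<^bsub>F\<^esub> f x))"

definition C1_map ::
    "('k::topological_field, 'v) tvs \<Rightarrow> 'v set \<Rightarrow> ('k, 'f) tvs \<Rightarrow> ('v \<Rightarrow> 'f) \<Rightarrow> bool" where
  "C1_map V U F f \<longleftrightarrow>
     continuous_map (subtopology (vtop V) U) (vtop F) f \<and> (\<exists>g. is_bracket1 V U F f g)"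

text \<open>
  For open \<open>U\<close> and Hausdorff \<open>F\<close> there is at most one such map, because the scalar field is not
  discrete and values outside the domain are fixed to be \<open>undefined\<close>.
\<close>

definition bracket1 ::
    "('k::topological_field, 'v) tvs \<Rightarrow> 'v set \<Rightarrow> ('k, 'f) tvs \<Rightarrow> ('v \<Rightarrow> 'f)
      \<Rightarrow> ('v \<times> 'v \<times> 'k \<Rightarrow> 'f)" where
  "bracket1 V U F f = (THE g. is_bracket1 V U F f g)"

text \<open>
  The sets \<open>U\<^sup>[\<^sup>j\<^sup>]\<close> live in different types for different \<open>j\<close>. To allow recursion on \<open>j\<close>, the
  type below contains a copy of each of them: a point of \<open>U\<^sup>[\<^sup>0\<^sup>] = U\<close> is wrapped in \<open>Base\<close>, and
  a triple \<open>(x, y, t)\<close> in \<open>U\<^sup>[\<^sup>j\<^sup>+\<^sup>1\<^sup>]\<close> becomes \<open>Triple x y t\<close>. The ambient space of \<open>U\<^sup>[\<^sup>j\<^sup>]\<close> is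
  \<open>iter_tvs V j\<close>.
\<close>

datatype ('k, 'v) iter = Base 'v | Triple "('k, 'v) iter" "('k, 'v) iter" 'k

definition triple :: "('k, 'v) iter \<times> ('k, 'v) iter \<times> 'k \<Rightarrow> ('k, 'v) iter" where
  "triple = (\<lambda>(x, y, t). Triple x y t)"

primrec iter_tvs :: "('k::topological_field, 'v) tvs \<Rightarrow> nat \<Rightarrow> ('k, ('k, 'v) iter) tvs" where
  "iter_tvs V 0 = map_tvs Base V"
| "iter_tvs V (Suc j) =
     map_tvs triple (prod_tvs (iter_tvs V j) (prod_tvs (iter_tvs V j) scalar_tvs))"

primrec iter_dom ::
    "('k::topological_field, 'v) tvs \<Rightarrow> 'v set \<Rightarrow> nat \<Rightarrow> ('k, 'v) iter set" where
  "iter_dom V U 0 = Base ` U"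
| "iter_dom V U (Suc j) = triple ` dom1 (iter_tvs V j) (iter_dom V U j)"

text \<open>The map \<open>f\<^sup>[\<^sup>j\<^sup>]\<close>; meaningful only if \<open>f\<close> is \<open>C\<^sup>j\<close>.\<close>

primrec iter_bracket ::
    "('k::topological_field, 'v) tvs \<Rightarrow> 'v set \<Rightarrow> ('k, 'f) tvs \<Rightarrow> ('v \<Rightarrow> 'f) \<Rightarrow> nat
      \<Rightarrow> (('k, 'v) iter \<Rightarrow> 'f)" where
  "iter_bracket V U F f 0 = restrict (f \<circ> inv_into UNIV Base) (iter_dom V U 0)"
| "iter_bracket V U F f (Suc j) =
     restrict
       (bracket1 (iter_tvs V j) (iter_dom V U j) F (iter_bracket V U F f j) \<circ> inv_into UNIV triple)
       (iter_dom V U (Suc j))"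

primrec Cn_map ::
    "nat \<Rightarrow> ('k::topological_field, 'v) tvs \<Rightarrow> 'v set \<Rightarrow> ('k, 'f) tvs \<Rightarrow> ('v \<Rightarrow> 'f) \<Rightarrow> bool"
where
  "Cn_map 0 V U F f \<longleftrightarrow> continuous_map (subtopology (vtop V) U) (vtop F) f"
| "Cn_map (Suc n) V U F f \<longleftrightarrow>
     Cn_map n V U F f \<and> C1_map (iter_tvs V n) (iter_dom V U n) F (iter_bracket V U F f n)"

definition Ck_map ::
    "enat \<Rightarrow> ('k::topological_field, 'v) tvs \<Rightarrow> 'v set \<Rightarrow> ('k, 'f) tvs \<Rightarrow> ('v \<Rightarrow> 'f) \<Rightarrow> bool"
where
  "Ck_map k V U F f \<longleftrightarrow> (case k of enat n \<Rightarrow> Cn_map n V U F f | \<infinity> \<Rightarrow> \<forall>n. Cn_map n V U F f)"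


section \<open>Function spaces on open sets\<close>

text \<open>Functions on a set are represented as functions that are \<open>undefined\<close> off that set.\<close>

definition compact_open_topology :: "'a topology \<Rightarrow> 'b topology \<Rightarrow> ('a \<Rightarrow> 'b) topology" where
  "compact_open_topology S T =
     topology_generated_by
       {{f \<in> extensional (topspace S). continuous_map S T f \<and> f ` K \<subseteq> W} | K W.
          compactin S K \<and> openin T W}"

definition initial_topology ::
    "'s set \<Rightarrow> 'i set \<Rightarrow> ('i \<Rightarrow> 's \<Rightarrow> 'b) \<Rightarrow> ('i \<Rightarrow> 'b topology) \<Rightarrow> 's topology" where
  "initial_topology S I g T =
     topology_generated_by (insert S {{s \<in> S. g i s \<in> W} | i W. i \<in> I \<and> openin (T i) W})"

definition Ck_topology ::
    "enat \<Rightarrow> ('k::topological_field, 'v) tvs \<Rightarrow> 'v set \<Rightarrow> ('k, 'f) tvs \<Rightarrow> ('v \<Rightarrow> 'f) topology"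
where
  "Ck_topology k V U F =
     initial_topology {f \<in> extensional U. Ck_map k V U F f} {j. enat j \<le> k}
       (\<lambda>j f. iter_bracket V U F f j)
       (\<lambda>j. compact_open_topology (subtopology (vtop (iter_tvs V j)) (iter_dom V U j)) (vtop F))"


section \<open>Manifolds\<close>

text \<open>
  A chart \<open>\<kappa> : U \<rightarrow> \<kappa> ` U\<close> is a pair \<open>(U, \<kappa>)\<close>. The component \<open>atlas\<close> is any atlas defining
  the manifold; the charts of the manifold, \<open>charts k M\<close>, form the maximal
  \<open>C\<^sup>k\<close>-atlas determined by it.
\<close>

record ('k, 'm, 'z) manifold_data =
  mtop :: "'m topology"
  model :: "('k, 'z) tvs"
  atlas :: "('m set \<times> ('m \<Rightarrow> 'z)) set"

definition is_chart :: "'m topology \<Rightarrow> ('k, 'z) tvs \<Rightarrow> 'm set \<times> ('m \<Rightarrow> 'z) \<Rightarrow> bool" where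
  "is_chart S Z = (\<lambda>(U, \<kappa>).
     openin S U \<and> openin (vtop Z) (\<kappa> ` U) \<and>
     homeomorphic_map (subtopology S U) (subtopology (vtop Z) (\<kappa> ` U)) \<kappa>)"

definition compatible_charts ::
    "enat \<Rightarrow> ('k::topological_field, 'z) tvs
      \<Rightarrow> 'm set \<times> ('m \<Rightarrow> 'z) \<Rightarrow> 'm set \<times> ('m \<Rightarrow> 'z) \<Rightarrow> bool" where
  "compatible_charts k Z = (\<lambda>(U, \<kappa>) (U', \<kappa>').
     Ck_map k Z (\<kappa> ` (U \<inter> U')) Z (\<kappa>' \<circ> inv_into U \<kappa>) \<and>
     Ck_map k Z (\<kappa>' ` (U \<inter> U')) Z (\<kappa> \<circ> inv_into U' \<kappa>'))"

locale Ck_manifold =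
  fixes k :: enat and M :: "('k::topological_field, 'm, 'z) manifold_data"
  assumes Hausdorff_mtop: "Hausdorff_space (mtop M)"
    and tvs_model: "topological_vector_space (model M)"
    and atlas_charts: "\<And>c. c \<in> atlas M \<Longrightarrow> is_chart (mtop M) (model M) c"
    and atlas_covers: "(\<Union>(U, \<kappa>)\<in>atlas M. U) = topspace (mtop M)"
    and atlas_compatible:
      "\<And>c c'. c \<in> atlas M \<Longrightarrow> c' \<in> atlas M \<Longrightarrow> compatible_charts k (model M) c c'"

definition charts ::
    "enat \<Rightarrow> ('k::topological_field, 'm, 'z) manifold_data \<Rightarrow> ('m set \<times> ('m \<Rightarrow> 'z)) set" where
  "charts k M =
     {c. is_chart (mtop M) (model M) c \<and> (\<forall>c'\<in>atlas M. compatible_charts k (model M) c c')}"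

definition Ck_manifold_map ::
    "enat \<Rightarrow> ('k::topological_field, 'm, 'z) manifold_data \<Rightarrow> ('k, 'n, 'w) manifold_data
      \<Rightarrow> ('m \<Rightarrow> 'n) \<Rightarrow> bool" where
  "Ck_manifold_map k M N f \<longleftrightarrow>
     continuous_map (mtop M) (mtop N) f \<and>
     (\<forall>(U, \<kappa>)\<in>charts k M. \<forall>(W, \<mu>)\<in>charts k N.
        Ck_map k (model M) (\<kappa> ` (U \<inter> f -` W)) (model N) (\<mu> \<circ> f \<circ> inv_into U \<kappa>))"

definition tvs_manifold :: "('k, 'v) tvs \<Rightarrow> ('k, 'v, 'v) manifold_data" where
  "tvs_manifold V = \<lparr>mtop = vtop V, model = V, atlas = {(carrier V, id)}\<rparr>"

definition prod_manifold ::
    "('k, 'm, 'z) manifold_data \<Rightarrow> ('k, 'n, 'w) manifold_data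
      \<Rightarrow> ('k, 'm \<times> 'n, 'z \<times> 'w) manifold_data" where
  "prod_manifold M N =
     \<lparr>mtop = prod_topology (mtop M) (mtop N),
      model = prod_tvs (model M) (model N),
      atlas = {(U \<times> W, map_prod \<kappa> \<mu>) | U \<kappa> W \<mu>. (U, \<kappa>) \<in> atlas M \<and> (W, \<mu>) \<in> atlas N}\<rparr>"

text \<open>The space \<open>C\<^sup>k(M, E)\<close> with pointwise operations.\<close>

definition Ck_functions ::
    "enat \<Rightarrow> ('k::topological_field, 'm, 'z) manifold_data \<Rightarrow> ('k, 'e) tvs \<Rightarrow> ('m \<Rightarrow> 'e) set"
where
  "Ck_functions k M E =
     {\<gamma> \<in> extensional (topspace (mtop M)). Ck_manifold_map k M (tvs_manifold E) \<gamma>}"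

definition Ck_tvs ::
    "enat \<Rightarrow> ('k::topological_field, 'm, 'z) manifold_data \<Rightarrow> ('k, 'e) tvs
      \<Rightarrow> ('k, 'm \<Rightarrow> 'e) tvs" where
  "Ck_tvs k M E =
     \<lparr>carrier = Ck_functions k M E, monoid.mult = undefined, one = undefined,
      ring.zero = (\<lambda>x\<in>topspace (mtop M). \<zero>\<^bsub>E\<^esub>),
      add = (\<lambda>\<gamma> \<eta>. \<lambda>x\<in>topspace (mtop M). \<gamma> x \<oplus>\<^bsub>E\<^esub> \<eta> x),
      smult = (\<lambda>c \<gamma>. \<lambda>x\<in>topspace (mtop M). c \<odot>\<^bsub>E\<^esub> \<gamma> x),
      vtop = initial_topology (Ck_functions k M E) (charts k M)
        (\<lambda>(U, \<kappa>) \<gamma>. restrict (\<gamma> \<circ> inv_into U \<kappa>) (\<kappa> ` U))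
        (\<lambda>(U, \<kappa>). Ck_topology k (model M) (\<kappa> ` U) E)\<rparr>"

end

theory Submission
  imports Defs
begin

text \<open>
  For \<open>t \<noteq> 0\<close> the difference quotient of the evaluation map at \<open>((\<gamma>, x), (\<eta>, y), t)\<close> is
  \<open>\<gamma>\<^sup>[\<^sup>1\<^sup>](x, y, t) + \<eta>(x + t y)\<close>, and the right-hand side makes sense for \<open>t = 0\<close> as well. Its two
  summands are the evaluation of the linear family \<open>\<gamma> \<mapsto> \<gamma>\<^sup>[\<^sup>1\<^sup>]\<close> at a point and the original
  evaluation composed with a polynomial map, so induction on the order of differentiability
  reduces the claim to joint continuity of \<open>(\<gamma>, p) \<mapsto> \<gamma>\<^sup>[\<^sup>j\<^sup>](p)\<close>. This is continuity of the
  evaluation \<open>C(A, E) \<times> A \<rightarrow> E\<close> for locally compact \<open>A\<close>, which applies since a finite-dimensional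
  Hausdorff space over a locally compact field is locally compact. The chain rule and the
  locality of differentiability carry the result from charts of the given atlas to all charts.
\<close>

section \<open>Topological vector spaces\<close>


text \<open>The induction climbs from \<open>V\<close> to \<open>V x V x K\<close> at every step,
  and two features of the definition stand in its way. The levels \<open>U^[j]\<close> have points
  of different shape and their brackets are definite descriptions; and \<open>Cn_map\<close> adds a
  condition on the last bracket, whereas the chain rule and the formula for evaluation speak about
  the first one. Hence a second notion of order \<open>n\<close>, called \<open>CN\<close>: it peels
  off the first quotient and merely asserts that one exists, with the denominator cleared.
  Uniqueness of quotients, which rests on the scalars being non-discrete, enters where local
  quotients are glued and where the calculus is carried back to the definition. The calculus applies
  to the parameter space only once \<open>Ck_tvs\<close> is known to be a topological vector space,
  and this too follows from joint continuity of the brackets. In the proof of local compactness the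
  coordinate map is known to be continuous in one direction only; powers of one small scalar,
  combined with a compact shell around zero, replace the missing continuity of its inverse.\<close>

lemma continuous_map_fst':
    "continuous_map S (prod_topology A B) f \<Longrightarrow> continuous_map S A (\<lambda>s. fst (f s))"
  and continuous_map_snd':
    "continuous_map S (prod_topology A B) f \<Longrightarrow> continuous_map S B (\<lambda>s. snd (f s))"
  by (simp_all add: continuous_map_pairwise o_def)

lemma continuous_map_ident: "continuous_map A A (\<lambda>x. x)"
  using continuous_map_id by (simp add: id_def)

lemmas continuous_map_projections =
  continuous_map_pairedI continuous_map_fst' continuous_map_snd' continuous_map_ident

abbreviation cont_on ::
    "('k, 'v) tvs \<Rightarrow> 'v set \<Rightarrow> ('k, 'f) tvs \<Rightarrow> ('v \<Rightarrow> 'f) \<Rightarrow> bool" where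
  "cont_on V U F f \<equiv> continuous_map (subtopology (vtop V) U) (vtop F) f"

abbreviation comb :: "('k, 'v) tvs \<Rightarrow> 'v \<Rightarrow> 'k \<Rightarrow> 'v \<Rightarrow> 'v" where
  "comb V x t y \<equiv> x \<oplus>\<^bsub>V\<^esub> t \<odot>\<^bsub>V\<^esub> y"

lemma carrier_ring_of_type_algebra [simp]: "carrier (ring_of_type_algebra :: 'a::ring_1 ring) = UNIV"
  and add_ring_of_type_algebra [simp]: "x \<oplus>\<^bsub>ring_of_type_algebra\<^esub> y = (x + y :: 'a)"
  and mult_ring_of_type_algebra [simp]: "x \<otimes>\<^bsub>ring_of_type_algebra\<^esub> y = (x * y :: 'a)"
  and one_ring_of_type_algebra [simp]: "\<one>\<^bsub>ring_of_type_algebra\<^esub> = (1 :: 'a)"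
  and zero_ring_of_type_algebra [simp]: "\<zero>\<^bsub>ring_of_type_algebra\<^esub> = (0 :: 'a)"
  by (simp_all add: ring_of_type_algebra_def)

text \<open>Negatives are supplied by \<open>(-1) \<odot> x\<close>, so the rule
  \<open>0 \<odot> x = \<zero>\<close> takes the place of an axiom of additive inverses.\<close>

lemma topological_vector_spaceI:
  fixes V :: "('k::topological_field, 'v) tvs" (structure)
  assumes add_closed: "\<And>x y. x \<in> carrier V \<Longrightarrow> y \<in> carrier V \<Longrightarrow> x \<oplus> y \<in> carrier V"
    and zero_closed: "\<zero> \<in> carrier V"
    and add_assoc: "\<And>x y z. x \<in> carrier V \<Longrightarrow> y \<in> carrier V \<Longrightarrow> z \<in> carrier V \<Longrightarrow>
      (x \<oplus> y) \<oplus> z = x \<oplus> (y \<oplus> z)"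
    and add_comm: "\<And>x y. x \<in> carrier V \<Longrightarrow> y \<in> carrier V \<Longrightarrow> x \<oplus> y = y \<oplus> x"
    and zero_add: "\<And>x. x \<in> carrier V \<Longrightarrow> \<zero> \<oplus> x = x"
    and smult_closed: "\<And>c x. x \<in> carrier V \<Longrightarrow> c \<odot> x \<in> carrier V"
    and smult_add_left: "\<And>c d x. x \<in> carrier V \<Longrightarrow> (c + d) \<odot> x = c \<odot> x \<oplus> d \<odot> x"
    and smult_add_right: "\<And>c x y. x \<in> carrier V \<Longrightarrow> y \<in> carrier V \<Longrightarrow>
      c \<odot> (x \<oplus> y) = c \<odot> x \<oplus> c \<odot> y"
    and smult_smult: "\<And>c d x. x \<in> carrier V \<Longrightarrow> (c * d) \<odot> x = c \<odot> (d \<odot> x)"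
    and one_smult: "\<And>x. x \<in> carrier V \<Longrightarrow> 1 \<odot> x = x"
    and zero_smult: "\<And>x. x \<in> carrier V \<Longrightarrow> 0 \<odot> x = \<zero>"
    and topspace: "topspace (vtop V) = carrier V"
    and Hausdorff: "Hausdorff_space (vtop V)"
    and add_cont:
      "continuous_map (prod_topology (vtop V) (vtop V)) (vtop V) (\<lambda>(x, y). x \<oplus> y)"
    and smult_cont:
      "continuous_map (prod_topology euclidean (vtop V)) (vtop V) (\<lambda>(c, x). c \<odot> x)"
  shows "topological_vector_space V"
proof -
  have "\<exists>y\<in>carrier V. y \<oplus> x = \<zero>" if x: "x \<in> carrier V" for x
  proof (intro bexI)
    have "(-1) \<odot> x \<oplus> 1 \<odot> x = \<zero>"
      using smult_add_left [OF x, of "-1" 1] zero_smult [OF x] by simp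
    then show "(-1) \<odot> x \<oplus> x = \<zero>" using one_smult [OF x] by simp
  qed (use x smult_closed in auto)
  then have "abelian_group V"
    using assms by (intro abelian_groupI) auto
  then have "Module.module (ring_of_type_algebra :: 'k ring) V"
    using assms by (intro moduleI) (auto intro: cring_from_type_algebra)
  then show ?thesis
    using topspace Hausdorff add_cont smult_cont
    by (intro topological_vector_space.intro topological_vector_space_axioms.intro) auto
qed

context topological_vector_space
begin

lemma smult_mem [simp, intro]: "x \<in> carrier V \<Longrightarrow> c \<odot> x \<in> carrier V"
  using smult_closed [of c x] by simp

lemma smult_add_left: "x \<in> carrier V \<Longrightarrow> (c + d) \<odot> x = c \<odot> x \<oplus> d \<odot> x"
  using smult_l_distr [of c d x] by simp

lemma smult_add_right:
  "x \<in> carrier V \<Longrightarrow> y \<in> carrier V \<Longrightarrow> c \<odot> (x \<oplus> y) = c \<odot> x \<oplus> c \<odot> y"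
  using smult_r_distr [of c x y] by simp

lemma smult_smult: "x \<in> carrier V \<Longrightarrow> c \<odot> (d \<odot> x) = (c * d) \<odot> x"
  using smult_assoc1 [of c d x] by simp

lemma one_smult [simp]: "x \<in> carrier V \<Longrightarrow> 1 \<odot> x = x"
  using smult_one [of x] by simp

lemma zero_smult [simp]: "x \<in> carrier V \<Longrightarrow> 0 \<odot> x = \<zero>"
  using smult_l_null [of x] by simp

lemma minus_eq_smult:
  assumes "x \<in> carrier V" "y \<in> carrier V"
  shows "x \<ominus> y = x \<oplus> (-1) \<odot> y"
proof -
  have "(-1) \<odot> y \<oplus> y = \<zero>"
    using smult_add_left [of y "-1" 1] assms by simp
  then have "\<ominus> y = (-1) \<odot> y" using assms by (metis M.minus_equality smult_mem)
  then show ?thesis by (simp add: a_minus_def)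
qed

text \<open>Division by \<open>t\<close>: an equation with cleared denominator determines the
  quotient as soon as \<open>t \<noteq> 0\<close>.\<close>

lemma comb_cancel:
  assumes "x \<in> carrier V" "y \<in> carrier V" "y' \<in> carrier V" "t \<noteq> 0"
    and "x \<oplus> t \<odot> y = x \<oplus> t \<odot> y'"
  shows "y = y'"
proof -
  have "t \<odot> y = t \<odot> y'"
    using assms M.add.l_cancel smult_mem by blast
  then have "inverse t \<odot> (t \<odot> y) = inverse t \<odot> (t \<odot> y')" by simp
  then show ?thesis using assms by (simp add: smult_smult)
qed

lemma comb_quotient:
  assumes "x \<in> carrier V" "z \<in> carrier V" "t \<noteq> 0"
  shows "x \<oplus> t \<odot> (inverse t \<odot> (z \<ominus> x)) = z"
proof -
  have "x \<oplus> (z \<ominus> x) = z \<oplus> (x \<oplus> \<ominus> x)"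
    using assms by (simp add: a_minus_def M.a_ac)
  then show ?thesis using assms by (simp add: smult_smult M.r_neg)
qed

lemma comb_add_comb:
  assumes "x \<in> carrier V" "y \<in> carrier V" "x' \<in> carrier V" "y' \<in> carrier V"
  shows "(x \<oplus> t \<odot> y) \<oplus> (x' \<oplus> t \<odot> y') = (x \<oplus> x') \<oplus> t \<odot> (y \<oplus> y')"
  using assms by (simp add: smult_add_right M.a_ac)

text \<open>This exchange turns a linear combination of two difference quotients into the difference
  quotient of the combination.\<close>

lemma comb_swap:
  assumes "x \<in> carrier V" "y \<in> carrier V" "x' \<in> carrier V" "y' \<in> carrier V"
  shows "(x \<oplus> t \<odot> y) \<oplus> c \<odot> (x' \<oplus> t \<odot> y') = (x \<oplus> c \<odot> x') \<oplus> t \<odot> (y \<oplus> c \<odot> y')"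
  using assms by (simp add: smult_add_right smult_smult M.a_ac mult.commute)

text \<open>Product rule for increments: at \<open>(c, v)\<close> in direction \<open>(d, w)\<close>
  scalar multiplication has the quotient
  \<open>c \<odot> w \<oplus> d \<odot> (v \<oplus> t \<odot> w)\<close>.\<close>

lemma smult_comb:
  assumes "v \<in> carrier V" "w \<in> carrier V"
  shows "(c + t * d) \<odot> (v \<oplus> t \<odot> w) = c \<odot> v \<oplus> t \<odot> (c \<odot> w \<oplus> d \<odot> (v \<oplus> t \<odot> w))"
  using assms by (simp add: smult_add_left smult_add_right smult_smult M.a_ac algebra_simps)

lemma continuous_map_add:
  assumes "continuous_map S (vtop V) f" "continuous_map S (vtop V) g"
  shows "continuous_map S (vtop V) (\<lambda>s. f s \<oplus> g s)"
  using continuous_map_compose [OF continuous_map_pairedI [OF assms] continuous_add]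
  by (simp add: o_def)

lemma continuous_map_smult:
  assumes "continuous_map S euclidean c" "continuous_map S (vtop V) g"
  shows "continuous_map S (vtop V) (\<lambda>s. c s \<odot> g s)"
  using continuous_map_compose [OF continuous_map_pairedI [OF assms] continuous_smult]
  by (simp add: o_def)

lemma open_subset_carrier: "openin (vtop V) U \<Longrightarrow> U \<subseteq> carrier V"
  using openin_subset topspace_vtop by metis

end

lemma continuous_map_scalar_add: "continuous_map S euclidean f \<Longrightarrow> continuous_map S euclidean g \<Longrightarrow>
    continuous_map S euclidean (\<lambda>s. f s + g s :: 'k::topological_field)"
  and continuous_map_scalar_mult: "continuous_map S euclidean f \<Longrightarrow> continuous_map S euclidean g \<Longrightarrow>
    continuous_map S euclidean (\<lambda>s. f s * g s :: 'k::topological_field)"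
  by (auto simp: continuous_map_atin limitin_canonical_iff intro: tendsto_add tendsto_mult)

lemma continuous_map_scalar_inverse: "continuous_map S euclidean f \<Longrightarrow>
   (\<And>s. s \<in> topspace S \<Longrightarrow> f s \<noteq> 0) \<Longrightarrow>
    continuous_map S euclidean (\<lambda>s. inverse (f s) :: 'k::topological_field)"
  by (auto simp: continuous_map_atin limitin_canonical_iff intro: filterlim_compose [OF tendsto_inverse_nhds])

section \<open>Scalars, products and transported copies as topological vector spaces\<close>

lemma carrier_scalar_tvs [simp]: "carrier scalar_tvs = UNIV"
  and add_scalar_tvs [simp]: "x \<oplus>\<^bsub>scalar_tvs\<^esub> y = x + y"
  and smult_scalar_tvs [simp]: "x \<odot>\<^bsub>scalar_tvs\<^esub> y = x * y"
  and zero_scalar_tvs [simp]: "\<zero>\<^bsub>scalar_tvs\<^esub> = 0"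
  and vtop_scalar_tvs [simp]: "vtop scalar_tvs = euclidean"
  by (simp_all add: scalar_tvs_def)

lemma tvs_scalar: "topological_vector_space (scalar_tvs :: ('k::topological_field, 'k) tvs)"
proof (rule topological_vector_spaceI)
  have "continuous_map (prod_topology euclidean euclidean) euclidean (\<lambda>p :: 'k \<times> 'k. fst p + snd p)"
    by (rule continuous_map_scalar_add continuous_map_projections)+
  then show "continuous_map (prod_topology (vtop scalar_tvs) (vtop scalar_tvs)) (vtop scalar_tvs)
      (\<lambda>(x, y :: 'k). x \<oplus>\<^bsub>scalar_tvs\<^esub> y)"
    by (simp add: case_prod_unfold)
  have "continuous_map (prod_topology euclidean euclidean) euclidean (\<lambda>p :: 'k \<times> 'k. fst p * snd p)"
    by (rule continuous_map_scalar_mult continuous_map_projections)+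
  then show "continuous_map (prod_topology euclidean (vtop scalar_tvs)) (vtop scalar_tvs)
      (\<lambda>(x, y :: 'k). x \<odot>\<^bsub>scalar_tvs\<^esub> y)"
    by (simp add: case_prod_unfold)
  show "Hausdorff_space (vtop (scalar_tvs :: ('k, 'k) tvs))"
    unfolding Hausdorff_space_def disjnt_def vtop_scalar_tvs open_openin [symmetric] topspace_euclidean
    using hausdorff by metis
qed (auto simp: algebra_simps)

lemma carrier_prod_tvs [simp]: "carrier (prod_tvs V W) = carrier V \<times> carrier W"
  and add_prod_tvs [simp]: "(x, y) \<oplus>\<^bsub>prod_tvs V W\<^esub> (x', y') = (x \<oplus>\<^bsub>V\<^esub> x', y \<oplus>\<^bsub>W\<^esub> y')"
  and smult_prod_tvs [simp]: "c \<odot>\<^bsub>prod_tvs V W\<^esub> (x, y) = (c \<odot>\<^bsub>V\<^esub> x, c \<odot>\<^bsub>W\<^esub> y)"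
  and zero_prod_tvs [simp]: "\<zero>\<^bsub>prod_tvs V W\<^esub> = (\<zero>\<^bsub>V\<^esub>, \<zero>\<^bsub>W\<^esub>)"
  and vtop_prod_tvs [simp]: "vtop (prod_tvs V W) = prod_topology (vtop V) (vtop W)"
  by (simp_all add: prod_tvs_def)

lemma tvs_prod:
  assumes "topological_vector_space V" "topological_vector_space W"
  shows "topological_vector_space (prod_tvs V W)"
proof -
  interpret V: topological_vector_space V by fact
  interpret W: topological_vector_space W by fact
  show ?thesis
  proof (rule topological_vector_spaceI)
    have "continuous_map (prod_topology (prod_topology (vtop V) (vtop W)) (prod_topology (vtop V) (vtop W)))
        (prod_topology (vtop V) (vtop W))
        (\<lambda>p. (fst (fst p) \<oplus>\<^bsub>V\<^esub> fst (snd p), snd (fst p) \<oplus>\<^bsub>W\<^esub> snd (snd p)))"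
      by (rule V.continuous_map_add W.continuous_map_add continuous_map_projections)+
    then show "continuous_map (prod_topology (vtop (prod_tvs V W)) (vtop (prod_tvs V W)))
        (vtop (prod_tvs V W)) (\<lambda>(x, y). x \<oplus>\<^bsub>prod_tvs V W\<^esub> y)"
      by (simp add: case_prod_unfold prod_tvs_def)
    have "continuous_map (prod_topology euclidean (prod_topology (vtop V) (vtop W)))
        (prod_topology (vtop V) (vtop W))
        (\<lambda>p. (fst p \<odot>\<^bsub>V\<^esub> fst (snd p), fst p \<odot>\<^bsub>W\<^esub> snd (snd p)))"
      by (rule V.continuous_map_smult W.continuous_map_smult continuous_map_projections)+
    then show "continuous_map (prod_topology euclidean (vtop (prod_tvs V W)))
        (vtop (prod_tvs V W)) (\<lambda>(x, y). x \<odot>\<^bsub>prod_tvs V W\<^esub> y)"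
      by (simp add: case_prod_unfold prod_tvs_def)
    show "Hausdorff_space (vtop (prod_tvs V W))"
      using V.Hausdorff_vtop W.Hausdorff_vtop by (simp add: Hausdorff_space_prod_topology)
  qed (auto simp: V.topspace_vtop W.topspace_vtop V.M.a_assoc W.M.a_assoc V.smult_add_left V.smult_add_right
        V.smult_smult W.smult_add_left W.smult_add_right W.smult_smult intro!: V.M.a_comm W.M.a_comm)
qed

lemma carrier_map_tvs [simp]: "carrier (map_tvs h V) = h ` carrier V"
  and zero_map_tvs [simp]: "\<zero>\<^bsub>map_tvs h V\<^esub> = h \<zero>\<^bsub>V\<^esub>"
  by (simp_all add: map_tvs_def)

lemma add_map_tvs [simp]: "inj h \<Longrightarrow> h x \<oplus>\<^bsub>map_tvs h V\<^esub> h y = h (x \<oplus>\<^bsub>V\<^esub> y)"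
  and smult_map_tvs [simp]: "inj h \<Longrightarrow> c \<odot>\<^bsub>map_tvs h V\<^esub> h x = h (c \<odot>\<^bsub>V\<^esub> x)"
  by (simp_all add: map_tvs_def)

lemma continuous_map_into_map_tvs:
  assumes "inj h" "topspace (vtop V) = carrier V" "continuous_map S (vtop V) f"
  shows "continuous_map S (vtop (map_tvs h V)) (\<lambda>s. h (f s))"
proof -
  have "continuous_map S (pullback_topology (h ` carrier V) (inv_into UNIV h) (vtop V)) (\<lambda>s. h (f s))"
    using assms by (intro continuous_map_pullback') (auto simp: o_def continuous_map_def)
  then show ?thesis by (simp add: map_tvs_def)
qed

lemma continuous_map_inv_map_tvs:
  assumes "inj h"
  shows "continuous_map (vtop (map_tvs h V)) (vtop V) (inv_into UNIV h)"
  using continuous_map_pullback [OF continuous_map_id, of "h ` carrier V" "inv_into UNIV h" "vtop V"]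
  by (simp add: map_tvs_def o_def id_def)

lemma topspace_map_tvs:
  assumes "inj h" "topspace (vtop V) = carrier V"
  shows "topspace (vtop (map_tvs h V)) = h ` carrier V"
  using assms by (auto simp: map_tvs_def topspace_pullback_topology)

lemma tvs_map:
  assumes "topological_vector_space V" and h: "inj h"
  shows "topological_vector_space (map_tvs h V)"
proof -
  interpret V: topological_vector_space V by fact
  note ts = topspace_map_tvs [OF h V.topspace_vtop]
  note ci = continuous_map_inv_map_tvs [OF h, of V]
  show ?thesis
  proof (rule topological_vector_spaceI)
    have "continuous_map (prod_topology (vtop (map_tvs h V)) (vtop (map_tvs h V)))
        (vtop (map_tvs h V)) (\<lambda>p. h (inv_into UNIV h (fst p) \<oplus>\<^bsub>V\<^esub> inv_into UNIV h (snd p)))"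
      by (intro continuous_map_into_map_tvs h V.topspace_vtop V.continuous_map_add
          continuous_map_compose [OF continuous_map_fst ci, unfolded o_def]
          continuous_map_compose [OF continuous_map_snd ci, unfolded o_def])
    then show "continuous_map (prod_topology (vtop (map_tvs h V)) (vtop (map_tvs h V)))
        (vtop (map_tvs h V)) (\<lambda>(x, y). x \<oplus>\<^bsub>map_tvs h V\<^esub> y)"
      by (rule continuous_map_eq) (use h ts in auto)
    have "continuous_map (prod_topology euclidean (vtop (map_tvs h V)))
        (vtop (map_tvs h V)) (\<lambda>p. h (fst p \<odot>\<^bsub>V\<^esub> inv_into UNIV h (snd p)))"
      by (intro continuous_map_into_map_tvs h V.topspace_vtop V.continuous_map_smult continuous_map_fst
          continuous_map_compose [OF continuous_map_snd ci, unfolded o_def])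
    then show "continuous_map (prod_topology euclidean (vtop (map_tvs h V)))
        (vtop (map_tvs h V)) (\<lambda>(x, y). x \<odot>\<^bsub>map_tvs h V\<^esub> y)"
      by (rule continuous_map_eq) (use h ts in auto)
    show "Hausdorff_space (vtop (map_tvs h V))"
      by (rule Hausdorff_space_injective_preimage [OF V.Hausdorff_vtop ci]) (auto simp: ts h intro!: inj_onI)
  qed (auto simp: h ts V.smult_add_left V.smult_add_right V.smult_smult V.M.a_assoc intro!: arg_cong [of _ _ h] V.M.a_comm)
qed


section \<open>One type for all spaces, and the chain rule\<close>


text \<open>
  The chain rule is proved by induction on the order, and the induction step passes from the
  spaces \<open>V\<close> and \<open>W\<close> to \<open>V \<times> V \<times> K\<close> and \<open>W \<times> W \<times> K\<close>. To keep the types fixed in the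
  induction, all spaces are embedded into the following type, which is closed under pairing.
\<close>

datatype ('k, 'a) univ =
    Atom 'a
  | Scal (unscal: 'k)
  | Pr (lft: "('k, 'a) univ") (rgt: "('k, 'a) univ")

definition uscal :: "('k::topological_field, ('k, 'a) univ) tvs" where
  "uscal = map_tvs Scal scalar_tvs"

definition uprod ::
    "('k::topological_field, ('k, 'a) univ) tvs \<Rightarrow> ('k, ('k, 'a) univ) tvs \<Rightarrow> ('k, ('k, 'a) univ) tvs"
  where "uprod V W = map_tvs (\<lambda>(x, y). Pr x y) (prod_tvs V W)"

lemma inj_Scal: "inj Scal"
  by (simp add: inj_def)

lemma inj_Pr: "inj (\<lambda>(x, y). Pr x y)"
  by (auto simp: inj_def)

lemma inv_Pr: "inv_into UNIV (\<lambda>(x, y). Pr x y) (Pr x y) = (x, y)"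
  using inv_f_f [OF inj_Pr, of "(x, y)"] by simp

lemma carrier_uscal: "carrier uscal = range Scal"
  by (simp add: uscal_def)

lemma Scal_in_uscal [simp]: "Scal t \<in> carrier uscal"
  by (simp add: carrier_uscal)

lemma add_uscal [simp]: "Scal s \<oplus>\<^bsub>uscal\<^esub> Scal t = Scal (s + t)"
  and smult_uscal [simp]: "s \<odot>\<^bsub>uscal\<^esub> Scal t = Scal (s * t)"
  by (simp_all add: uscal_def inj_Scal)

lemma carrier_uprod: "carrier (uprod V W) = {Pr x y | x y. x \<in> carrier V \<and> y \<in> carrier W}"
  by (auto simp: uprod_def)

lemma Pr_in_uprod [simp]: "Pr x y \<in> carrier (uprod V W) \<longleftrightarrow> x \<in> carrier V \<and> y \<in> carrier W"
  by (auto simp: carrier_uprod)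

lemma add_uprod [simp]: "Pr x y \<oplus>\<^bsub>uprod V W\<^esub> Pr x' y' = Pr (x \<oplus>\<^bsub>V\<^esub> x') (y \<oplus>\<^bsub>W\<^esub> y')"
  by (simp add: uprod_def map_tvs_def inv_Pr)

lemma smult_uprod [simp]: "c \<odot>\<^bsub>uprod V W\<^esub> Pr x y = Pr (c \<odot>\<^bsub>V\<^esub> x) (c \<odot>\<^bsub>W\<^esub> y)"
  by (simp add: uprod_def map_tvs_def inv_Pr)

lemma tvs_uscal: "topological_vector_space uscal"
  unfolding uscal_def by (intro tvs_map tvs_scalar inj_Scal)

lemma tvs_uprod:
  "topological_vector_space V \<Longrightarrow> topological_vector_space W \<Longrightarrow> topological_vector_space (uprod V W)"
  unfolding uprod_def by (intro tvs_map tvs_prod inj_Pr)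

lemma continuous_map_Scal:
  "continuous_map S euclidean c \<Longrightarrow> continuous_map S (vtop uscal) (\<lambda>s. Scal (c s))"
  unfolding uscal_def by (rule continuous_map_into_map_tvs) (auto simp: inj_Scal)

lemma continuous_map_unscal:
  assumes "continuous_map S (vtop uscal) f"
  shows "continuous_map S euclidean (\<lambda>s. unscal (f s))"
proof -
  have c: "continuous_map S euclidean (\<lambda>s. inv_into UNIV Scal (f s))"
    using continuous_map_compose [OF assms [unfolded uscal_def] continuous_map_inv_map_tvs [OF inj_Scal]]
    by (simp add: o_def)
  moreover have "f s \<in> range Scal" if "s \<in> topspace S" for s
    using assms that topological_vector_space.topspace_vtop [OF tvs_uscal] carrier_uscal
    by (metis continuous_map_funspace Pi_iff)
  ultimately show ?thesis
    by (intro continuous_map_eq [OF c]) (fastforce simp: inj_Scal)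
qed

lemma continuous_map_Pr:
  assumes "topological_vector_space V" "topological_vector_space W"
    and "continuous_map S (vtop V) f" "continuous_map S (vtop W) g"
  shows "continuous_map S (vtop (uprod V W)) (\<lambda>s. Pr (f s) (g s))"
proof -
  have "topspace (vtop (prod_tvs V W)) = carrier (prod_tvs V W)"
    using topological_vector_space.topspace_vtop [OF tvs_prod] assms by blast
  then show ?thesis
    using continuous_map_into_map_tvs [OF inj_Pr, of "prod_tvs V W" S "\<lambda>s. (f s, g s)"] assms
    by (simp add: uprod_def continuous_map_paired)
qed

lemma
  assumes "topological_vector_space V" "topological_vector_space W"
    and f: "continuous_map S (vtop (uprod V W)) f"
  shows continuous_map_lft: "continuous_map S (vtop V) (\<lambda>s. lft (f s))"
    and continuous_map_rgt: "continuous_map S (vtop W) (\<lambda>s. rgt (f s))"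
proof -
  let ?h = "\<lambda>(x, y). Pr x y"
  have c: "continuous_map S (prod_topology (vtop V) (vtop W)) (\<lambda>s. inv_into UNIV ?h (f s))"
    using continuous_map_compose [OF f [unfolded uprod_def] continuous_map_inv_map_tvs [OF inj_Pr]]
    by (simp add: o_def)
  have "f s \<in> carrier (uprod V W)" if "s \<in> topspace S" for s
    using f that topological_vector_space.topspace_vtop [OF tvs_uprod] assms(1,2)
    by (metis continuous_map_funspace Pi_iff)
  then have *: "\<exists>x y. f s = Pr x y" if "s \<in> topspace S" for s
    using that by (force simp: carrier_uprod)
  show "continuous_map S (vtop V) (\<lambda>s. lft (f s))"
    by (rule continuous_map_eq [OF continuous_map_fst' [OF c]]) (auto dest!: * simp: inv_Pr)
  show "continuous_map S (vtop W) (\<lambda>s. rgt (f s))"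
    by (rule continuous_map_eq [OF continuous_map_snd' [OF c]]) (auto dest!: * simp: inv_Pr)
qed

section \<open>The domain of the first difference quotient inside \<open>univ\<close>\<close>

abbreviation tr :: "('k, 'a) univ \<Rightarrow> ('k, 'a) univ \<Rightarrow> 'k \<Rightarrow> ('k, 'a) univ" where
  "tr x y t \<equiv> Pr x (Pr y (Scal t))"

text \<open>The ambient space of \<open>U^[1]\<close>; \<open>udom V U\<close> below is
  \<open>U^[1]\<close> itself.\<close>

definition ubr :: "('k::topological_field, ('k, 'a) univ) tvs \<Rightarrow> ('k, ('k, 'a) univ) tvs" where
  "ubr V = uprod V (uprod V uscal)"

definition udom ::
    "('k::topological_field, ('k, 'a) univ) tvs \<Rightarrow> ('k, 'a) univ set \<Rightarrow> ('k, 'a) univ set" where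
  "udom V U = {tr x y t | x y t. x \<in> U \<and> y \<in> carrier V \<and> comb V x t y \<in> U}"

lemma tr_in_udom [simp]:
  "tr x y t \<in> udom V U \<longleftrightarrow> x \<in> U \<and> y \<in> carrier V \<and> comb V x t y \<in> U"
  by (auto simp: udom_def)

lemma carrier_ubr: "carrier (ubr V) = {tr x y t | x y t. x \<in> carrier V \<and> y \<in> carrier V}"
  by (auto simp: ubr_def carrier_uprod carrier_uscal)

lemma tvs_ubr: "topological_vector_space V \<Longrightarrow> topological_vector_space (ubr V)"
  unfolding ubr_def by (intro tvs_uprod tvs_uscal)

lemma udom_subset: "U \<subseteq> carrier V \<Longrightarrow> udom V U \<subseteq> carrier (ubr V)"
  by (auto simp: udom_def carrier_ubr)

lemma udom_mono: "U' \<subseteq> U \<Longrightarrow> udom V U' \<subseteq> udom V U"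
  by (auto simp: udom_def)

lemma
  assumes V: "topological_vector_space V" and f: "continuous_map S (vtop (ubr V)) f"
  shows continuous_map_ubr_lft: "continuous_map S (vtop V) (\<lambda>s. lft (f s))"
    and continuous_map_ubr_mid: "continuous_map S (vtop V) (\<lambda>s. lft (rgt (f s)))"
    and continuous_map_ubr_rgt: "continuous_map S (vtop uscal) (\<lambda>s. rgt (rgt (f s)))"
    and continuous_map_ubr_scal: "continuous_map S euclidean (\<lambda>s. unscal (rgt (rgt (f s))))"
proof -
  note f' = f [unfolded ubr_def]
  note r = continuous_map_rgt [OF V tvs_uprod [OF V tvs_uscal] f']
  show "continuous_map S (vtop V) (\<lambda>s. lft (f s))"
    by (rule continuous_map_lft [OF V tvs_uprod [OF V tvs_uscal] f'])
  show "continuous_map S (vtop V) (\<lambda>s. lft (rgt (f s)))"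
    by (rule continuous_map_lft [OF V tvs_uscal r])
  show "continuous_map S (vtop uscal) (\<lambda>s. rgt (rgt (f s)))"
    by (rule continuous_map_rgt [OF V tvs_uscal r])
  then show "continuous_map S euclidean (\<lambda>s. unscal (rgt (rgt (f s))))"
    by (rule continuous_map_unscal)
qed

lemma continuous_map_tr:
  assumes "topological_vector_space V" "continuous_map S (vtop V) f" "continuous_map S (vtop V) g"
    "continuous_map S euclidean c"
  shows "continuous_map S (vtop (ubr V)) (\<lambda>s. tr (f s) (g s) (c s))"
  unfolding ubr_def using assms
  by (intro continuous_map_Pr continuous_map_Scal tvs_uprod tvs_uscal)

lemma openin_udom:
  assumes V: "topological_vector_space V" and U: "openin (vtop V) U"
  shows "openin (vtop (ubr V)) (udom V U)"
proof -
  interpret V: topological_vector_space V by fact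
  interpret D: topological_vector_space "ubr V" by (rule tvs_ubr [OF V])
  note c = continuous_map_ident [of "vtop (ubr V)"]
  have "continuous_map (vtop (ubr V)) (vtop V) (\<lambda>p. comb V (lft p) (unscal (rgt (rgt p))) (lft (rgt p)))"
    by (intro V.continuous_map_add V.continuous_map_smult continuous_map_ubr_lft [OF V c]
        continuous_map_ubr_mid [OF V c] continuous_map_ubr_scal [OF V c])
  from openin_continuous_map_preimage [OF this U]
    openin_continuous_map_preimage [OF continuous_map_ubr_lft [OF V c] U]
  have "openin (vtop (ubr V))
     ({p \<in> topspace (vtop (ubr V)). comb V (lft p) (unscal (rgt (rgt p))) (lft (rgt p)) \<in> U} \<inter>
      {p \<in> topspace (vtop (ubr V)). lft p \<in> U})" (is "openin _ ?A")
    by (rule openin_Int)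
  moreover have "?A = udom V U"
    using V.open_subset_carrier [OF U] by (auto simp: D.topspace_vtop carrier_ubr udom_def)
  ultimately show ?thesis by simp
qed

text \<open>Clearing the denominator makes the condition vacuous at \<open>t = 0\<close>.\<close>

definition quot_eq ::
    "('k::topological_field, ('k, 'a) univ) tvs \<Rightarrow> ('k, 'a) univ set \<Rightarrow> ('k, 'f) tvs
      \<Rightarrow> (('k, 'a) univ \<Rightarrow> 'f) \<Rightarrow> (('k, 'a) univ \<Rightarrow> 'f) \<Rightarrow> bool" where
  "quot_eq V U F f g \<longleftrightarrow>
     (\<forall>x\<in>U. \<forall>y\<in>carrier V. \<forall>t. comb V x t y \<in> U \<longrightarrow>
        f (comb V x t y) = comb F (f x) t (g (tr x y t)))"

text \<open>The recursion runs over the first quotient, opposite to \<open>Cn_map\<close>, which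
  adds a condition on the last one; \<open>C1_chain_iff_CN\<close> reconciles the two. Only the
  existence of a quotient is asked for, and values outside \<open>U\<close> and \<open>U^[1]\<close>
  are left free, so that witnesses can be plain formulas.\<close>

primrec CN ::
    "nat \<Rightarrow> ('k::topological_field, ('k, 'a) univ) tvs \<Rightarrow> ('k, 'a) univ set \<Rightarrow> ('k, 'f) tvs
      \<Rightarrow> (('k, 'a) univ \<Rightarrow> 'f) \<Rightarrow> bool" where
  "CN 0 V U F f \<longleftrightarrow> cont_on V U F f"
| "CN (Suc n) V U F f \<longleftrightarrow> cont_on V U F f \<and>
     (\<exists>g. quot_eq V U F f g \<and> CN n (ubr V) (udom V U) F g)"

section \<open>Linear maps and the chain rule for \<open>CN\<close>\<close>

lemma CN_cont: "CN n V U F f \<Longrightarrow> cont_on V U F f"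
  by (cases n) auto

lemma CN_cong:
  assumes "CN n V U F f" "\<And>x. x \<in> U \<Longrightarrow> f x = f' x"
  shows "CN n V U F f'"
proof (cases n)
  case 0
  then show ?thesis using assms by (auto intro: continuous_map_eq)
next
  case (Suc m)
  then obtain g where "quot_eq V U F f g" "CN m (ubr V) (udom V U) F g"
    using assms by auto
  moreover from this have "quot_eq V U F f' g"
    using assms(2) by (simp add: quot_eq_def)
  moreover have "cont_on V U F f'"
    by (rule continuous_map_eq [OF CN_cont [OF assms(1)]]) (use assms(2) in auto)
  ultimately show ?thesis using Suc by auto
qed

lemma CN_maps:
  assumes "CN n V U F f" "topspace (vtop V) = carrier V" "topspace (vtop F) = carrier F"
    "U \<subseteq> carrier V" "x \<in> U"
  shows "f x \<in> carrier F"
  using CN_cont [OF assms(1)] assms(2-) by (fastforce simp: continuous_map_def)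

lemma CN_SucD: "CN (Suc n) V U F f \<Longrightarrow> CN n V U F f"
proof (induction n arbitrary: V U f)
  case (Suc n)
  then show ?case by (metis CN.simps(2))
qed auto

text \<open>\<open>U'^[1]\<close> lies in \<open>U^[1]\<close>, so a quotient on the larger set
  serves on the smaller one.\<close>

lemma CN_subset:
  "CN n V U F f \<Longrightarrow> U' \<subseteq> U \<Longrightarrow> CN n V U' F f"
proof (induction n arbitrary: V U U' f)
  case 0
  then show ?case by (auto intro: continuous_map_from_subtopology_mono)
next
  case (Suc n)
  then obtain g where g: "quot_eq V U F f g" "CN n (ubr V) (udom V U) F g"
    by auto
  then have "quot_eq V U' F f g"
    using Suc.prems(2) unfolding quot_eq_def by blast
  moreover have "CN n (ubr V) (udom V U') F g"
    using Suc.IH g(2) udom_mono Suc.prems(2) by blast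
  moreover have "cont_on V U' F f"
    using CN_cont [OF Suc.prems(1)] Suc.prems(2) by (rule continuous_map_from_subtopology_mono)
  ultimately show ?case by auto
qed

text \<open>The quotient of a linear map at \<open>(x, y, t)\<close> is \<open>L y\<close>, which is
  again linear in the triple, so the induction closes.\<close>

lemma CN_linear:
  assumes "topological_vector_space V"
    and "continuous_map (vtop V) (vtop F) L"
    and "\<And>x y t. x \<in> carrier V \<Longrightarrow> y \<in> carrier V \<Longrightarrow>
          L (comb V x t y) = comb F (L x) t (L y)"
    and "U \<subseteq> carrier V"
  shows "CN n V U F L"
  using assms
proof (induction n arbitrary: V U L)
  case 0
  then show ?case by (simp add: continuous_map_from_subtopology)
next
  case (Suc n)
  let ?g = "\<lambda>p. L (lft (rgt p))"
  have "quot_eq V U F L ?g"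
    using Suc.prems by (auto simp: quot_eq_def)
  moreover have "CN n (ubr V) (udom V U) F ?g"
  proof (rule Suc.IH)
    show "continuous_map (vtop (ubr V)) (vtop F) ?g"
      using continuous_map_compose [OF continuous_map_ubr_mid [OF Suc.prems(1) continuous_map_ident] Suc.prems(2)]
      by (simp add: o_def)
    show "?g (comb (ubr V) p t q) = comb F (?g p) t (?g q)"
      if "p \<in> carrier (ubr V)" "q \<in> carrier (ubr V)" for p q t
      using that Suc.prems(3) by (auto simp: carrier_ubr) (auto simp: ubr_def)
  qed (use Suc.prems tvs_ubr udom_subset in blast)+
  ultimately show ?case
    using Suc.prems(2) by (auto intro: continuous_map_from_subtopology)
qed

lemma
  assumes V: "topological_vector_space V" and W: "topological_vector_space W"
    and U: "U \<subseteq> carrier (uprod V W)"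
  shows CN_lft: "CN n (uprod V W) U V lft" and CN_rgt: "CN n (uprod V W) U W rgt"
proof -
  note cm = continuous_map_lft [OF V W continuous_map_ident] continuous_map_rgt [OF V W continuous_map_ident]
  show "CN n (uprod V W) U V lft" "CN n (uprod V W) U W rgt"
    by (rule CN_linear [OF tvs_uprod [OF V W] _ _ U], rule cm, auto simp: carrier_uprod)+
qed

lemma
  assumes V: "topological_vector_space V" and U: "U \<subseteq> carrier (ubr V)"
  shows CN_ubr_lft: "CN n (ubr V) U V lft"
    and CN_ubr_mid: "CN n (ubr V) U V (\<lambda>p. lft (rgt p))"
    and CN_ubr_rgt: "CN n (ubr V) U uscal (\<lambda>p. rgt (rgt p))"
proof -
  note cm = continuous_map_ubr_lft [OF V continuous_map_ident]
    continuous_map_ubr_mid [OF V continuous_map_ident] continuous_map_ubr_rgt [OF V continuous_map_ident]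
  have add: "comb (ubr V) (tr x y t) s (tr x' y' t') = tr (comb V x s x') (comb V y s y') (t + s * t')"
    for x y t s x' y' t'
    by (simp add: ubr_def)
  show "CN n (ubr V) U V lft" "CN n (ubr V) U V (\<lambda>p. lft (rgt p))" "CN n (ubr V) U uscal (\<lambda>p. rgt (rgt p))"
    by (rule CN_linear [OF tvs_ubr [OF V] _ _ U], rule cm, auto simp: carrier_ubr add)+
qed

text \<open>A constant need not be linear, but its quotient is the zero map, which is;
  \<open>CN_linear\<close> takes over after one step.\<close>

lemma CN_const:
  assumes "topological_vector_space V" "topological_vector_space F" "U \<subseteq> carrier V" "c \<in> carrier F"
  shows "CN n V U F (\<lambda>_. c)"
proof (cases n)
  case 0
  then show ?thesis
    using assms topological_vector_space.topspace_vtop by (auto simp: continuous_map_const)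
next
  case (Suc m)
  interpret F: topological_vector_space F by fact
  have c: "continuous_map S (vtop F) (\<lambda>_. v)" if "v \<in> carrier F" for S :: "('a, 'b) univ topology" and v
    using that F.topspace_vtop by simp
  have "quot_eq V U F (\<lambda>_. c) (\<lambda>_. \<zero>\<^bsub>F\<^esub>)"
    using assms by (simp add: quot_eq_def)
  moreover have "CN m (ubr V) (udom V U) F (\<lambda>_. \<zero>\<^bsub>F\<^esub>)"
    using assms by (intro CN_linear c tvs_ubr udom_subset) auto
  ultimately show ?thesis
    using c assms Suc by auto
qed

lemma CN_Pr:
  assumes "topological_vector_space F" "topological_vector_space G"
    and "CN n V U F f" "CN n V U G g"
  shows "CN n V U (uprod F G) (\<lambda>p. Pr (f p) (g p))"
  using assms(3,4)
proof (induction n arbitrary: V U f g)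
  case 0
  then show ?case using assms by (auto intro: continuous_map_Pr)
next
  case (Suc n)
  then obtain f' g' where *: "quot_eq V U F f f'" "CN n (ubr V) (udom V U) F f'"
     "quot_eq V U G g g'" "CN n (ubr V) (udom V U) G g'"
    by auto
  then have "quot_eq V U (uprod F G) (\<lambda>p. Pr (f p) (g p)) (\<lambda>p. Pr (f' p) (g' p))"
    by (simp add: quot_eq_def)
  moreover have "cont_on V U (uprod F G) (\<lambda>p. Pr (f p) (g p))"
    using CN_cont Suc.prems assms by (intro continuous_map_Pr) auto
  ultimately show ?case using Suc.IH * by auto
qed

text \<open>For a linear inner map the quotient is \<open>g'\<close> after
  \<open>(x, y, t) \<mapsto> (L x, L y, t)\<close>, and this inner map is linear again. The general
  chain rule draws on this case: it needs \<open>f\<close> after \<open>lft\<close>, a map into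
  \<open>W\<close>, whereas its own induction hypothesis speaks about the fixed target
  \<open>F\<close>.\<close>

lemma CN_compose_linear:
  fixes V W :: "('k::topological_field, ('k, 'a) univ) tvs"
  assumes "topological_vector_space W" "CN n W U' F g" "U' \<subseteq> carrier W"
    and "topological_vector_space V" "continuous_map (vtop V) (vtop W) L"
    and "\<And>x y t. x \<in> carrier V \<Longrightarrow> y \<in> carrier V \<Longrightarrow>
          L (comb V x t y) = comb W (L x) t (L y)"
    and "U \<subseteq> carrier V" "\<And>x. x \<in> U \<Longrightarrow> L x \<in> U'"
  shows "CN n V U F (\<lambda>x. g (L x))"
  using assms
proof (induction n arbitrary: V U W U' L g)
  case 0
  have "continuous_map (subtopology (vtop V) U) (subtopology (vtop W) U') L"
    using 0 by (auto simp: continuous_map_in_subtopology continuous_map_from_subtopology)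
  from continuous_map_compose [OF this] show ?case using 0 by (simp add: o_def)
next
  case (Suc n)
  interpret V: topological_vector_space V by fact
  interpret W: topological_vector_space W by fact
  note LW = continuous_map_funspace [OF Suc.prems(5), unfolded V.topspace_vtop W.topspace_vtop]
  obtain g' where g': "quot_eq W U' F g g'" "CN n (ubr W) (udom W U') F g'"
    using Suc.prems by auto
  define L' where "L' = (\<lambda>p. tr (L (lft p)) (L (lft (rgt p))) (unscal (rgt (rgt p))))"
  have "CN n (ubr V) (udom V U) F (\<lambda>x. g' (L' x))"
  proof (rule Suc.IH [OF _ g'(2)])
    show "continuous_map (vtop (ubr V)) (vtop (ubr W)) L'"
      unfolding L'_def
      using continuous_map_compose [OF continuous_map_ubr_lft [OF Suc.prems(4) continuous_map_ident] Suc.prems(5)]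
        continuous_map_compose [OF continuous_map_ubr_mid [OF Suc.prems(4) continuous_map_ident] Suc.prems(5)]
      by (intro continuous_map_tr Suc.prems continuous_map_ubr_scal [OF Suc.prems(4) continuous_map_ident])
        (simp_all add: o_def)
    show "L' (comb (ubr V) p t q) = comb (ubr W) (L' p) t (L' q)"
      if "p \<in> carrier (ubr V)" "q \<in> carrier (ubr V)" for p q t
      using that Suc.prems(6) unfolding carrier_ubr L'_def by (auto simp: ubr_def)
    show "L' p \<in> udom W U'" if "p \<in> udom V U" for p
    proof -
      obtain x y t where p: "p = tr x y t" "x \<in> U" "y \<in> carrier V" "comb V x t y \<in> U"
        using \<open>p \<in> udom V U\<close> unfolding udom_def by blast
      then have "comb W (L x) t (L y) \<in> U'"
        using Suc.prems(6) [of x y t] Suc.prems(7) Suc.prems(8) [of "comb V x t y"] by auto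
      then show ?thesis
        using p Suc.prems(8) LW by (auto simp: L'_def)
    qed
  qed (use Suc.prems tvs_ubr udom_subset in blast)+
  moreover have "quot_eq V U F (\<lambda>x. g (L x)) (\<lambda>x. g' (L' x))"
    unfolding quot_eq_def
  proof (intro ballI allI impI)
    fix x y t assume p: "x \<in> U" "y \<in> carrier V" "comb V x t y \<in> U"
    then have "L (comb V x t y) = comb W (L x) t (L y)" "L y \<in> carrier W"
      "L x \<in> U'" "L (comb V x t y) \<in> U'"
      using Suc.prems(6,7,8) LW by auto
    then show "g (L (comb V x t y)) = comb F (g (L x)) t (g' (L' (tr x y t)))"
      using g'(1) unfolding quot_eq_def L'_def by simp
  qed
  moreover have "cont_on V U F (\<lambda>x. g (L x))"
  proof -
    have "continuous_map (subtopology (vtop V) U) (subtopology (vtop W) U') L"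
      using Suc.prems by (auto simp: continuous_map_in_subtopology continuous_map_from_subtopology)
    from continuous_map_compose [OF this] show ?thesis
      using CN_cont [OF Suc.prems(2)] by (simp add: o_def)
  qed
  ultimately show ?case by auto
qed

text \<open>The quotient of \<open>g\<close> after \<open>f\<close> at \<open>(x, y, t)\<close> is
  \<open>g'(f x, f'(x, y, t), t)\<close>. The inner triple is \<open>q\<close>; it lands in the
  domain of \<open>g'\<close> because \<open>f(x + t y) = f x + t f'(x, y, t)\<close>, and it has
  order \<open>n\<close>, so the induction hypothesis applies to \<open>g'\<close> after
  \<open>q\<close>.\<close>

lemma CN_compose:
  fixes V W :: "('k::topological_field, ('k, 'a) univ) tvs"
  assumes "topological_vector_space V" "topological_vector_space W"
    and "CN n V U W f" "CN n W U' F g"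
    and "U \<subseteq> carrier V" "U' \<subseteq> carrier W" "\<And>x. x \<in> U \<Longrightarrow> f x \<in> U'"
  shows "CN n V U F (\<lambda>x. g (f x))"
  using assms
proof (induction n arbitrary: V U W U' f g)
  case 0
  have "continuous_map (subtopology (vtop V) U) (subtopology (vtop W) U') f"
    using 0 by (auto simp: continuous_map_in_subtopology)
  from continuous_map_compose [OF this] show ?case using 0 by (simp add: o_def)
next
  case (Suc n)
  interpret V: topological_vector_space V by fact
  interpret W: topological_vector_space W by fact
  have fW: "f x \<in> carrier W" if "x \<in> U" for x
    using CN_maps [OF Suc.prems(3)] V.topspace_vtop W.topspace_vtop Suc.prems(5) that by blast
  obtain f' g' where f': "quot_eq V U W f f'" "CN n (ubr V) (udom V U) W f'"
    and g': "quot_eq W U' F g g'" "CN n (ubr W) (udom W U') F g'"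
    using Suc.prems by auto
  define q where "q = (\<lambda>p. Pr (f (lft p)) (Pr (f' p) (rgt (rgt p))))"
  note tvs = tvs_ubr [OF Suc.prems(1)] tvs_ubr [OF Suc.prems(2)]
  have sub: "udom V U \<subseteq> carrier (ubr V)" "udom W U' \<subseteq> carrier (ubr W)"
    using Suc.prems udom_subset by blast+
  have f'W: "f' p \<in> carrier W" if "p \<in> udom V U" for p
    using CN_maps [OF f'(2)] that sub topological_vector_space.topspace_vtop tvs W.topspace_vtop by blast
  have q_mem: "q p \<in> udom W U'" if mem: "p \<in> udom V U" for p
  proof -
    obtain x y t where p: "p = tr x y t" "x \<in> U" "y \<in> carrier V" "comb V x t y \<in> U"
      using mem unfolding udom_def by blast
    then have "comb W (f x) t (f' p) = f (comb V x t y)"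
      using f'(1) by (simp add: quot_eq_def)
    then show ?thesis
      using p f'W [OF mem] Suc.prems(7) by (simp add: q_def)
  qed
  have "CN n (ubr V) (udom V U) W (\<lambda>p. f (lft p))"
  proof (rule CN_compose_linear [OF Suc.prems(1) CN_SucD [OF Suc.prems(3)] Suc.prems(5) tvs(1)])
    show "continuous_map (vtop (ubr V)) (vtop V) lft"
      by (rule continuous_map_ubr_lft [OF Suc.prems(1) continuous_map_ident])
    show "lft (comb (ubr V) p t q) = comb V (lft p) t (lft q)"
      if "p \<in> carrier (ubr V)" "q \<in> carrier (ubr V)" for p q t
      using that unfolding carrier_ubr by (auto simp: ubr_def)
  qed (use sub in \<open>auto simp: udom_def\<close>)
  moreover have "CN n (ubr V) (udom V U) uscal (\<lambda>p. rgt (rgt p))"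
    using Suc.prems(1) sub(1) by (rule CN_ubr_rgt)
  ultimately have "CN n (ubr V) (udom V U) (ubr W) q"
    unfolding q_def ubr_def [of W] using f'(2) Suc.prems
    by (intro CN_Pr tvs_uprod tvs_uscal)
  then have "CN n (ubr V) (udom V U) F (\<lambda>p. g' (q p))"
    using Suc.IH [OF tvs _ g'(2) sub, of q] q_mem by blast
  moreover have "quot_eq V U F (\<lambda>x. g (f x)) (\<lambda>p. g' (q p))"
    unfolding quot_eq_def
  proof (intro ballI allI impI)
    fix x y t assume p: "x \<in> U" "y \<in> carrier V" "comb V x t y \<in> U"
    then have e: "f (comb V x t y) = comb W (f x) t (f' (tr x y t))"
      using f'(1) by (simp add: quot_eq_def)
    moreover have "f' (tr x y t) \<in> carrier W" using p f'W by simp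
    moreover have "f x \<in> U'" "f (comb V x t y) \<in> U'" using p Suc.prems(7) by auto
    ultimately show "g (f (comb V x t y)) = comb F (g (f x)) t (g' (q (tr x y t)))"
      using g'(1) unfolding quot_eq_def q_def by simp
  qed
  moreover have "cont_on V U F (\<lambda>x. g (f x))"
  proof -
    have "continuous_map (subtopology (vtop V) U) (subtopology (vtop W) U') f"
      using Suc.prems CN_cont by (auto simp: continuous_map_in_subtopology)
    from continuous_map_compose [OF this] show ?thesis
      using CN_cont [OF Suc.prems(4)] by (simp add: o_def)
  qed
  ultimately show ?case by auto
qed


section \<open>Sums, scalar multiples and inverses\<close>

lemma CN_comp_add:
  fixes V F :: "('k::topological_field, ('k, 'a) univ) tvs"
  assumes V: "topological_vector_space V" and F: "topological_vector_space F" and "U \<subseteq> carrier V"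
    and "CN n V U F f" "CN n V U F g"
  shows "CN n V U F (\<lambda>p. f p \<oplus>\<^bsub>F\<^esub> g p)"
proof -
  interpret F: topological_vector_space F by fact
  interpret V: topological_vector_space V by fact
  let ?P = "uprod F F" and ?A = "\<lambda>p. lft p \<oplus>\<^bsub>F\<^esub> rgt p"
  have "CN n ?P (carrier ?P) F ?A"
  proof (rule CN_linear)
    show "continuous_map (vtop ?P) (vtop F) ?A"
      by (intro F.continuous_map_add continuous_map_lft [OF F F] continuous_map_rgt [OF F F] continuous_map_ident)
    show "?A (comb ?P p t q) = comb F (?A p) t (?A q)"
      if "p \<in> carrier ?P" "q \<in> carrier ?P" for p q t
      using that F.comb_add_comb by (auto simp: carrier_uprod)
  qed (auto intro: tvs_uprod F)
  moreover have "f p \<in> carrier F" "g p \<in> carrier F" if "p \<in> U" for p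
    using CN_maps assms V.topspace_vtop F.topspace_vtop that by blast+
  ultimately show ?thesis
    using CN_compose [OF V tvs_uprod [OF F F] CN_Pr [OF F F assms(4,5)], of "carrier ?P" F ?A] assms
    by simp
qed

text \<open>By \<open>smult_comb\<close> the quotient consists of sums and further scalar
  multiplications, whose order \<open>n\<close> is the induction hypothesis.\<close>

lemma CN_smult:
  fixes F :: "('k::topological_field, ('k, 'a) univ) tvs"
  assumes F: "topological_vector_space F"
  shows "U \<subseteq> carrier (uprod uscal F) \<Longrightarrow> CN n (uprod uscal F) U F (\<lambda>p. unscal (lft p) \<odot>\<^bsub>F\<^esub> rgt p)"
proof (induction n arbitrary: U)
  let ?P = "uprod uscal F" and ?M = "\<lambda>p. unscal (lft p) \<odot>\<^bsub>F\<^esub> rgt p"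
  interpret F: topological_vector_space F by fact
  note P = tvs_uprod [OF tvs_uscal F]
  have cont: "continuous_map (vtop ?P) (vtop F) ?M"
    by (intro F.continuous_map_smult continuous_map_unscal continuous_map_lft [OF tvs_uscal F]
        continuous_map_rgt [OF tvs_uscal F] continuous_map_ident)
  case 0
  show ?case using cont by (simp add: continuous_map_from_subtopology)
  case (Suc n)
  let ?D = "ubr ?P" and ?dU = "udom ?P U"
  have dU: "?dU \<subseteq> carrier ?D" by (rule udom_subset [OF Suc.prems])
  define m where "m = (\<lambda>(a :: ('k, 'a) univ) b. unscal a \<odot>\<^bsub>F\<^esub> b)"
  \<comment> \<open>The induction hypothesis on the whole product space, composed with a pair of
    maps, gives products of maps of order \<open>n\<close>.\<close>
  have comp: "CN n ?D ?dU F (\<lambda>p. m (a p) (b p))"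
    if ab: "CN n ?D ?dU uscal a" "CN n ?D ?dU F b" for a b
  proof -
    have "a p \<in> carrier uscal" "b p \<in> carrier F" if "p \<in> ?dU" for p
      using CN_maps [OF _ _ _ dU that] ab topological_vector_space.topspace_vtop
        F.topspace_vtop tvs_uscal tvs_ubr [OF P] by blast+
    then show ?thesis
      using CN_compose [OF tvs_ubr [OF P] P CN_Pr [OF tvs_uscal F ab] Suc.IH [OF order_refl] dU order_refl]
      by (simp add: m_def)
  qed
  have mem: "lft p \<in> carrier ?P" "lft (rgt p) \<in> carrier ?P" if "p \<in> ?dU" for p
    using that dU by (auto simp: carrier_ubr)
  have l: "CN n ?D ?dU uscal (\<lambda>p. lft (lft p))"
    by (rule CN_compose [OF tvs_ubr [OF P] P CN_ubr_lft [OF P dU] CN_lft [OF tvs_uscal F order_refl] dU order_refl mem(1)])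
  have r: "CN n ?D ?dU F (\<lambda>p. rgt (lft p))"
    by (rule CN_compose [OF tvs_ubr [OF P] P CN_ubr_lft [OF P dU] CN_rgt [OF tvs_uscal F order_refl] dU order_refl mem(1)])
  have l': "CN n ?D ?dU uscal (\<lambda>p. lft (lft (rgt p)))"
    by (rule CN_compose [OF tvs_ubr [OF P] P CN_ubr_mid [OF P dU] CN_lft [OF tvs_uscal F order_refl] dU order_refl mem(2)])
  have r': "CN n ?D ?dU F (\<lambda>p. rgt (lft (rgt p)))"
    by (rule CN_compose [OF tvs_ubr [OF P] P CN_ubr_mid [OF P dU] CN_rgt [OF tvs_uscal F order_refl] dU order_refl mem(2)])
  note t = CN_ubr_rgt [OF P dU]
  let ?g = "\<lambda>p. m (lft (lft p)) (rgt (lft (rgt p))) \<oplus>\<^bsub>F\<^esub>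
      m (lft (lft (rgt p))) (rgt (lft p) \<oplus>\<^bsub>F\<^esub> m (rgt (rgt p)) (rgt (lft (rgt p))))"
  have "CN n ?D ?dU F ?g"
    by (intro CN_comp_add comp l r l' r' t tvs_ubr [OF P] F dU)
  moreover have "quot_eq ?P U F ?M ?g"
    unfolding quot_eq_def m_def using Suc.prems F.smult_comb
    by (auto simp: carrier_uprod carrier_uscal subset_iff)
  ultimately show ?case
    using cont by (auto intro: continuous_map_from_subtopology)
qed

lemma CN_comp_smult:
  fixes V F :: "('k::topological_field, ('k, 'a) univ) tvs"
  assumes V: "topological_vector_space V" and F: "topological_vector_space F" and U: "U \<subseteq> carrier V"
    and c: "CN n V U (uscal :: ('k, ('k, 'a) univ) tvs) c" and f: "CN n V U F f"
  shows "CN n V U F (\<lambda>p. unscal (c p) \<odot>\<^bsub>F\<^esub> f p)"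
proof -
  interpret F: topological_vector_space F by fact
  interpret V: topological_vector_space V by fact
  have "c p \<in> carrier uscal" "f p \<in> carrier F" if "p \<in> U" for p
    using CN_maps [OF c] CN_maps [OF f] U V.topspace_vtop F.topspace_vtop that
      topological_vector_space.topspace_vtop [OF tvs_uscal] by blast+
  then show ?thesis
    using CN_compose [OF V tvs_uprod [OF tvs_uscal F] CN_Pr [OF tvs_uscal F c f]
        CN_smult [OF F order_refl] U order_refl] by simp
qed

lemma inverse_add_eq:
  fixes x y t :: "'k::field"
  assumes "x \<noteq> 0" "x + t * y \<noteq> 0"
  shows "inverse (x + t * y) = inverse x + t * (inverse x * (inverse (x + t * y) * - y))"
proof -
  define z where "z = x + t * y"
  have "t * (inverse x * (inverse z * - y)) = inverse x * inverse z * (x - z)"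
    by (simp add: z_def algebra_simps)
  also have "\<dots> = inverse z - inverse x"
    using assms(1,2) [folded z_def] by (simp add: field_simps)
  finally have eq: "t * (inverse x * (inverse z * - y)) = inverse z - inverse x" .
  show ?thesis
    unfolding z_def [symmetric] eq by simp
qed

text \<open>The quotient is \<open>- y / (x (x + t y))\<close>: two inverses, of order
  \<open>n\<close> by induction, times a linear map.\<close>

lemma CN_inverse:
  "CN n (uscal :: ('k::topological_field, ('k, 'a) univ) tvs) (Scal ` (-{0}))
     (uscal :: ('k, ('k, 'a) univ) tvs) (\<lambda>p. Scal (inverse (unscal p)))"
proof (induction n)
  let ?U = "Scal ` (-{0}) :: ('k, 'a) univ set" and ?J = "\<lambda>p :: ('k, 'a) univ. Scal (inverse (unscal p)) :: ('k, 'a) univ"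
  let ?K = "uscal :: ('k, ('k, 'a) univ) tvs"
  have ts: "topspace (vtop ?K) = range Scal"
    using topological_vector_space.topspace_vtop [OF tvs_uscal] carrier_uscal by metis
  have "continuous_map (subtopology (vtop ?K) ?U) euclidean unscal"
    by (intro continuous_map_from_subtopology continuous_map_unscal continuous_map_ident)
  then have cont: "cont_on ?K ?U uscal ?J"
    by (intro continuous_map_Scal continuous_map_scalar_inverse) (auto simp: ts)
  case 0
  show ?case using cont by simp
  case (Suc n)
  let ?D = "ubr ?K" and ?dU = "udom ?K ?U"
  have U: "?U \<subseteq> carrier ?K" by (auto simp: carrier_uscal)
  have dU: "?dU \<subseteq> carrier ?D" by (rule udom_subset [OF U])
  have D: "topological_vector_space ?D" by (rule tvs_ubr [OF tvs_uscal])
  note comp = CN_comp_smult [OF D tvs_uscal dU] and addc = CN_comp_add [OF D tvs_uscal dU]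
  note l = CN_ubr_lft [OF tvs_uscal dU] and m = CN_ubr_mid [OF tvs_uscal dU] and r = CN_ubr_rgt [OF tvs_uscal dU]
  have c: "CN n ?D ?dU ?K (\<lambda>p. comb ?K (lft p) (unscal (rgt (rgt p))) (lft (rgt p)))"
    by (intro addc comp l m r)
  have J1: "CN n ?D ?dU ?K (\<lambda>p. ?J (lft p))"
    by (rule CN_compose [OF D tvs_uscal l Suc.IH dU U]) (auto simp: udom_def)
  have J2: "CN n ?D ?dU ?K (\<lambda>p. ?J (comb ?K (lft p) (unscal (rgt (rgt p))) (lft (rgt p))))"
    by (rule CN_compose [OF D tvs_uscal c Suc.IH dU U]) (auto simp: udom_def)
  have neg: "CN n ?D ?dU ?K (\<lambda>p. (-1) \<odot>\<^bsub>?K\<^esub> lft (rgt p))"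
  proof -
    \<comment> \<open>The number \<open>-1\<close> is written as the constant map
      \<open>Scal (-1)\<close> so that the rule for products of two maps applies.\<close>
    have "CN n ?D ?dU ?K (\<lambda>p. unscal (Scal (-1) :: ('k, 'a) univ) \<odot>\<^bsub>?K\<^esub> lft (rgt p))"
    proof (rule comp [OF _ m])
      show "CN n ?D ?dU ?K (\<lambda>p. Scal (-1))"
        by (rule CN_const) (auto intro: D tvs_uscal dU [THEN subsetD])
    qed
    then show ?thesis by simp
  qed
  let ?g = "\<lambda>p. unscal (?J (lft p)) \<odot>\<^bsub>?K\<^esub> (unscal (?J (comb ?K (lft p) (unscal (rgt (rgt p))) (lft (rgt p))))
     \<odot>\<^bsub>?K\<^esub> ((-1) \<odot>\<^bsub>?K\<^esub> lft (rgt p)))"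
  have "CN n ?D ?dU ?K ?g"
    by (intro comp J1 J2 neg)
  moreover have "quot_eq ?K ?U ?K ?J ?g"
    using inverse_add_eq by (auto simp: quot_eq_def carrier_uscal)
  ultimately show ?case using cont by auto
qed


section \<open>Uniqueness of difference quotients and locality\<close>


text \<open>Translations would make every singleton open, and the field would be discrete.\<close>

lemma not_open_singleton_zero: "\<not> open {0 :: 'k::topological_field}"
proof
  assume *: "open {0 :: 'k}"
  have "open {x}" for x :: 'k
  proof -
    have "open ((\<lambda>y. y - x) -` {0})"
      by (intro open_vimage * continuous_on_diff continuous_on_id continuous_on_const)
    moreover have "(\<lambda>y. y - x) -` {0} = {x}" by auto
    ultimately show ?thesis by simp
  qed
  then have "open (\<Union>x\<in>S. {x})" for S :: "'k set"
    by blast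
  then show False using not_discrete by auto
qed

text \<open>As the field is not discrete, \<open>0\<close> lies in the closure of
  \<open>A - {0}\<close>, and continuous maps into a Hausdorff space that agree on a set agree on
  its closure.\<close>

lemma continuous_maps_eq_at_zero:
  fixes A :: "'k::topological_field set"
  assumes "open A" "0 \<in> A" "Hausdorff_space T"
    and "continuous_map (subtopology euclidean A) T a" "continuous_map (subtopology euclidean A) T b"
    and "\<And>t. t \<in> A \<Longrightarrow> t \<noteq> 0 \<Longrightarrow> a t = b t"
  shows "a 0 = b 0"
proof (rule forall_in_closure_of_eq [OF _ assms(3-5)])
  show "0 \<in> subtopology euclidean A closure_of (A - {0})"
    unfolding in_closure_of
  proof (intro conjI allI impI)
    fix B assume "0 \<in> B \<and> openin (subtopology euclidean A) B"
    then have "open B" "0 \<in> B" "B \<subseteq> A"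
      using assms(1) by (auto simp: openin_open_eq)
    moreover have "B \<noteq> {0}" using \<open>open B\<close> not_open_singleton_zero by auto
    ultimately show "\<exists>y. y \<in> A - {0} \<and> y \<in> B" by auto
  qed (use assms in auto)
qed (use assms in auto)

lemma open_curve_domain:
  assumes "topological_vector_space V" "openin (vtop V) U" "x \<in> carrier V" "y \<in> carrier V"
  shows "open {t. comb V x t y \<in> U}"
proof -
  interpret V: topological_vector_space V by fact
  have "continuous_map euclidean (vtop V) (\<lambda>t. comb V x t y)"
    using assms by (intro V.continuous_map_add V.continuous_map_smult continuous_map_ident)
      (auto simp: V.topspace_vtop)
  from openin_continuous_map_preimage [OF this assms(2)] show ?thesis by simp
qed

text \<open>For \<open>t \<noteq> 0\<close> the equation can be divided by \<open>t\<close>. A point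
  with \<open>t = 0\<close> is reached by letting \<open>s\<close> tend to \<open>0\<close> in
  \<open>(x, y, s)\<close>, which stays in \<open>U^[1]\<close> for small \<open>s\<close> because
  \<open>U\<close> is open.\<close>

lemma quot_eq_unique:
  assumes V: "topological_vector_space V" and F: "topological_vector_space F" and U: "openin (vtop V) U"
    and q: "quot_eq V U F f g" "quot_eq V U F f g'"
    and c: "cont_on (ubr V) (udom V U) F g"
       "cont_on (ubr V) (udom V U) F g'"
    and f: "\<And>x. x \<in> U \<Longrightarrow> f x \<in> carrier F"
    and p: "p \<in> udom V U"
  shows "g p = g' p"
proof -
  interpret V: topological_vector_space V by fact
  interpret F: topological_vector_space F by fact
  note UV = V.open_subset_carrier [OF U]
  obtain x y t where xyt: "p = tr x y t" "x \<in> U" "y \<in> carrier V" "comb V x t y \<in> U"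
    using p unfolding udom_def by blast
  have sub: "udom V U \<subseteq> topspace (vtop (ubr V))"
    using openin_subset [OF openin_udom [OF V U]] .
  have mem: "g r \<in> carrier F" "g' r \<in> carrier F" if "r \<in> udom V U" for r
    using continuous_map_funspace [OF c(1)] continuous_map_funspace [OF c(2)] that sub F.topspace_vtop
    by (auto simp: Pi_iff)
  have nz: "g (tr x y s) = g' (tr x y s)" if "comb V x s y \<in> U" "s \<noteq> 0" for s
  proof (rule F.comb_cancel [of "f x" _ _ s])
    show "comb F (f x) s (g (tr x y s)) = comb F (f x) s (g' (tr x y s))"
      using q that xyt unfolding quot_eq_def by metis
  qed (use that xyt mem f in auto)
  show ?thesis
  proof (cases "t = 0")
    case True
    let ?A = "{s. comb V x s y \<in> U}"
    have "continuous_map (subtopology euclidean ?A) (vtop (ubr V)) (\<lambda>s. tr x y s)"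
      using xyt UV by (intro continuous_map_tr V continuous_map_from_subtopology continuous_map_ident)
        (auto simp: V.topspace_vtop)
    then have "continuous_map (subtopology euclidean ?A) (subtopology (vtop (ubr V)) (udom V U)) (\<lambda>s. tr x y s)"
      using xyt by (auto simp: continuous_map_in_subtopology)
    then have "g (tr x y 0) = g' (tr x y 0)"
      using xyt UV nz True continuous_map_compose c
      by (intro continuous_maps_eq_at_zero [of ?A "vtop F" "\<lambda>s. g (tr x y s)" "\<lambda>s. g' (tr x y s)"]
         open_curve_domain V U F.Hausdorff_vtop) (auto simp: o_def)
    then show ?thesis using True xyt by simp
  next
    case False
    then show ?thesis using nz xyt by simp
  qed
qed

lemma continuous_map_local:
  assumes "\<And>x. x \<in> topspace S \<Longrightarrow> \<exists>A. openin S A \<and> x \<in> A \<and> continuous_map (subtopology S A) T f"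
  shows "continuous_map S T f"
proof -
  obtain A where A: "\<And>x. x \<in> topspace S \<Longrightarrow> openin S (A x) \<and> x \<in> A x \<and> continuous_map (subtopology S (A x)) T f"
    using assms by metis
  then show ?thesis
    by (intro pasting_lemma [of "topspace S" S A T "\<lambda>_. f" f]) auto
qed

text \<open>The sets \<open>N^[1]\<close> for small \<open>N\<close> do not cover
  \<open>U^[1]\<close>: a triple may have \<open>x\<close> and \<open>x + t y\<close> far apart.
  Such triples have \<open>t \<noteq> 0\<close>, where the quotient is given by an explicit formula;
  the local quotients are needed near \<open>t = 0\<close> only.\<close>

lemma CN_local:
  fixes V F :: "('k::topological_field, ('k, 'a) univ) tvs"
  assumes "topological_vector_space V" "topological_vector_space F" "openin (vtop V) U"
    and "\<And>x. x \<in> U \<Longrightarrow> \<exists>U'. openin (vtop V) U' \<and> x \<in> U' \<and> U' \<subseteq> U \<and> CN n V U' F f"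
  shows "CN n V U F f"
  using assms
proof (induction n arbitrary: V U f)
  case 0
  have "\<exists>A. openin (subtopology (vtop V) U) A \<and> x \<in> A \<and> continuous_map (subtopology (subtopology (vtop V) U) A) (vtop F) f"
    if x: "x \<in> topspace (subtopology (vtop V) U)" for x
  proof -
    obtain U' where "openin (vtop V) U'" "x \<in> U'" "U' \<subseteq> U" "cont_on V U' F f"
      using 0(4) [of x] x by auto
    moreover from this have "U \<inter> U' = U'" by blast
    moreover from this have "openin (subtopology (vtop V) U) U'"
      using openin_subtopology_Int2 [OF \<open>openin (vtop V) U'\<close>, of U] by simp
    ultimately show ?thesis
      by (intro exI [of _ U']) (simp add: subtopology_subtopology)
  qed
  then show ?case by (auto intro: continuous_map_local)
next
  case (Suc n)
  interpret V: topological_vector_space V by fact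
  interpret F: topological_vector_space F by fact
  note D = tvs_ubr [OF Suc.prems(1)]
  interpret D: topological_vector_space "ubr V" by (rule D)
  note U = V.open_subset_carrier [OF Suc.prems(3)]
  note oD = openin_udom [OF Suc.prems(1,3)]
  note dU = udom_subset [OF U]
  obtain N where N: "\<And>x. x \<in> U \<Longrightarrow> openin (vtop V) (N x) \<and> x \<in> N x \<and> N x \<subseteq> U \<and> CN (Suc n) V (N x) F f"
    using Suc.prems(4) by metis
  then have "\<exists>g. quot_eq V (N x) F f g \<and> CN n (ubr V) (udom V (N x)) F g" if "x \<in> U" for x
    using that by auto
  then obtain G where G: "\<And>x. x \<in> U \<Longrightarrow> quot_eq V (N x) F f (G x) \<and> CN n (ubr V) (udom V (N x)) F (G x)"
    by metis
  \<comment> \<open>One order less is available globally from the induction hypothesis for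
    \<open>f\<close> itself; this makes the explicit formula off \<open>t = 0\<close> of order
    \<open>n\<close>.\<close>
  have fn: "CN n V U F f"
    by (rule Suc.IH [OF Suc.prems(1-3)]) (meson N CN_SucD)
  have fF: "f x \<in> carrier F" if "x \<in> U" for x
    using CN_maps [OF fn V.topspace_vtop F.topspace_vtop U that] .
  \<comment> \<open>At \<open>t = 0\<close> the local quotient belonging to the base point
    \<open>x\<close> of the triple is used. The difference is written as a combination with
    coefficient \<open>-1\<close>, so that sums and scalar multiples suffice to treat it.\<close>
  define g where "g = (\<lambda>p. let x = lft p; y = lft (rgt p); t = unscal (rgt (rgt p)) in
      if t = 0 then G x p else inverse t \<odot>\<^bsub>F\<^esub> (comb F (f (comb V x t y)) (-1) (f x)))"
  have G_mem: "G x p \<in> carrier F" if "x \<in> U" "p \<in> udom V (N x)" for x p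
    using CN_maps [of n "ubr V" "udom V (N x)" F "G x"] G [OF that(1)] N [OF that(1)] U dU udom_mono [of "N x" U V]
      D.topspace_vtop F.topspace_vtop that by blast
  have q: "quot_eq V U F f g"
    unfolding quot_eq_def
  proof (intro ballI allI impI)
    fix x y t assume p: "x \<in> U" "y \<in> carrier V" "comb V x t y \<in> U"
    show "f (comb V x t y) = comb F (f x) t (g (tr x y t))"
    proof (cases "t = 0")
      case True
      have "tr x y 0 \<in> udom V (N x)" using p N [OF p(1)] U by auto
      then have "G x (tr x y 0) \<in> carrier F" using G_mem p by blast
      moreover have "x \<in> carrier V" using p U by auto
      ultimately show ?thesis
        using True p fF by (simp add: g_def)
    next
      case False
      then show ?thesis
        using F.comb_quotient [of "f x" "f (comb V x t y)" t] p fF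
        by (simp add: g_def F.minus_eq_smult)
    qed
  qed
  \<comment> \<open>This set is open and, together with the domains \<open>udom V (N x)\<close>,
    covers \<open>udom V U\<close>, since \<open>(x, y, 0)\<close> belongs to
    \<open>udom V (N x)\<close>.\<close>
  let ?E = "{p \<in> udom V U. unscal (rgt (rgt p)) \<noteq> 0}"
  have E: "?E \<subseteq> carrier (ubr V)" using dU by auto
  have gE: "CN n (ubr V) ?E F g"
  proof -
    note c = CN_comp_add [OF D _ E] CN_comp_smult [OF D _ E]
    note lmr = CN_ubr_lft [OF Suc.prems(1) E] CN_ubr_mid [OF Suc.prems(1) E] CN_ubr_rgt [OF Suc.prems(1) E]
    have x: "CN n (ubr V) ?E F (\<lambda>p. f (lft p))"
      by (rule CN_compose [OF D Suc.prems(1) lmr(1) fn E U]) (auto simp: udom_def)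
    have k: "CN n (ubr V) ?E V (\<lambda>p. comb V (lft p) (unscal (rgt (rgt p))) (lft (rgt p)))"
      by (intro c lmr Suc.prems)
    have k': "CN n (ubr V) ?E F (\<lambda>p. f (comb V (lft p) (unscal (rgt (rgt p))) (lft (rgt p))))"
      by (rule CN_compose [OF D Suc.prems(1) k fn E U]) (auto simp: udom_def)
    have "CN n (ubr V) ?E uscal (\<lambda>p. Scal (-1) :: ('k, 'a) univ)"
      by (rule CN_const [OF D tvs_uscal E]) simp
    then have m: "CN n (ubr V) ?E F (\<lambda>p. unscal (Scal (-1) :: ('k, 'a) univ) \<odot>\<^bsub>F\<^esub> f (lft p))"
      by (intro c x Suc.prems)
    have i: "CN n (ubr V) ?E uscal (\<lambda>p. Scal (inverse (unscal (rgt (rgt p)))) :: ('k, 'a) univ)"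
      by (rule CN_compose [OF D tvs_uscal lmr(3) CN_inverse E]) (auto simp: carrier_uscal udom_def)
    have "CN n (ubr V) ?E F (\<lambda>p. unscal (Scal (inverse (unscal (rgt (rgt p)))) :: ('k, 'a) univ) \<odot>\<^bsub>F\<^esub>
      (comb F (f (comb V (lft p) (unscal (rgt (rgt p))) (lft (rgt p)))) (unscal (Scal (-1) :: ('k, 'a) univ)) (f (lft p))))"
      by (intro c x k' m i Suc.prems)
    then show ?thesis
      by (rule CN_cong) (auto simp: g_def Let_def)
  qed
  have oE: "openin (vtop (ubr V)) ?E"
  proof -
    have "continuous_map (vtop (ubr V)) euclidean (\<lambda>p. unscal (rgt (rgt p)))"
      by (rule continuous_map_ubr_scal [OF Suc.prems(1) continuous_map_ident])
    moreover have "open (- {0 :: 'k})" by (simp add: open_Compl)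
    ultimately have "openin (vtop (ubr V)) {p \<in> topspace (vtop (ubr V)). unscal (rgt (rgt p)) \<in> - {0}}"
      by (intro openin_continuous_map_preimage) auto
    from openin_Int [OF oD this]
    have "openin (vtop (ubr V)) (udom V U \<inter> {p \<in> topspace (vtop (ubr V)). unscal (rgt (rgt p)) \<in> - {0}})" .
    moreover have "udom V U \<inter> {p \<in> topspace (vtop (ubr V)). unscal (rgt (rgt p)) \<in> - {0}} = ?E"
      using openin_subset [OF oD] by auto
    ultimately show ?thesis by simp
  qed
  have gN: "CN n (ubr V) (udom V (N x)) F g" if x: "x \<in> U" for x
  proof (rule CN_cong)
    show "CN n (ubr V) (udom V (N x)) F (G x)" using G x by blast
    fix p assume p: "p \<in> udom V (N x)"
    then obtain x' y t where p': "p = tr x' y t" "x' \<in> N x" "y \<in> carrier V" "comb V x' t y \<in> N x"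
      unfolding udom_def by blast
    then have x': "x' \<in> U" and xt: "comb V x' t y \<in> U" and x'V: "x' \<in> carrier V"
      using N [OF x] U by auto
    show "G x p = g p"
    proof (cases "t = 0")
      case True
      \<comment> \<open>At \<open>t = 0\<close> the glued map uses \<open>G x'\<close>, not
        \<open>G x\<close>. Both are quotients of \<open>f\<close> over the overlap, whose first
        domain contains \<open>(x', y, 0)\<close>, so uniqueness identifies them there.\<close>
      let ?W = "N x \<inter> N x'"
      have W: "openin (vtop V) ?W" "?W \<subseteq> U" using N x x' by (auto intro: openin_Int)
      have "G x p = G x' p"
      proof (rule quot_eq_unique [where f = f and g = "G x" and g' = "G x'", OF Suc.prems(1,2) W(1)])
        show "quot_eq V ?W F f (G x)" "quot_eq V ?W F f (G x')"
          using G [OF x] G [OF x'] unfolding quot_eq_def by blast+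
        show "cont_on (ubr V) (udom V ?W) F (G x)"
          "cont_on (ubr V) (udom V ?W) F (G x')"
          using CN_subset [OF _ udom_mono [of ?W "N x" V], THEN CN_cont] CN_subset [OF _ udom_mono [of ?W "N x'" V], THEN CN_cont]
            G [OF x] G [OF x'] by blast+
        show "p \<in> udom V ?W" using p' True N [OF x'] x'V by auto
      qed (use W fF in auto)
      then show ?thesis using True p' by (simp add: g_def)
    next
      case False
      show ?thesis
      proof (rule F.comb_cancel [of "f x'" _ _ t])
        show "comb F (f x') t (G x p) = comb F (f x') t (g p)"
          using G [OF x] q p' x' xt unfolding quot_eq_def by metis
        show "g p \<in> carrier F"
          using False p' fF x' xt by (auto simp: g_def Let_def)
      qed (use False fF x' G_mem x p in auto)
    qed
  qed
  have "CN n (ubr V) (udom V U) F g"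
  proof (rule Suc.IH [OF D Suc.prems(2) oD])
    fix p assume p: "p \<in> udom V U"
    then obtain x y t where xyt: "p = tr x y t" "x \<in> U" "y \<in> carrier V"
      unfolding udom_def by blast
    show "\<exists>U'. openin (vtop (ubr V)) U' \<and> p \<in> U' \<and> U' \<subseteq> udom V U \<and> CN n (ubr V) U' F g"
    proof (cases "t = 0")
      case True
      have "p \<in> udom V (N x)" using xyt True N [OF xyt(2)] U by auto
      moreover have "openin (vtop (ubr V)) (udom V (N x))" "udom V (N x) \<subseteq> udom V U"
        using N [OF xyt(2)] by (auto intro!: openin_udom Suc.prems udom_mono)
      ultimately show ?thesis
        using gN [OF xyt(2)] by (intro exI [of _ "udom V (N x)"]) auto
    next
      case False
      then show ?thesis using gE oE p xyt by (intro exI [of _ ?E]) auto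
    qed
  qed
  then show ?case using q CN_cont [OF fn] by auto
qed


section \<open>Evaluation with a linear parameter\<close>


text \<open>\<open>\<psi> j \<gamma>\<close> plays the role of \<open>\<gamma>^[j]\<close>. A whole
  chain of families is considered so that the induction hypothesis can be used twice: for the chain
  shifted by one, which evaluates \<open>\<gamma>^[1]\<close>, and for the same chain cut off at
  \<open>n\<close>, which evaluates \<open>\<eta>\<close> at the moved point.\<close>

lemma CN_eval:
  fixes G F :: "('k::topological_field, ('k, 'a) univ) tvs"
    and V :: "nat \<Rightarrow> ('k, ('k, 'a) univ) tvs"
  assumes G: "topological_vector_space G" and F: "topological_vector_space F"
    and "topological_vector_space (V 0)" "U 0 \<subseteq> carrier (V 0)"
    and "\<And>j. V (Suc j) = ubr (V j)" "\<And>j. U (Suc j) = udom (V j) (U j)"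
    and "\<And>j. j \<le> n \<Longrightarrow> continuous_map (prod_topology (vtop G) (subtopology (vtop (V j)) (U j))) (vtop F)
          (\<lambda>z. \<psi> j (fst z) (snd z))"
    and "\<And>j \<gamma>. j < n \<Longrightarrow> \<gamma> \<in> carrier G \<Longrightarrow> quot_eq (V j) (U j) F (\<psi> j \<gamma>) (\<psi> (Suc j) \<gamma>)"
    and "\<And>j \<gamma> \<eta> t p. j \<le> n \<Longrightarrow> \<gamma> \<in> carrier G \<Longrightarrow> \<eta> \<in> carrier G \<Longrightarrow> p \<in> U j \<Longrightarrow>
          \<psi> j (comb G \<gamma> t \<eta>) p = comb F (\<psi> j \<gamma> p) t (\<psi> j \<eta> p)"
  shows "CN n (uprod G (V 0)) {Pr \<gamma> x | \<gamma> x. \<gamma> \<in> carrier G \<and> x \<in> U 0} F (\<lambda>p. \<psi> 0 (lft p) (rgt p))"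
  using assms(3-)
proof (induction n arbitrary: V U \<psi>)
  have cont: "continuous_map (subtopology (vtop (uprod G (V 0))) {Pr \<gamma> x | \<gamma> x. \<gamma> \<in> carrier G \<and> x \<in> U 0})
      (vtop F) (\<lambda>p. \<psi> 0 (lft p) (rgt p))"
    if V: "topological_vector_space (V 0)"
      and c: "continuous_map (prod_topology (vtop G) (subtopology (vtop (V 0)) (U 0))) (vtop F)
          (\<lambda>z. \<psi> 0 (fst z) (snd z))"
    for V :: "nat \<Rightarrow> ('k, ('k, 'a) univ) tvs" and U and \<psi> :: "nat \<Rightarrow> ('k, 'a) univ \<Rightarrow> ('k, 'a) univ \<Rightarrow> ('k, 'a) univ"
  proof -
    let ?S = "subtopology (vtop (uprod G (V 0))) {Pr \<gamma> x | \<gamma> x. \<gamma> \<in> carrier G \<and> x \<in> U 0}"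
    have "continuous_map ?S (vtop (uprod G (V 0))) (\<lambda>p. p)"
      by (intro continuous_map_from_subtopology continuous_map_ident)
    from continuous_map_lft [OF G V this] continuous_map_rgt [OF G V this]
    have "continuous_map ?S (prod_topology (vtop G) (subtopology (vtop (V 0)) (U 0))) (\<lambda>p. (lft p, rgt p))"
      by (auto simp: continuous_map_paired continuous_map_in_subtopology)
    from continuous_map_compose [OF this c] show ?thesis by (simp add: o_def)
  qed
  {
    case 0
    then show ?case using cont [of V U \<psi>] by simp
  next
    case (Suc n)
    note V = Suc.prems(1)
    interpret G: topological_vector_space G by fact
    interpret F: topological_vector_space F by fact
    interpret V: topological_vector_space "V 0" by fact
    let ?P = "uprod G (V 0)" and ?U = "{Pr \<gamma> x | \<gamma> x. \<gamma> \<in> carrier G \<and> x \<in> U 0}"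
    let ?D = "ubr ?P" and ?dU = "udom ?P ?U"
    have P: "topological_vector_space ?P" by (rule tvs_uprod [OF G V])
    note D = tvs_ubr [OF P]
    have U: "?U \<subseteq> carrier ?P" using Suc.prems(2) by auto
    note dU = udom_subset [OF U]
    have mem: "lft p \<in> carrier ?P" "lft (rgt p) \<in> carrier ?P" if "p \<in> ?dU" for p
      using that dU by (auto simp: carrier_ubr)
    have add: "comb ?D (tr (Pr \<gamma> x) (Pr \<eta> y) t) s (tr (Pr \<gamma>' x') (Pr \<eta>' y') t') =
       tr (Pr (comb G \<gamma> s \<gamma>') (comb (V 0) x s x')) (Pr (comb G \<eta> s \<eta>') (comb (V 0) y s y')) (t + s * t')"
      for \<gamma> x \<eta> y t s \<gamma>' x' \<eta>' y' t'
      by (simp add: ubr_def)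
    \<comment> \<open>Regroups \<open>((\<gamma>, x), (\<eta>, y), t)\<close> as
      \<open>(\<gamma>, (x, y, t))\<close>; it is linear, so \<open>CN_compose_linear\<close>
      applies.\<close>
    define L where "L = (\<lambda>p :: ('k, 'a) univ. Pr (lft (lft p)) (tr (rgt (lft p)) (rgt (lft (rgt p))) (unscal (rgt (rgt p)))))"
    have 1: "CN n ?D ?dU F (\<lambda>p. \<psi> 1 (lft (L p)) (rgt (L p)))"
    proof (rule CN_compose_linear [where W = "uprod G (V 1)" and U' = "{Pr \<gamma> x | \<gamma> x. \<gamma> \<in> carrier G \<and> x \<in> U 1}"
          and g = "\<lambda>p. \<psi> 1 (lft p) (rgt p)"])
      have V1: "V 1 = ubr (V 0)" and U1: "U 1 = udom (V 0) (U 0)" using Suc.prems(3,4) by simp_all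
      show "topological_vector_space (uprod G (V 1))"
        unfolding V1 by (intro tvs_uprod G tvs_ubr V)
      show "CN n (uprod G (V 1)) {Pr \<gamma> x | \<gamma> x. \<gamma> \<in> carrier G \<and> x \<in> U 1} F (\<lambda>p. \<psi> 1 (lft p) (rgt p))"
        unfolding One_nat_def
      proof (rule Suc.IH [of "\<lambda>j. V (Suc j)" "\<lambda>j. U (Suc j)" "\<lambda>j. \<psi> (Suc j)"])
        show "topological_vector_space (V (Suc 0))" "U (Suc 0) \<subseteq> carrier (V (Suc 0))"
          using tvs_ubr [OF V] udom_subset [OF Suc.prems(2)] by (simp_all only: Suc.prems(3,4))
        show "V (Suc (Suc j)) = ubr (V (Suc j))" "U (Suc (Suc j)) = udom (V (Suc j)) (U (Suc j))" for j
          by (rule Suc.prems(3), rule Suc.prems(4))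
      qed (rule Suc.prems(5-), simp; assumption)+
      show "{Pr \<gamma> x | \<gamma> x. \<gamma> \<in> carrier G \<and> x \<in> U 1} \<subseteq> carrier (uprod G (V 1))"
        using udom_subset [OF Suc.prems(2)] unfolding U1 V1 by auto
      note id = continuous_map_ident [of "vtop ?D"]
      note lP = continuous_map_ubr_lft [OF P id] and mP = continuous_map_ubr_mid [OF P id]
      show "continuous_map (vtop ?D) (vtop (uprod G (V 1))) L"
        unfolding L_def V1
        by (intro continuous_map_Pr G V tvs_ubr continuous_map_tr continuous_map_ubr_scal [OF P id]
            continuous_map_lft [OF G V lP] continuous_map_rgt [OF G V lP] continuous_map_rgt [OF G V mP])
      show "L (comb ?D p t q) = comb (uprod G (V 1)) (L p) t (L q)"
        if "p \<in> carrier ?D" "q \<in> carrier ?D" for p q t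
        using that unfolding carrier_ubr carrier_uprod V1 L_def by (auto simp: add) (simp add: ubr_def)
      show "L p \<in> {Pr \<gamma> x | \<gamma> x. \<gamma> \<in> carrier G \<and> x \<in> U 1}" if p: "p \<in> ?dU" for p
        using p unfolding U1 L_def udom_def by (auto simp: carrier_uprod)
    qed (use D dU in auto)
    \<comment> \<open>Sends \<open>((\<gamma>, x), (\<eta>, y), t)\<close> to
      \<open>(\<eta>, x + t y)\<close>. Because of the product \<open>t y\<close> this is not
      linear, and the full chain rule is used.\<close>
    define K where "K = (\<lambda>p :: ('k, 'a) univ. Pr (lft (lft (rgt p)))
       (comb (V 0) (rgt (lft p)) (unscal (rgt (rgt p))) (rgt (lft (rgt p)))))"
    have "CN n ?D ?dU ?P K"
      unfolding K_def
    proof (intro CN_Pr G V CN_comp_add CN_comp_smult D dU)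
      show "CN n ?D ?dU G (\<lambda>p. lft (lft (rgt p)))"
        by (rule CN_compose [OF D P CN_ubr_mid [OF P dU] CN_lft [OF G V order_refl] dU order_refl mem(2)])
      show "CN n ?D ?dU (V 0) (\<lambda>p. rgt (lft p))"
        by (rule CN_compose [OF D P CN_ubr_lft [OF P dU] CN_rgt [OF G V order_refl] dU order_refl mem(1)])
      show "CN n ?D ?dU (V 0) (\<lambda>p. rgt (lft (rgt p)))"
        by (rule CN_compose [OF D P CN_ubr_mid [OF P dU] CN_rgt [OF G V order_refl] dU order_refl mem(2)])
      show "CN n ?D ?dU uscal (\<lambda>p. rgt (rgt p))"
        by (rule CN_ubr_rgt [OF P dU])
    qed
    moreover have "CN n ?P ?U F (\<lambda>p. \<psi> 0 (lft p) (rgt p))"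
      by (rule Suc.IH [OF Suc.prems(1-4)]) (rule Suc.prems(5-), simp; assumption)+
    moreover have "K p \<in> ?U" if p: "p \<in> ?dU" for p
      using p unfolding K_def udom_def by (auto simp: carrier_uprod)
    ultimately have 2: "CN n ?D ?dU F (\<lambda>p. \<psi> 0 (lft (K p)) (rgt (K p)))"
      using CN_compose [OF D P, where g = "\<lambda>p. \<psi> 0 (lft p) (rgt p)" and f = K] dU U by blast
    let ?g = "\<lambda>p. \<psi> 1 (lft (L p)) (rgt (L p)) \<oplus>\<^bsub>F\<^esub> \<psi> 0 (lft (K p)) (rgt (K p))"
    have "CN n ?D ?dU F ?g"
      by (intro CN_comp_add 1 2 D F dU)
    moreover have "quot_eq ?P ?U F (\<lambda>p. \<psi> 0 (lft p) (rgt p)) ?g"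
      unfolding quot_eq_def
    proof (intro ballI allI impI)
      fix p q t assume "p \<in> ?U" "q \<in> carrier ?P" and pq: "comb ?P p t q \<in> ?U"
      then obtain \<gamma> x \<eta> y where pq': "p = Pr \<gamma> x" "q = Pr \<eta> y" "\<gamma> \<in> carrier G" "\<eta> \<in> carrier G" "x \<in> U 0" "y \<in> carrier (V 0)"
        by (auto simp: carrier_uprod)
      then have xy: "comb (V 0) x t y \<in> U 0" using pq by auto
      have F0: "\<psi> 0 \<gamma>' x' \<in> carrier F" if "\<gamma>' \<in> carrier G" "x' \<in> U 0" for \<gamma>' x'
        using continuous_map_funspace [OF Suc.prems(5) [of 0]] that Suc.prems(2) G.topspace_vtop F.topspace_vtop V.topspace_vtop
        by (auto simp: Pi_iff)
      have F1: "\<psi> 1 \<gamma> (tr x y t) \<in> carrier F"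
      proof -
        have "tr x y t \<in> U 1" using pq' xy by (simp add: Suc.prems(4))
        moreover from this have "tr x y t \<in> topspace (vtop (V 1))"
          using topological_vector_space.topspace_vtop [OF tvs_ubr [OF V]] udom_subset [OF Suc.prems(2)]
          by (auto simp: Suc.prems(3,4))
        ultimately show ?thesis
          using continuous_map_funspace [OF Suc.prems(5) [of 1]] pq' G.topspace_vtop F.topspace_vtop
          by (auto simp: Pi_iff)
      qed
      \<comment> \<open>Linearity in the parameter is applied first, at the moved point; only then
        is \<open>\<gamma>\<close> alone expanded along \<open>x + t y\<close>.\<close>
      have "\<psi> 0 (comb G \<gamma> t \<eta>) (comb (V 0) x t y)
          = comb F (\<psi> 0 \<gamma> (comb (V 0) x t y)) t (\<psi> 0 \<eta> (comb (V 0) x t y))"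
        by (rule Suc.prems(7)) (use pq' xy in simp_all)
      also have "\<psi> 0 \<gamma> (comb (V 0) x t y) = comb F (\<psi> 0 \<gamma> x) t (\<psi> 1 \<gamma> (tr x y t))"
        using Suc.prems(6) [of 0 \<gamma>] pq' xy by (simp add: quot_eq_def)
      finally have "\<psi> 0 (comb G \<gamma> t \<eta>) (comb (V 0) x t y) =
         comb F (\<psi> 0 \<gamma> x) t (\<psi> 1 \<gamma> (tr x y t) \<oplus>\<^bsub>F\<^esub> \<psi> 0 \<eta> (comb (V 0) x t y))"
        using F0 F1 pq' xy by (simp add: F.smult_add_right F.M.a_assoc)
      then show "\<psi> 0 (lft (comb ?P p t q)) (rgt (comb ?P p t q)) =
          comb F (\<psi> 0 (lft p) (rgt p)) t (?g (tr p q t))"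
        by (simp add: pq' L_def K_def)
    qed
    ultimately show ?case using cont [of V U \<psi>] Suc.prems(1,5) by auto
  }
qed


section \<open>Transfer along embeddings\<close>


text \<open>For \<open>t \<noteq> 0\<close> the two equations differ by multiplication with
  \<open>t\<close>. At \<open>t = 0\<close> the cleared one reads
  \<open>f x = f x + 0 g(x, y, 0)\<close>, which is true because continuity already forces
  \<open>g\<close> to take values in the carrier of \<open>F\<close>.\<close>

lemma is_bracket1_iff:
  assumes A: "topological_vector_space A" and F: "topological_vector_space F"
    and W: "W \<subseteq> carrier A" and f: "\<And>x. x \<in> W \<Longrightarrow> f x \<in> carrier F"
  shows "is_bracket1 A W F f g \<longleftrightarrow> g \<in> extensional (dom1 A W) \<and>
     cont_on (prod_tvs A (prod_tvs A scalar_tvs)) (dom1 A W) F g \<and>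
     (\<forall>x\<in>W. \<forall>y\<in>carrier A. \<forall>t. comb A x t y \<in> W \<longrightarrow>
        f (comb A x t y) = comb F (f x) t (g (x, y, t)))"
    (is "_ \<longleftrightarrow> ?e \<and> ?c \<and> ?q")
proof -
  interpret A: topological_vector_space A by fact
  interpret F: topological_vector_space F by fact
  have "(\<forall>(x, y, t)\<in>dom1 A W. t \<noteq> 0 \<longrightarrow>
        g (x, y, t) = inverse t \<odot>\<^bsub>F\<^esub> (f (comb A x t y) \<ominus>\<^bsub>F\<^esub> f x)) \<longleftrightarrow> ?q" if c: ?c
  proof -
    have g: "g (x, y, t) \<in> carrier F" if "x \<in> W" "y \<in> carrier A" "comb A x t y \<in> W" for x y t
      using continuous_map_funspace [OF c] that W A.topspace_vtop F.topspace_vtop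
      by (auto simp: Pi_iff dom1_def)
    have "(t \<noteq> 0 \<longrightarrow> g (x, y, t) = inverse t \<odot>\<^bsub>F\<^esub> (f (comb A x t y) \<ominus>\<^bsub>F\<^esub> f x)) \<longleftrightarrow>
        f (comb A x t y) = comb F (f x) t (g (x, y, t))"
      if xyt: "x \<in> W" "y \<in> carrier A" "comb A x t y \<in> W" for x y t
    proof (cases "t = 0")
      case True
      moreover have "x \<in> carrier A" using xyt W by auto
      ultimately show ?thesis using xyt f g [OF xyt] by simp
    next
      case False
      have m: "f (comb A x t y) \<ominus>\<^bsub>F\<^esub> f x \<in> carrier F" using f xyt by blast
      note q = F.comb_quotient [OF f [OF xyt(1)] f [OF xyt(3)] False]
      show ?thesis
      proof
        assume "t \<noteq> 0 \<longrightarrow> g (x, y, t) = inverse t \<odot>\<^bsub>F\<^esub> (f (comb A x t y) \<ominus>\<^bsub>F\<^esub> f x)"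
        then show "f (comb A x t y) = comb F (f x) t (g (x, y, t))" using q False by simp
      next
        assume *: "f (comb A x t y) = comb F (f x) t (g (x, y, t))"
        have "g (x, y, t) = inverse t \<odot>\<^bsub>F\<^esub> (f (comb A x t y) \<ominus>\<^bsub>F\<^esub> f x)"
          by (rule F.comb_cancel [of "f x" _ _ t]) (use * q f xyt g m False in auto)
        then show "t \<noteq> 0 \<longrightarrow> g (x, y, t) = inverse t \<odot>\<^bsub>F\<^esub> (f (comb A x t y) \<ominus>\<^bsub>F\<^esub> f x)" by simp
      qed
    qed
    then show ?thesis by (auto simp: dom1_def)
  qed
  then show ?thesis unfolding is_bracket1_def by (intro conj_cong refl)
qed

text \<open>Linear homeomorphisms. Linearity is expressed by the single combination
  \<open>x + t y\<close> that occurs in difference quotients.\<close>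

definition tvs_iso :: "('v \<Rightarrow> 'w) \<Rightarrow> ('k::topological_field, 'v) tvs \<Rightarrow> ('k, 'w) tvs \<Rightarrow> bool" where
  "tvs_iso e A B \<longleftrightarrow> (\<exists>e'. homeomorphic_maps (vtop A) (vtop B) e e') \<and>
     (\<forall>x\<in>carrier A. \<forall>y\<in>carrier A. \<forall>t. e (comb A x t y) = comb B (e x) t (e y))"

lemma tvs_iso_map: "topological_vector_space V \<Longrightarrow> inj h \<Longrightarrow> tvs_iso h V (map_tvs h V)"
  unfolding tvs_iso_def homeomorphic_maps_def
  using continuous_map_into_map_tvs [of h V "vtop V" "\<lambda>x. x"] continuous_map_inv_map_tvs [of h V]
    topspace_map_tvs [of h V] topological_vector_space.topspace_vtop [of V]
  by (auto intro!: exI [of _ "inv_into UNIV h"])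

context
  fixes A :: "('k::topological_field, 'v) tvs" and B :: "('k, ('k, 'a) univ) tvs"
    and e
  assumes A: "topological_vector_space A" and B: "topological_vector_space B"
    and e: "tvs_iso e A B"
begin

interpretation A: topological_vector_space A by (rule A)
interpretation B: topological_vector_space B by (rule B)

lemma iso_comb: "x \<in> carrier A \<Longrightarrow> y \<in> carrier A \<Longrightarrow> e (comb A x t y) = comb B (e x) t (e y)"
  using e by (simp add: tvs_iso_def)

lemma iso_inj: "inj_on e (carrier A)"
  and iso_image: "e ` carrier A = carrier B"
  and iso_homeo: "homeomorphic_map (vtop A) (vtop B) e"
proof -
  show *: "homeomorphic_map (vtop A) (vtop B) e"
    using e homeomorphic_map_maps by (auto simp: tvs_iso_def)
  show "inj_on e (carrier A)" "e ` carrier A = carrier B"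
    using * A.topspace_vtop B.topspace_vtop by (metis homeomorphic_eq_everything_map)+
qed

lemma iso_open: "W \<subseteq> carrier A \<Longrightarrow> openin (vtop B) (e ` W) \<longleftrightarrow> openin (vtop A) W"
  using homeomorphic_map_openness [OF iso_homeo] A.topspace_vtop by metis

lemma iso_mem:
  assumes "W \<subseteq> carrier A" "x \<in> carrier A" "y \<in> carrier A"
  shows "comb B (e x) t (e y) \<in> e ` W \<longleftrightarrow> comb A x t y \<in> W"
proof -
  have "comb A x t y \<in> carrier A" using assms by simp
  then show ?thesis
    using inj_on_image_mem_iff [OF iso_inj _ assms(1)] iso_comb [OF assms(2,3), symmetric] by simp
qed

lemma iso_udom:
  assumes W: "W \<subseteq> carrier A"
  shows "udom B (e ` W) = (\<lambda>(x, y, t). tr (e x) (e y) t) ` dom1 A W"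
proof (intro equalityI subsetI)
  fix p assume "p \<in> udom B (e ` W)"
  then obtain x' y' t where p: "p = tr x' y' t" "x' \<in> e ` W" "y' \<in> carrier B"
      "comb B x' t y' \<in> e ` W"
    unfolding udom_def by blast
  then obtain x y where xy: "x' = e x" "x \<in> W" "y' = e y" "y \<in> carrier A"
    unfolding iso_image [symmetric] by blast
  then have "(x, y, t) \<in> dom1 A W"
    using p(4) iso_mem [OF W, of x y t] W by (auto simp: dom1_def)
  then show "p \<in> (\<lambda>(x, y, t). tr (e x) (e y) t) ` dom1 A W"
    using p xy by (intro image_eqI [of _ _ "(x, y, t)"]) auto
next
  fix p assume "p \<in> (\<lambda>(x, y, t). tr (e x) (e y) t) ` dom1 A W"
  then obtain x y t where p: "p = tr (e x) (e y) t" "x \<in> W" "y \<in> carrier A" "comb A x t y \<in> W"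
    unfolding dom1_def by auto
  then show "p \<in> udom B (e ` W)"
    using iso_mem [OF W, of x y t] W iso_image by (auto simp flip: iso_image)
qed

lemma iso_cont:
  assumes W: "W \<subseteq> carrier A" and f: "\<And>x. x \<in> W \<Longrightarrow> f' (e x) = f x"
  shows "cont_on A W F f \<longleftrightarrow>
    cont_on B (e ` W) F f'"
proof -
  obtain e' where e': "homeomorphic_maps (vtop A) (vtop B) e e'"
    using e by (auto simp: tvs_iso_def)
  then have ee: "e' (e x) = x" if "x \<in> carrier A" for x
    using that by (simp add: homeomorphic_maps_def A.topspace_vtop)
  have c: "continuous_map (subtopology (vtop A) W) (subtopology (vtop B) (e ` W)) e"
    "continuous_map (subtopology (vtop B) (e ` W)) (subtopology (vtop A) W) e'"
    using e' ee W by (auto simp: homeomorphic_maps_def continuous_map_in_subtopology continuous_map_from_subtopology subset_iff)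
  show ?thesis
  proof
    assume "cont_on A W F f"
    from continuous_map_compose [OF c(2) this]
    show "cont_on B (e ` W) F f'"
      by (rule continuous_map_eq) (use W ee f in auto)
  next
    assume "cont_on B (e ` W) F f'"
    from continuous_map_compose [OF c(1) this]
    show "cont_on A W F f"
      by (rule continuous_map_eq) (use f in auto)
  qed
qed

text \<open>The map \<open>E\<close>, which is \<open>e\<close> on both vectors and the identity on
  the scalar, is a homeomorphism from \<open>W^[1]\<close> onto its copy in \<open>univ\<close>. The
  functions \<open>g\<close> and \<open>g'\<close> are tied together on this set only, so either one
  may be constructed from the other.\<close>

lemma iso_bracket:
  assumes F: "topological_vector_space F" and W: "W \<subseteq> carrier A" and f: "\<And>x. x \<in> W \<Longrightarrow> f' (e x) = f x" "\<And>x. x \<in> W \<Longrightarrow> f x \<in> carrier F"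
    and g: "\<And>x y t. (x, y, t) \<in> dom1 A W \<Longrightarrow> g' (tr (e x) (e y) t) = g (x, y, t)"
    and ext: "g \<in> extensional (dom1 A W)"
  shows "is_bracket1 A W F f g \<longleftrightarrow>
    cont_on (ubr B) (udom B (e ` W)) F g' \<and> quot_eq B (e ` W) F f' g'"
proof -
  obtain e' where e': "homeomorphic_maps (vtop A) (vtop B) e e'"
    using e by (auto simp: tvs_iso_def)
  then have ee: "e' (e x) = x" if "x \<in> carrier A" for x
    using that by (simp add: homeomorphic_maps_def A.topspace_vtop)
  let ?P = "vtop (prod_tvs A (prod_tvs A scalar_tvs))"
  let ?S = "subtopology ?P (dom1 A W)" and ?T = "subtopology (vtop (ubr B)) (udom B (e ` W))"
  have c: "continuous_map (vtop A) (vtop B) e" "continuous_map (vtop B) (vtop A) e'"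
    using e' by (auto simp: homeomorphic_maps_def)
  define E where "E = (\<lambda>p. tr (e (fst p)) (e (fst (snd p))) (snd (snd p)))"
  define E' where "E' = (\<lambda>p :: ('k, 'a) univ. (e' (lft p), e' (lft (rgt p)), unscal (rgt (rgt p))))"
  have idP: "continuous_map ?P (prod_topology (vtop A) (prod_topology (vtop A) euclidean)) (\<lambda>p. p)"
    using continuous_map_ident by simp
  note 1 = continuous_map_fst' [OF idP] and 2 = continuous_map_fst' [OF continuous_map_snd' [OF idP]]
    and 3 = continuous_map_snd' [OF continuous_map_snd' [OF idP]]
  have "continuous_map ?P (vtop (ubr B)) E"
    unfolding E_def using continuous_map_compose [OF 1 c(1)] continuous_map_compose [OF 2 c(1)] 3
    by (intro continuous_map_tr B) (simp_all add: o_def)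
  moreover have udom: "udom B (e ` W) = E ` dom1 A W"
    using iso_udom [OF W] by (simp add: E_def case_prod_unfold)
  ultimately have cE: "continuous_map ?S ?T E"
    by (auto simp: continuous_map_in_subtopology continuous_map_from_subtopology)
  note id = continuous_map_ident [of "vtop (ubr B)"]
  have "continuous_map (vtop (ubr B)) ?P E'"
    using continuous_map_compose [OF continuous_map_ubr_lft [OF B id] c(2)]
      continuous_map_compose [OF continuous_map_ubr_mid [OF B id] c(2)] continuous_map_ubr_scal [OF B id]
    by (simp add: o_def E'_def continuous_map_paired)
  moreover have E'E: "E' (E p) = p" if "p \<in> dom1 A W" for p
    using that W ee by (auto simp: E_def E'_def dom1_def)
  ultimately have cE': "continuous_map ?T ?S E'"
    by (auto simp: continuous_map_in_subtopology continuous_map_from_subtopology udom)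
  have gE: "g' (E p) = g p" if "p \<in> dom1 A W" for p
    using that g by (cases p) (auto simp: E_def)
  have cont: "continuous_map ?S (vtop F) g \<longleftrightarrow> continuous_map ?T (vtop F) g'"
  proof
    assume "continuous_map ?S (vtop F) g"
    from continuous_map_compose [OF cE' this]
    show "continuous_map ?T (vtop F) g'"
      by (rule continuous_map_eq) (use E'E gE in \<open>auto simp: udom\<close>)
  next
    assume "continuous_map ?T (vtop F) g'"
    from continuous_map_compose [OF cE this]
    show "continuous_map ?S (vtop F) g"
      by (rule continuous_map_eq) (use gE in auto)
  qed
  have "quot_eq B (e ` W) F f' g' \<longleftrightarrow> (\<forall>x\<in>W. \<forall>y\<in>carrier A. \<forall>t. comb A x t y \<in> W \<longrightarrow>
        f (comb A x t y) = comb F (f x) t (g (x, y, t)))"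
    unfolding quot_eq_def iso_image [symmetric] ball_simps
  proof (intro ball_cong refl all_cong1 imp_cong)
    fix x y t assume xy: "x \<in> W" "y \<in> carrier A"
    show "comb B (e x) t (e y) \<in> e ` W \<longleftrightarrow> comb A x t y \<in> W" by (rule iso_mem [OF W]) (use xy W in auto)
    assume W': "comb A x t y \<in> W"
    have "f' (comb B (e x) t (e y)) = f (comb A x t y)"
      using f(1) [OF W'] iso_comb [of x y t] xy W by auto
    then show "(f' (comb B (e x) t (e y)) = comb F (f' (e x)) t (g' (tr (e x) (e y) t))) \<longleftrightarrow>
        (f (comb A x t y) = comb F (f x) t (g (x, y, t)))"
      using f(1) [OF xy(1)] g [of x y t] xy W' by (simp add: dom1_def)
  qed
  then show ?thesis
    using is_bracket1_iff [where f = f and g = g, OF A F W f(2)] ext cont by blast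
qed

text \<open>Makes the definite description usable. Two candidates are moved along \<open>e\<close>
  into \<open>univ\<close>, where \<open>quot_eq_unique\<close> makes them agree on the domain; off
  the domain both are \<open>undefined\<close>.\<close>

lemma bracket1_eqI:
  fixes f :: "'v \<Rightarrow> 'f"
  assumes F: "topological_vector_space F" and W: "openin (vtop A) W" and f: "\<And>x. x \<in> W \<Longrightarrow> f x \<in> carrier F"
    and g: "is_bracket1 A W F f g"
  shows "bracket1 A W F f = g"
  unfolding bracket1_def
proof (rule the_equality)
  show "is_bracket1 A W F f g" by fact
  fix k assume k: "is_bracket1 A W F f k"
  have WA: "W \<subseteq> carrier A" by (rule A.open_subset_carrier [OF W])
  obtain e' where e': "homeomorphic_maps (vtop A) (vtop B) e e'"
    using e by (auto simp: tvs_iso_def)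
  then have ee: "e' (e x) = x" if "x \<in> carrier A" for x
    using that by (simp add: homeomorphic_maps_def A.topspace_vtop)
  define tr' where "tr' = (\<lambda>l p. l (e' (lft p), e' (lft (rgt p)), unscal (rgt (rgt (p :: ('k, 'a) univ)))) :: 'f)"
  have b: "cont_on (ubr B) (udom B (e ` W)) F (tr' l) \<and> quot_eq B (e ` W) F (\<lambda>x. f (e' x)) (tr' l)"
    if l: "is_bracket1 A W F f l" for l
  proof -
    have f1: "f (e' (e x)) = f x" if "x \<in> W" for x
      using that WA ee by auto
    have g1: "tr' l (tr (e x) (e y) t) = l (x, y, t)" if "(x, y, t) \<in> dom1 A W" for x y t
      using that WA ee by (auto simp: tr'_def dom1_def)
    have "l \<in> extensional (dom1 A W)" using l by (simp add: is_bracket1_def)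
    from iso_bracket [where f = f and f' = "\<lambda>x. f (e' x)" and g = l and g' = "tr' l", OF F WA f1 f g1 this] l
    show ?thesis by blast
  qed
  have "k p = g p" if p: "p \<in> dom1 A W" for p
  proof -
    obtain x y t where xyt: "p = (x, y, t)" by (cases p)
    have "tr' k (tr (e x) (e y) t) = tr' g (tr (e x) (e y) t)"
    proof (rule quot_eq_unique [OF B F, where U = "e ` W" and f = "\<lambda>x. f (e' x)"])
      show "tr (e x) (e y) t \<in> udom B (e ` W)"
        unfolding iso_udom [OF WA] using p xyt by force
      show "f (e' x) \<in> carrier F" if "x \<in> e ` W" for x
        using that f WA ee by auto
    qed (use b k g W iso_open WA in auto)
    then show ?thesis using xyt p WA ee by (auto simp: tr'_def dom1_def)
  qed
  moreover have "k \<in> extensional (dom1 A W)" "g \<in> extensional (dom1 A W)"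
    using k g by (auto simp: is_bracket1_def)
  ultimately show "k = g" by (intro extensionalityI [where A = "dom1 A W"])
qed

end


section \<open>The iterated spaces and their copies in \<open>univ\<close>\<close>

abbreviation iter_space :: "('k::topological_field, 'v) tvs \<Rightarrow> 'v set \<Rightarrow> nat \<Rightarrow> ('k, 'v) iter topology" where
  "iter_space V U j \<equiv> subtopology (vtop (iter_tvs V j)) (iter_dom V U j)"

text \<open>One recursion serves every level: restricted to \<open>iter_tvs V j\<close> it becomes
  an isomorphism onto the \<open>j\<close>-fold \<open>ubr\<close> of the copy of
  \<open>V\<close>.\<close>

primrec embed :: "('v \<Rightarrow> ('k, 'a) univ) \<Rightarrow> ('k, 'v) iter \<Rightarrow> ('k, 'a) univ" where
  "embed h (Base v) = h v"
| "embed h (Triple x y t) = tr (embed h x) (embed h y) t"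

lemma inj_Base: "inj Base"
  by (simp add: inj_def)

lemma inj_triple: "inj triple"
  by (auto simp: inj_def triple_def)

lemma tvs_iter: "topological_vector_space V \<Longrightarrow> topological_vector_space (iter_tvs V j)"
  by (induction j) (simp_all add: tvs_map tvs_prod tvs_scalar inj_Base inj_triple)

lemma carrier_iter_Suc:
  "carrier (iter_tvs V (Suc j)) =
    {Triple x y t | x y t. x \<in> carrier (iter_tvs V j) \<and> y \<in> carrier (iter_tvs V j)}"
  by (auto simp: triple_def image_iff)

lemma comb_iter_Suc:
  "comb (iter_tvs V (Suc j)) (Triple x y t) s (Triple x' y' t') =
    Triple (comb (iter_tvs V j) x s x') (comb (iter_tvs V j) y s y') (t + s * t')"
proof -
  have *: "Triple a b c = triple (a, b, c)" for a b c by (simp add: triple_def)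
  show ?thesis
    unfolding * by (simp add: inj_triple)
qed

lemma iter_dom_Suc:
  "iter_dom V U (Suc j) = {Triple x y t | x y t. x \<in> iter_dom V U j \<and> y \<in> carrier (iter_tvs V j) \<and>
     comb (iter_tvs V j) x t y \<in> iter_dom V U j}"
  by (auto simp: dom1_def triple_def image_iff)

lemma iter_dom_subset: "U \<subseteq> carrier V \<Longrightarrow> iter_dom V U j \<subseteq> carrier (iter_tvs V j)"
proof (induction j)
  case (Suc j)
  then show ?case unfolding iter_dom_Suc carrier_iter_Suc by auto
qed auto

lemma continuous_map_Triple:
  assumes V: "topological_vector_space V"
    and "continuous_map S (vtop (iter_tvs V j)) f" "continuous_map S (vtop (iter_tvs V j)) g"
    and "continuous_map S euclidean c"
  shows "continuous_map S (vtop (iter_tvs V (Suc j))) (\<lambda>s. Triple (f s) (g s) (c s))"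
proof -
  have "continuous_map S (vtop (iter_tvs V (Suc j))) (\<lambda>s. triple (f s, g s, c s))"
    unfolding iter_tvs.simps
  proof (rule continuous_map_into_map_tvs [OF inj_triple])
    show "topspace (vtop (prod_tvs (iter_tvs V j) (prod_tvs (iter_tvs V j) scalar_tvs))) =
        carrier (prod_tvs (iter_tvs V j) (prod_tvs (iter_tvs V j) scalar_tvs))"
      by (rule topological_vector_space.topspace_vtop) (intro tvs_prod tvs_iter V tvs_scalar)
  qed (use assms in \<open>simp add: continuous_map_paired\<close>)
  then show ?thesis by (simp add: triple_def)
qed

text \<open>The inverse at the next level applies the previous inverse to both vectors of a triple
  and unwraps the scalar.\<close>

lemma tvs_iso_embed:
  fixes h :: "'v \<Rightarrow> ('k::topological_field, 'a) univ"
  assumes V: "topological_vector_space V" and B: "\<And>j. topological_vector_space (B j)"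
    and h: "tvs_iso h V (B 0)" and Suc_B: "\<And>j. B (Suc j) = ubr (B j)"
  shows "tvs_iso (embed h) (iter_tvs V j) (B j)"
proof (induction j)
  case 0
  obtain h' where h': "homeomorphic_maps (vtop V) (vtop (B 0)) h h'"
    using h by (auto simp: tvs_iso_def)
  interpret V: topological_vector_space V by fact
  let ?W = "vtop (map_tvs (Base :: 'v \<Rightarrow> ('k, 'v) iter) V)"
  have cB: "continuous_map (vtop V) ?W Base"
    using continuous_map_into_map_tvs [OF inj_Base V.topspace_vtop continuous_map_ident] .
  have c: "continuous_map (vtop V) (vtop (B 0)) h" "continuous_map (vtop (B 0)) (vtop V) h'"
    and inv: "\<And>x. x \<in> carrier V \<Longrightarrow> h' (h x) = x" "\<And>y. y \<in> topspace (vtop (B 0)) \<Longrightarrow> h (h' y) = y"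
    using h' by (auto simp: homeomorphic_maps_def V.topspace_vtop)
  have ts: "topspace ?W = Base ` carrier V"
    using topspace_map_tvs [OF inj_Base V.topspace_vtop] .
  have "homeomorphic_maps ?W (vtop (B 0)) (embed h) (\<lambda>p. Base (h' p))"
    unfolding homeomorphic_maps_def
  proof (intro conjI)
    show "continuous_map ?W (vtop (B 0)) (embed h)"
      by (rule continuous_map_eq [OF continuous_map_compose [OF continuous_map_inv_map_tvs [OF inj_Base] c(1)]])
        (auto simp: ts inj_Base)
    show "continuous_map (vtop (B 0)) ?W (\<lambda>p. Base (h' p))"
      using continuous_map_compose [OF c(2) cB] by (simp add: o_def)
  qed (use inv ts in auto)
  moreover have "embed h (comb (map_tvs Base V) x t y) = comb (B 0) (embed h x) t (embed h y)"
    if "x \<in> carrier (map_tvs Base V)" "y \<in> carrier (map_tvs Base V)" for x y t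
    using that h by (auto simp: tvs_iso_def inj_Base)
  ultimately show ?case
    unfolding tvs_iso_def by auto
next
  case (Suc j)
  let ?A = "iter_tvs V j" and ?e = "embed h"
  obtain e' where e': "homeomorphic_maps (vtop ?A) (vtop (B j)) ?e e'"
    using Suc by (auto simp: tvs_iso_def)
  interpret A: topological_vector_space ?A by (rule tvs_iter [OF V])
  interpret A': topological_vector_space "iter_tvs V (Suc j)" by (rule tvs_iter [OF V])
  interpret B: topological_vector_space "B j" by (rule B)
  interpret B': topological_vector_space "B (Suc j)" by (rule B)
  have c: "continuous_map (vtop ?A) (vtop (B j)) ?e" "continuous_map (vtop (B j)) (vtop ?A) e'"
    and inv: "\<And>x. x \<in> carrier ?A \<Longrightarrow> e' (?e x) = x" "\<And>y. y \<in> carrier (B j) \<Longrightarrow> ?e (e' y) = y"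
    using e' by (auto simp: homeomorphic_maps_def A.topspace_vtop B.topspace_vtop)
  let ?W = "vtop (iter_tvs V (Suc j))"
  have "continuous_map ?W (prod_topology (vtop ?A) (prod_topology (vtop ?A) euclidean)) (inv_into UNIV triple)"
    using continuous_map_inv_map_tvs [OF inj_triple, of "prod_tvs ?A (prod_tvs ?A scalar_tvs)"] by simp
  note i = continuous_map_fst' [OF this] continuous_map_fst' [OF continuous_map_snd' [OF this]]
    continuous_map_snd' [OF continuous_map_snd' [OF this]]
  define E' where "E' = (\<lambda>p :: ('k, 'a) univ. Triple (e' (lft p)) (e' (lft (rgt p))) (unscal (rgt (rgt p))))"
  have "continuous_map ?W (vtop (ubr (B j)))
     (\<lambda>p. tr (?e (fst (inv_into UNIV triple p))) (?e (fst (snd (inv_into UNIV triple p)))) (snd (snd (inv_into UNIV triple p))))"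
    using continuous_map_compose [OF i(1) c(1)] continuous_map_compose [OF i(2) c(1)] i(3)
    by (intro continuous_map_tr B) (simp_all add: o_def)
  moreover have "inv_into UNIV triple (Triple x y t) = (x, y, t)" for x y :: "('k, 'v) iter" and t
    using inv_f_f [OF inj_triple, of "(x, y, t)"] by (simp add: triple_def)
  ultimately have 1: "continuous_map ?W (vtop (B (Suc j))) ?e"
    unfolding Suc_B by (elim continuous_map_eq) (auto simp: A'.topspace_vtop carrier_iter_Suc simp del: iter_tvs.simps)
  note id = continuous_map_ident [of "vtop (ubr (B j))"]
  have 2: "continuous_map (vtop (B (Suc j))) ?W E'"
    unfolding E'_def Suc_B [of j] using continuous_map_compose [OF continuous_map_ubr_lft [OF B id] c(2)]
      continuous_map_compose [OF continuous_map_ubr_mid [OF B id] c(2)] continuous_map_ubr_scal [OF B id]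
    by (intro continuous_map_Triple V) (simp_all add: o_def)
  have "homeomorphic_maps ?W (vtop (B (Suc j))) ?e E'"
    unfolding homeomorphic_maps_def A'.topspace_vtop B'.topspace_vtop
    using 1 2 inv by (auto simp: E'_def carrier_iter_Suc Suc_B carrier_ubr simp del: iter_tvs.simps)
  moreover have "?e (comb (iter_tvs V (Suc j)) x t y) = comb (B (Suc j)) (?e x) t (?e y)"
    if "x \<in> carrier (iter_tvs V (Suc j))" "y \<in> carrier (iter_tvs V (Suc j))" for x y t
    using that Suc by (auto simp: carrier_iter_Suc comb_iter_Suc Suc_B ubr_def tvs_iso_def simp del: iter_tvs.simps)
  ultimately show ?case
    unfolding tvs_iso_def by auto
qed

lemma embed_iter_dom:
  fixes h :: "'v \<Rightarrow> ('k::topological_field, 'a) univ"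
  assumes V: "topological_vector_space V" and B: "\<And>j. topological_vector_space (B j)"
    and h: "tvs_iso h V (B 0)" and Suc_B: "\<And>j. B (Suc j) = ubr (B j)"
    and W: "U \<subseteq> carrier V" "W 0 = h ` U" "\<And>j. W (Suc j) = udom (B j) (W j)"
  shows "embed h ` iter_dom V U j = W j"
proof (induction j)
  case 0
  then show ?case by (auto simp: W image_iff)
next
  case (Suc j)
  have "udom (B j) (embed h ` iter_dom V U j) =
      (\<lambda>(x, y, t). tr (embed h x) (embed h y) t) ` dom1 (iter_tvs V j) (iter_dom V U j)"
    by (rule iso_udom [OF tvs_iter [OF V] B tvs_iso_embed [OF V B h Suc_B] iter_dom_subset [OF W(1)]])
  also have "\<dots> = embed h ` iter_dom V U (Suc j)"
    by (simp add: image_image triple_def case_prod_unfold)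
  finally show ?case by (simp add: Suc W)
qed


lemma iter_bracket_0 [simp]: "x \<in> U \<Longrightarrow> iter_bracket V U F f 0 (Base x) = f x"
  by (simp add: inj_Base)

lemma Cn_map_iff:
  "Cn_map n V U F f \<longleftrightarrow> cont_on V U F f \<and>
    (\<forall>i<n. C1_map (iter_tvs V i) (iter_dom V U i) F (iter_bracket V U F f i))"
  by (induction n) (auto simp: less_Suc_eq)

text \<open>
  \<open>B j\<close> and \<open>W j\<close> are the copies inside \<open>univ\<close> of the ambient space \<open>iter_tvs V j\<close> and of the
  domain \<open>iter_dom V U j\<close>.
\<close>

locale embedded =
  fixes V :: "('k::topological_field, 'v) tvs" and U :: "'v set" and F :: "('k, 'f) tvs"
    and h :: "'v \<Rightarrow> ('k, 'a) univ" and B :: "nat \<Rightarrow> ('k, ('k, 'a) univ) tvs"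
    and W :: "nat \<Rightarrow> ('k, 'a) univ set"
  assumes V: "topological_vector_space V" and F: "topological_vector_space F"
    and U: "openin (vtop V) U"
    and B0: "topological_vector_space (B 0)" and h: "tvs_iso h V (B 0)"
    and Suc_B: "\<And>j. B (Suc j) = ubr (B j)"
    and W0: "W 0 = h ` U" and Suc_W: "\<And>j. W (Suc j) = udom (B j) (W j)"
begin

lemma tvs_B: "topological_vector_space (B j)"
  by (induction j) (auto simp: B0 Suc_B tvs_ubr)

lemma UV: "U \<subseteq> carrier V"
  using topological_vector_space.open_subset_carrier [OF V U] .

lemmas iso_embed = tvs_iso_embed [OF V tvs_B h Suc_B]
lemmas image_embed = embed_iter_dom [OF V tvs_B h Suc_B UV W0 Suc_W]
lemmas dom_subset = iter_dom_subset [OF UV]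

lemma openin_W: "openin (vtop (B j)) (W j)"
proof (induction j)
  case 0
  then show ?case using iso_open [OF V B0 h UV] U by (simp add: W0)
next
  case (Suc j)
  then show ?case by (simp add: Suc_B Suc_W openin_udom tvs_B)
qed

lemma openin_iter_dom: "openin (vtop (iter_tvs V j)) (iter_dom V U j)"
  using iso_open [OF tvs_iter [OF V] tvs_B iso_embed dom_subset] openin_W image_embed by metis

text \<open>By uniqueness every known bracket \<open>g\<close> is the one selected by the
  description inside \<open>iter_bracket\<close>, so values and continuity of the next level can be
  read off from \<open>g\<close>.\<close>

lemma iter_bracket_Suc:
  assumes f: "continuous_map (iter_space V U j) (vtop F) (iter_bracket V U F f j)"
    and g: "is_bracket1 (iter_tvs V j) (iter_dom V U j) F (iter_bracket V U F f j) g"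
  shows "\<And>p. p \<in> dom1 (iter_tvs V j) (iter_dom V U j) \<Longrightarrow> iter_bracket V U F f (Suc j) (triple p) = g p"
    and "continuous_map (iter_space V U (Suc j)) (vtop F)
      (iter_bracket V U F f (Suc j))"
proof -
  have fF: "iter_bracket V U F f j x \<in> carrier F" if "x \<in> iter_dom V U j" for x
    using continuous_map_funspace [OF f] that dom_subset topological_vector_space.topspace_vtop [OF F]
      topological_vector_space.topspace_vtop [OF tvs_iter [OF V]] by (auto simp: Pi_iff)
  have b: "bracket1 (iter_tvs V j) (iter_dom V U j) F (iter_bracket V U F f j) = g"
    by (rule bracket1_eqI [OF tvs_iter [OF V] tvs_B iso_embed F openin_iter_dom fF g])
  show *: "iter_bracket V U F f (Suc j) (triple p) = g p" if "p \<in> dom1 (iter_tvs V j) (iter_dom V U j)" for p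
    using that by (simp add: b inj_triple)
  let ?P = "prod_tvs (iter_tvs V j) (prod_tvs (iter_tvs V j) scalar_tvs)"
  let ?S = "subtopology (vtop (iter_tvs V (Suc j))) (iter_dom V U (Suc j))"
  have "continuous_map ?S (subtopology (vtop ?P) (dom1 (iter_tvs V j) (iter_dom V U j))) (inv_into UNIV triple)"
    using continuous_map_inv_map_tvs [OF inj_triple, of ?P]
    by (auto simp: continuous_map_in_subtopology continuous_map_from_subtopology inj_triple)
  from continuous_map_compose [OF this, of "vtop F" g]
  have "continuous_map ?S (vtop F) (g \<circ> inv_into UNIV triple)"
    using g by (simp add: is_bracket1_def)
  then show "continuous_map ?S (vtop F) (iter_bracket V U F f (Suc j))"
    by (rule continuous_map_eq) (use * in \<open>auto simp: inj_triple\<close>)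
qed

lemma cont_embed_iff:
  assumes "\<And>p. p \<in> iter_dom V U j \<Longrightarrow> g (embed h p) = \<phi> p"
  shows "continuous_map (iter_space V U j) (vtop F) \<phi> \<longleftrightarrow>
    cont_on (B j) (W j) F g"
  using iso_cont [where f = \<phi> and f' = g, OF tvs_iter [OF V] tvs_B iso_embed dom_subset assms]
  by (simp add: image_embed)

declare iter_bracket.simps(2) [simp del]

text \<open>Reconciles the two directions of recursion. The starting level \<open>j\<close> is
  arbitrary because \<open>CN\<close> removes the first of the remaining levels, so the induction
  step passes from \<open>j\<close> to \<open>Suc j\<close> with one condition less.\<close>

lemma C1_chain_iff_CN:
  assumes "\<And>p. p \<in> iter_dom V U j \<Longrightarrow> g (embed h p) = iter_bracket V U F f j p"
  shows "continuous_map (iter_space V U j) (vtop F) (iter_bracket V U F f j) \<and>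
      (\<forall>i<n. C1_map (iter_tvs V (j + i)) (iter_dom V U (j + i)) F (iter_bracket V U F f (j + i))) \<longleftrightarrow>
    CN n (B j) (W j) F g"
  using assms
proof (induction n arbitrary: j g)
  case 0
  show ?case
    using cont_embed_iff [where \<phi> = "iter_bracket V U F f j" and g = g, OF 0] by simp
next
  case (Suc n)
  let ?f = "iter_bracket V U F f" and ?A = "iter_tvs V" and ?D = "iter_dom V U"
  have c: "cont_on (?A j) (?D j) F (?f j) \<longleftrightarrow>
     cont_on (B j) (W j) F g"
    by (rule cont_embed_iff [where \<phi> = "?f j" and g = g, OF Suc.prems])
  have all: "(\<forall>i<Suc n. C1_map (?A (j + i)) (?D (j + i)) F (?f (j + i))) \<longleftrightarrow>
     C1_map (?A j) (?D j) F (?f j) \<and> (\<forall>i<n. C1_map (?A (Suc j + i)) (?D (Suc j + i)) F (?f (Suc j + i)))"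
    using less_Suc_eq_0_disj by auto
  show ?case
  proof (cases "cont_on (?A j) (?D j) F (?f j)")
    case False
    then show ?thesis using c by simp
  next
    case True
    have fF: "?f j x \<in> carrier F" if "x \<in> ?D j" for x
      using continuous_map_funspace [OF True] that dom_subset topological_vector_space.topspace_vtop [OF F]
        topological_vector_space.topspace_vtop [OF tvs_iter [OF V]] by (auto simp: Pi_iff)
    have br: "is_bracket1 (?A j) (?D j) F (?f j) l \<longleftrightarrow>
        cont_on (B (Suc j)) (W (Suc j)) F m \<and> quot_eq (B j) (W j) F g m"
      if "\<And>x y t. (x, y, t) \<in> dom1 (?A j) (?D j) \<Longrightarrow> m (tr (embed h x) (embed h y) t) = l (x, y, t)"
        "l \<in> extensional (dom1 (?A j) (?D j))" for l m
      using iso_bracket [where f = "?f j" and f' = g and g = l and g' = m,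
          OF tvs_iter [OF V] tvs_B iso_embed F dom_subset Suc.prems fF that]
      by (simp add: image_embed Suc_B Suc_W)
    show ?thesis
    proof
      assume L: "cont_on (?A j) (?D j) F (?f j) \<and>
          (\<forall>i<Suc n. C1_map (?A (j + i)) (?D (j + i)) F (?f (j + i)))"
      then obtain k where k: "is_bracket1 (?A j) (?D j) F (?f j) k"
        unfolding all by (auto simp: C1_map_def)
      note S = iter_bracket_Suc [OF True k]
      \<comment> \<open>The next bracket, read through the inverse of the embedding at level
        \<open>Suc j\<close>, is the quotient that \<open>CN\<close> asks for.\<close>
      define e' where "e' = inv_into (carrier (?A (Suc j))) (embed h)"
      have e': "e' (embed h p) = p" if "p \<in> carrier (?A (Suc j))" for p
        unfolding e'_def by (rule inv_into_f_f [OF iso_inj [OF tvs_iter [OF V] tvs_B iso_embed] that])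
      define g' where "g' = (\<lambda>p. ?f (Suc j) (e' p))"
      have g': "g' (embed h p) = ?f (Suc j) p" if "p \<in> ?D (Suc j)" for p
        unfolding g'_def by (subst e') (use dom_subset [of "Suc j"] that in \<open>auto simp del: iter_tvs.simps iter_dom.simps\<close>)
      have "CN n (B (Suc j)) (W (Suc j)) F g'"
        using Suc.IH [where j = "Suc j" and g = g', OF g'] S(2) L unfolding all by blast
      moreover have "quot_eq (B j) (W j) F g g'"
      proof -
        have "g' (tr (embed h x) (embed h y) t) = k (x, y, t)" if "(x, y, t) \<in> dom1 (?A j) (?D j)" for x y t
        proof -
          have "triple (x, y, t) \<in> ?D (Suc j)" using that by simp
          from g' [OF this] S(1) [OF that] show ?thesis
            unfolding triple_def prod.case embed.simps by simp
        qed
        from br [where l = k and m = g', OF this] k show ?thesis by (simp add: is_bracket1_def)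
      qed
      ultimately show "CN (Suc n) (B j) (W j) F g"
        using c True by (auto simp: Suc_B Suc_W)
    next
      assume "CN (Suc n) (B j) (W j) F g"
      then obtain g' where g': "quot_eq (B j) (W j) F g g'" "CN n (B (Suc j)) (W (Suc j)) F g'"
        by (auto simp: Suc_B Suc_W)
      \<comment> \<open>Conversely the given quotient is pulled back along the embedding and made
        extensional, as \<open>is_bracket1\<close> demands; uniqueness then shows that it is the
        next bracket.\<close>
      define k where "k = restrict (\<lambda>(x, y, t). g' (tr (embed h x) (embed h y) t)) (dom1 (?A j) (?D j))"
      have k: "is_bracket1 (?A j) (?D j) F (?f j) k"
        using br [of g' k] g'(1) CN_cont [OF g'(2)] by (simp add: k_def)
      note S = iter_bracket_Suc [OF True k]
      have "g' (embed h p) = ?f (Suc j) p" if p: "p \<in> ?D (Suc j)" for p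
      proof -
        obtain q where "q \<in> dom1 (?A j) (?D j)" "p = triple q" using p by auto
        moreover obtain x y t where "q = (x, y, t)" by (cases q)
        ultimately show ?thesis using S(1) [of q] by (simp add: k_def triple_def)
      qed
      from Suc.IH [where j = "Suc j" and g = g', OF this] g'(2)
      show "cont_on (?A j) (?D j) F (?f j) \<and>
          (\<forall>i<Suc n. C1_map (?A (j + i)) (?D (j + i)) F (?f (j + i)))"
        unfolding all using True k by (auto simp: C1_map_def)
    qed
  qed
qed

text \<open>The chain that starts at level \<open>0\<close>. As \<open>g\<close> is free outside the
  copy of \<open>U\<close>, any convenient formula for \<open>f\<close> inside \<open>univ\<close>
  may be used.\<close>

lemma Cn_map_iff_CN:
  assumes g: "\<And>x. x \<in> U \<Longrightarrow> g (h x) = f x"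
  shows "Cn_map n V U F f \<longleftrightarrow> CN n (B 0) (h ` U) F g"
proof -
  have p0: "g (embed h p) = iter_bracket V U F f 0 p" if "p \<in> iter_dom V U 0" for p
    using that g by (auto simp: inj_Base)
  from C1_chain_iff_CN [where j = 0 and g = g and f = f and n = n, OF p0]
  have "continuous_map (iter_space V U 0) (vtop F) (iter_bracket V U F f 0) \<and>
      (\<forall>i<n. C1_map (iter_tvs V i) (iter_dom V U i) F (iter_bracket V U F f i)) \<longleftrightarrow> CN n (B 0) (h ` U) F g"
    by (simp only: W0 add_0)
  moreover have "continuous_map (iter_space V U 0) (vtop F) (iter_bracket V U F f 0)
     \<longleftrightarrow> cont_on (B 0) (h ` U) F g"
    using cont_embed_iff [where j = 0 and g = g and \<phi> = "iter_bracket V U F f 0", OF p0] by (simp only: W0)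
  moreover have "cont_on V U F f \<longleftrightarrow>
      cont_on (B 0) (h ` U) F g"
    by (rule iso_cont [where f = f and f' = g, OF V B0 h UV g])
  ultimately show ?thesis unfolding Cn_map_iff by blast
qed

end


section \<open>Calculus of differentiable maps\<close>


text \<open>The quotient of \<open>L\<close> after \<open>f\<close> is \<open>L\<close> after the
  quotient of \<open>f\<close>. Since neither target has to lie in \<open>univ\<close>, this moves
  targets into \<open>univ\<close> and out of it again.\<close>

lemma CN_post_linear:
  assumes "topological_vector_space V" "topological_vector_space F" "CN n V U F f" "U \<subseteq> carrier V"
    and L: "continuous_map (vtop F) (vtop F') L"
    and L': "\<And>x y t. x \<in> carrier F \<Longrightarrow> y \<in> carrier F \<Longrightarrow>
          L (comb F x t y) = comb F' (L x) t (L y)"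
  shows "CN n V U F' (\<lambda>x. L (f x))"
  using assms(1,3,4)
proof (induction n arbitrary: V U f)
  case 0
  then show ?case using continuous_map_compose [OF _ L] by (simp add: o_def)
next
  case (Suc n)
  then obtain g where g: "quot_eq V U F f g" "CN n (ubr V) (udom V U) F g" by auto
  note ts = topological_vector_space.topspace_vtop
  have "CN n (ubr V) (udom V U) F' (\<lambda>x. L (g x))"
    using Suc g tvs_ubr udom_subset by blast
  moreover have "quot_eq V U F' (\<lambda>x. L (f x)) (\<lambda>x. L (g x))"
    unfolding quot_eq_def
  proof (intro ballI allI impI)
    fix x y t assume xy: "x \<in> U" "y \<in> carrier V" "comb V x t y \<in> U"
    then have "f (comb V x t y) = comb F (f x) t (g (tr x y t))"
      using g(1) by (simp add: quot_eq_def)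
    moreover have "f x \<in> carrier F"
      using CN_maps [OF Suc.prems(2) ts ts] Suc.prems assms(2) xy by blast
    moreover have "g (tr x y t) \<in> carrier F"
      by (rule CN_maps [OF g(2) ts [OF tvs_ubr] ts]) (use Suc.prems assms(2) xy udom_subset in auto)
    ultimately show "L (f (comb V x t y)) = comb F' (L (f x)) t (L (g (tr x y t)))"
      using L' by simp
  qed
  moreover have "cont_on V U F' (\<lambda>x. L (f x))"
    using continuous_map_compose [OF CN_cont [OF Suc.prems(2)] L] by (simp add: o_def)
  ultimately show ?case by auto
qed

lemma
  fixes F :: "('k::topological_field, 'f) tvs"
  assumes V: "topological_vector_space V" and F: "topological_vector_space F" and U: "U \<subseteq> carrier V"
    and h: "inj h"
  shows CN_into_map_tvs: "CN n V U F f \<Longrightarrow> CN n V U (map_tvs h F) (\<lambda>x. h (f x))"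
    and CN_from_map_tvs: "CN n V U (map_tvs h F) g \<Longrightarrow> CN n V U F (\<lambda>x. inv_into UNIV h (g x))"
proof -
  show "CN n V U F f \<Longrightarrow> CN n V U (map_tvs h F) (\<lambda>x. h (f x))"
    by (rule CN_post_linear [OF V F _ U])
      (use h continuous_map_into_map_tvs [OF h topological_vector_space.topspace_vtop [OF F] continuous_map_ident] in auto)
  show "CN n V U (map_tvs h F) g \<Longrightarrow> CN n V U F (\<lambda>x. inv_into UNIV h (g x))"
    by (rule CN_post_linear [OF V tvs_map [OF F h] _ U]) (use h continuous_map_inv_map_tvs [OF h, of F] in auto)
qed

lemma embeddedI:
  assumes V: "topological_vector_space V" and F: "topological_vector_space F" and U: "openin (vtop V) U"
    and B: "topological_vector_space B" and h: "tvs_iso h V B"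
  shows "embedded V U F h (\<lambda>j. (ubr ^^ j) B) (rec_nat (h ` U) (\<lambda>j. udom ((ubr ^^ j) B)))"
  by (rule embedded.intro) (simp_all add: assms)

lemma Cn_map_iff_CN_iso:
  assumes V: "topological_vector_space V" and F: "topological_vector_space F" and U: "openin (vtop V) U"
    and B: "topological_vector_space B" and h: "tvs_iso h V B" and g: "\<And>x. x \<in> U \<Longrightarrow> g (h x) = f x"
  shows "Cn_map n V U F f \<longleftrightarrow> CN n B (h ` U) F g"
  using embedded.Cn_map_iff_CN [where f = f and g = g, OF embeddedI [OF V F U B h] g] by simp

lemma Cn_map_iff_CN_map:
  assumes V: "topological_vector_space V" and F: "topological_vector_space F" and U: "openin (vtop V) U"
    and h: "inj h"
  shows "Cn_map n V U F f \<longleftrightarrow> CN n (map_tvs h V) (h ` U) F (\<lambda>p. f (inv_into UNIV h p))"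
  by (rule Cn_map_iff_CN_iso [OF V F U tvs_map [OF V h] tvs_iso_map [OF V h]]) (simp add: h)

text \<open>The chain rule inside \<open>univ\<close> wants both spaces over one type of atoms; the
  sum type keeps copies of \<open>V\<close> and \<open>W\<close> side by side.\<close>

lemma Cn_map_compose:
  fixes V :: "('k::topological_field, 'v) tvs" and W :: "('k, 'w) tvs"
  assumes V: "topological_vector_space V" and W: "topological_vector_space W" and F: "topological_vector_space F"
    and U: "openin (vtop V) U" and U': "openin (vtop W) U'"
    and f: "Cn_map n V U W f" and g: "Cn_map n W U' F g" and sub: "\<And>x. x \<in> U \<Longrightarrow> f x \<in> U'"
  shows "Cn_map n V U F (\<lambda>x. g (f x))"
proof -
  define h1 :: "'v \<Rightarrow> ('k, 'v + 'w) univ" where "h1 = (\<lambda>x. Atom (Inl x))"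
  define h2 :: "'w \<Rightarrow> ('k, 'v + 'w) univ" where "h2 = (\<lambda>x. Atom (Inr x))"
  have h: "inj h1" "inj h2" by (auto simp: h1_def h2_def inj_def)
  have sV: "h1 ` U \<subseteq> carrier (map_tvs h1 V)" and sW: "h2 ` U' \<subseteq> carrier (map_tvs h2 W)"
    using topological_vector_space.open_subset_carrier U U' V W by fastforce+
  have "CN n (map_tvs h1 V) (h1 ` U) (map_tvs h2 W) (\<lambda>p. h2 (f (inv_into UNIV h1 p)))"
    using f Cn_map_iff_CN_map [OF V W U h(1)] CN_into_map_tvs [OF tvs_map [OF V h(1)] W sV h(2)] by blast
  from CN_compose [OF tvs_map [OF V h(1)] tvs_map [OF W h(2)] this _ sV sW]
  have "CN n (map_tvs h1 V) (h1 ` U) F (\<lambda>p. g (inv_into UNIV h2 (h2 (f (inv_into UNIV h1 p)))))"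
    using g Cn_map_iff_CN_map [OF W F U' h(2)] sub by (fastforce simp: h)
  then show ?thesis
    using Cn_map_iff_CN_map [OF V F U h(1)] by (simp add: h)
qed

lemma Cn_map_subset:
  fixes V :: "('k::topological_field, 'v) tvs"
  assumes V: "topological_vector_space V" and F: "topological_vector_space F"
    and U: "openin (vtop V) U" and U': "openin (vtop V) U'" "U' \<subseteq> U" and f: "Cn_map n V U F f"
  shows "Cn_map n V U' F f"
proof -
  define h :: "'v \<Rightarrow> ('k, 'v) univ" where "h = Atom"
  have h: "inj h" by (auto simp: h_def inj_def)
  show ?thesis
    using f U'(2) Cn_map_iff_CN_map [OF V F _ h, of _ n f] U U'(1)
      CN_subset [of n "map_tvs h V" "h ` U" F "\<lambda>p. f (inv_into UNIV h p)" "h ` U'"] by blast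
qed

text \<open>\<open>CN_local\<close> forms differences and scalar multiples of values of
  \<open>f\<close>, so the target has to be embedded along with the source.\<close>

lemma Cn_map_local:
  fixes V :: "('k::topological_field, 'v) tvs" and F :: "('k, 'f) tvs"
  assumes V: "topological_vector_space V" and F: "topological_vector_space F" and U: "openin (vtop V) U"
    and loc: "\<And>x. x \<in> U \<Longrightarrow> \<exists>U'. openin (vtop V) U' \<and> x \<in> U' \<and> U' \<subseteq> U \<and> Cn_map n V U' F f"
  shows "Cn_map n V U F f"
proof -
  define h1 :: "'v \<Rightarrow> ('k, 'v + 'f) univ" where "h1 = (\<lambda>x. Atom (Inl x))"
  define h2 :: "'f \<Rightarrow> ('k, 'v + 'f) univ" where "h2 = (\<lambda>x. Atom (Inr x))"
  have h: "inj h1" "inj h2" by (auto simp: h1_def h2_def inj_def)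
  note V' = tvs_map [OF V h(1)] and F' = tvs_map [OF F h(2)]
  have sV: "h1 ` A \<subseteq> carrier (map_tvs h1 V)" if "openin (vtop V) A" for A
    using topological_vector_space.open_subset_carrier [OF V that] by auto
  have o: "openin (vtop (map_tvs h1 V)) (h1 ` A)" if "openin (vtop V) A" for A
    using iso_open [OF V V' tvs_iso_map [OF V h(1)]] topological_vector_space.open_subset_carrier [OF V that] that by blast
  let ?f = "\<lambda>p. h2 (f (inv_into UNIV h1 p))"
  have "CN n (map_tvs h1 V) (h1 ` U) (map_tvs h2 F) ?f"
  proof (rule CN_local [OF V' F' o [OF U]])
    fix p assume "p \<in> h1 ` U"
    then obtain x where x: "x \<in> U" "p = h1 x" by blast
    then obtain A where A: "openin (vtop V) A" "x \<in> A" "A \<subseteq> U" "Cn_map n V A F f"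
      using loc by blast
    have "CN n (map_tvs h1 V) (h1 ` A) (map_tvs h2 F) ?f"
      using A(4) Cn_map_iff_CN_map [OF V F A(1) h(1)] CN_into_map_tvs [OF V' F sV [OF A(1)] h(2)] by blast
    then show "\<exists>U'. openin (vtop (map_tvs h1 V)) U' \<and> p \<in> U' \<and> U' \<subseteq> h1 ` U \<and>
        CN n (map_tvs h1 V) U' (map_tvs h2 F) ?f"
      using o [OF A(1)] A x by (intro exI [of _ "h1 ` A"]) auto
  qed
  from CN_from_map_tvs [OF V' F sV [OF U] h(2) this] show ?thesis
    using Cn_map_iff_CN_map [OF V F U h(1)] by (simp add: h)
qed

text \<open>Level \<open>0\<close> restricts the function to \<open>U\<close>, so both sides start
  with the same function; each later level depends on the previous one only.\<close>

lemma iter_bracket_cong: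
  assumes "\<And>x. x \<in> U \<Longrightarrow> f x = g x"
  shows "iter_bracket V U F f j = iter_bracket V U F g j"
proof (induction j)
  case 0
  show ?case unfolding iter_bracket.simps iter_dom.simps
    by (rule restrict_ext) (auto simp: inj_Base assms)
qed (simp add: iter_bracket.simps(2))

lemma Cn_map_cong:
  assumes "\<And>x. x \<in> U \<Longrightarrow> f x = g x"
  shows "Cn_map n V U F f \<longleftrightarrow> Cn_map n V U F g"
proof -
  have "cont_on V U F f \<longleftrightarrow> cont_on V U F g"
    using assms by (intro iffI; elim continuous_map_eq) auto
  moreover have "iter_bracket V U F f j = iter_bracket V U F g j" for j
    by (rule iter_bracket_cong) (rule assms)
  ultimately show ?thesis
    unfolding Cn_map_iff by simp
qed

lemma Cn_map_mono: "Cn_map n V U F f \<Longrightarrow> m \<le> n \<Longrightarrow> Cn_map m V U F f"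
  by (auto simp: Cn_map_iff)

lemma Cn_map_cont: "Cn_map n V U F f \<Longrightarrow> cont_on V U F f"
  by (simp add: Cn_map_iff)

lemma Cn_map_ident:
  fixes V :: "('k::topological_field, 'v) tvs"
  assumes V: "topological_vector_space V" and U: "openin (vtop V) U"
  shows "Cn_map n V U V (\<lambda>x. x)"
proof -
  define h :: "'v \<Rightarrow> ('k, 'v) univ" where "h = Atom"
  have h: "inj h" by (auto simp: h_def inj_def)
  have "CN n (map_tvs h V) (h ` U) V (inv_into UNIV h)"
    by (rule CN_linear [OF tvs_map [OF V h] continuous_map_inv_map_tvs [OF h]])
      (use topological_vector_space.open_subset_carrier [OF V U] h in auto)
  then show ?thesis using Cn_map_iff_CN_map [OF V V U h] by simp
qed

section \<open>Properties of the brackets: continuity, quotient equation and linearity\<close>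

context embedded
begin

lemma iter_bracket_cont:
  assumes "Cn_map n V U F f" "j \<le> n"
  shows "continuous_map (iter_space V U j) (vtop F) (iter_bracket V U F f j)"
  using assms(2)
proof (induction j)
  case 0
  interpret V: topological_vector_space V by (rule V)
  let ?B = "Base :: 'v \<Rightarrow> ('k, 'v) iter"
  have "continuous_map (subtopology (vtop (map_tvs ?B V)) (?B ` U)) (subtopology (vtop V) U) (inv_into UNIV ?B)"
    using continuous_map_inv_map_tvs [of ?B V, OF inj_Base]
    by (auto simp: continuous_map_in_subtopology continuous_map_from_subtopology inj_Base)
  from continuous_map_compose [OF this Cn_map_cont [OF assms(1)]]
  show ?case
    unfolding iter_tvs.simps iter_dom.simps by (rule continuous_map_eq) (auto simp: inj_Base)
next
  case (Suc j)
  then obtain k where k: "is_bracket1 (iter_tvs V j) (iter_dom V U j) F (iter_bracket V U F f j) k"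
    using assms(1) by (auto simp: Cn_map_iff C1_map_def Suc_le_eq)
  show ?case by (rule iter_bracket_Suc(2) [OF _ k]) (use Suc in simp)
qed

lemma iter_bracket_mem:
  assumes "Cn_map n V U F f" "j \<le> n" "p \<in> iter_dom V U j"
  shows "iter_bracket V U F f j p \<in> carrier F"
  using continuous_map_funspace [OF iter_bracket_cont [OF assms(1,2)]] assms(3) dom_subset
    topological_vector_space.topspace_vtop [OF F] topological_vector_space.topspace_vtop [OF tvs_iter [OF V]]
  by (auto simp: Pi_iff)

text \<open>The quotient property with cleared denominator, hence valid at \<open>t = 0\<close> as
  well and in the form required by \<open>quot_eq\<close>.\<close>

lemma iter_bracket_eq:
  assumes f: "Cn_map n V U F f" and j: "j < n"
    and p: "x \<in> iter_dom V U j" "y \<in> carrier (iter_tvs V j)" "comb (iter_tvs V j) x t y \<in> iter_dom V U j"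
  shows "iter_bracket V U F f j (comb (iter_tvs V j) x t y) =
    comb F (iter_bracket V U F f j x) t (iter_bracket V U F f (Suc j) (Triple x y t))"
proof -
  have m: "iter_bracket V U F f j q \<in> carrier F" if "q \<in> iter_dom V U j" for q
    using iter_bracket_mem [OF f _ that] j by simp
  obtain k where k: "is_bracket1 (iter_tvs V j) (iter_dom V U j) F (iter_bracket V U F f j) k"
    using f j by (auto simp: Cn_map_iff C1_map_def)
  have "iter_bracket V U F f (Suc j) (triple (x, y, t)) = k (x, y, t)"
    using j p by (intro iter_bracket_Suc(1) [OF iter_bracket_cont [OF f] k]) (auto simp: dom1_def)
  then show ?thesis
    using k is_bracket1_iff [where f = "iter_bracket V U F f j" and g = k, OF tvs_iter [OF V] F dom_subset m] p
    by (simp add: triple_def)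
qed

text \<open>Order and formula are proved in one induction: the next bracket of the combination can
  be identified by uniqueness only after the formula for its present bracket is known.\<close>

lemma
  assumes f: "Cn_map n V U F f" and g: "Cn_map n V U F g"
  shows Cn_map_lincomb: "Cn_map n V U F (\<lambda>x. comb F (f x) c (g x))"
    and iter_bracket_lincomb: "\<And>j p. j \<le> n \<Longrightarrow> p \<in> iter_dom V U j \<Longrightarrow>
      iter_bracket V U F (\<lambda>x. comb F (f x) c (g x)) j p =
      comb F (iter_bracket V U F f j p) c (iter_bracket V U F g j p)"
proof -
  interpret F: topological_vector_space F by (rule F)
  let ?s = "\<lambda>x. comb F (f x) c (g x)"
  have "Cn_map m V U F ?s \<and> (\<forall>j\<le>m. \<forall>p\<in>iter_dom V U j.
      iter_bracket V U F ?s j p = comb F (iter_bracket V U F f j p) c (iter_bracket V U F g j p))"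
    if "m \<le> n" for m
    using that
  proof (induction m)
    case 0
    have "cont_on V U F ?s"
      using Cn_map_cont [OF f] Cn_map_cont [OF g] F.topspace_vtop
      by (intro F.continuous_map_add F.continuous_map_smult) auto
    then show ?case by (auto simp: inj_Base)
  next
    case (Suc m)
    then have IH: "Cn_map m V U F ?s"
      and eq: "\<And>j p. j \<le> m \<Longrightarrow> p \<in> iter_dom V U j \<Longrightarrow> iter_bracket V U F ?s j p = comb F (iter_bracket V U F f j p) c (iter_bracket V U F g j p)"
      by auto
    let ?A = "iter_tvs V m" and ?D = "iter_dom V U m"
    let ?P = "subtopology (vtop (prod_tvs ?A (prod_tvs ?A scalar_tvs))) (dom1 ?A ?D)"
    have mem: "iter_bracket V U F f i p \<in> carrier F" "iter_bracket V U F g i p \<in> carrier F"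
      if "p \<in> iter_dom V U i" "i \<le> Suc m" for p i
      using iter_bracket_mem [OF f] iter_bracket_mem [OF g] that Suc.prems by auto
    \<comment> \<open>The same combination of the two next brackets is the candidate;
      \<open>comb_swap\<close> confirms that it satisfies the quotient equation.\<close>
    define k where "k = restrict (\<lambda>p. comb F (iter_bracket V U F f (Suc m) (triple p)) c (iter_bracket V U F g (Suc m) (triple p))) (dom1 ?A ?D)"
    have k: "is_bracket1 ?A ?D F (iter_bracket V U F ?s m) k"
    proof (subst is_bracket1_iff [OF tvs_iter [OF V] F dom_subset])
      show "iter_bracket V U F ?s m x \<in> carrier F" if "x \<in> ?D" for x
        using eq [OF order_refl that] mem [OF that] by simp
      have "continuous_map ?P (vtop F) k"
      proof -
        have "continuous_map ?P (vtop (iter_tvs V (Suc m))) triple"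
          unfolding iter_tvs.simps
          by (intro continuous_map_from_subtopology continuous_map_into_map_tvs [OF inj_triple _ continuous_map_ident]
             topological_vector_space.topspace_vtop tvs_prod tvs_iter V tvs_scalar)
        then have t: "continuous_map ?P (iter_space V U (Suc m)) triple"
          by (auto simp: continuous_map_in_subtopology)
        show ?thesis
        proof (rule continuous_map_eq)
          show "continuous_map ?P (vtop F) (\<lambda>p. comb F (iter_bracket V U F f (Suc m) (triple p)) c (iter_bracket V U F g (Suc m) (triple p)))"
            using continuous_map_compose [OF t iter_bracket_cont [OF f Suc.prems]]
              continuous_map_compose [OF t iter_bracket_cont [OF g Suc.prems]]
            by (intro F.continuous_map_add F.continuous_map_smult) (simp_all add: o_def)
        qed (simp add: k_def)
      qed
      moreover have "\<forall>x\<in>?D. \<forall>y\<in>carrier ?A. \<forall>t. comb ?A x t y \<in> ?D \<longrightarrow>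
          iter_bracket V U F ?s m (comb ?A x t y) =
          comb F (iter_bracket V U F ?s m x) t (k (x, y, t))"
      proof (intro ballI allI impI)
        fix x y t assume xy: "x \<in> ?D" "y \<in> carrier ?A" "comb ?A x t y \<in> ?D"
        let ?T = "Triple x y t"
        have T: "?T \<in> iter_dom V U (Suc m)" using xy unfolding iter_dom_Suc by blast
        note M = mem [OF xy(1), simplified] mem [OF T, simplified]
        have "m < n" using Suc.prems by simp
        have "iter_bracket V U F ?s m (comb ?A x t y) =
           comb F (iter_bracket V U F f m (comb ?A x t y)) c (iter_bracket V U F g m (comb ?A x t y))"
          by (rule eq [OF order_refl xy(3)])
        also have "\<dots> = comb F (comb F (iter_bracket V U F f m x) t (iter_bracket V U F f (Suc m) ?T)) c (comb F (iter_bracket V U F g m x) t (iter_bracket V U F g (Suc m) ?T))"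
          by (simp only: iter_bracket_eq [OF f \<open>m < n\<close> xy] iter_bracket_eq [OF g \<open>m < n\<close> xy])
        also have "\<dots> = comb F (comb F (iter_bracket V U F f m x) c (iter_bracket V U F g m x)) t (comb F (iter_bracket V U F f (Suc m) ?T) c (iter_bracket V U F g (Suc m) ?T))"
          by (rule F.comb_swap) (use M in auto)
        also have "comb F (iter_bracket V U F f m x) c (iter_bracket V U F g m x) = iter_bracket V U F ?s m x"
          by (rule eq [OF order_refl xy(1), symmetric])
        also have "comb F (iter_bracket V U F f (Suc m) ?T) c (iter_bracket V U F g (Suc m) ?T) = k (x, y, t)"
          using xy by (simp add: k_def dom1_def triple_def)
        finally show "iter_bracket V U F ?s m (comb ?A x t y) =
          comb F (iter_bracket V U F ?s m x) t (k (x, y, t))" .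
      qed
      ultimately show "k \<in> extensional (dom1 ?A ?D) \<and> continuous_map ?P (vtop F) k \<and>
         (\<forall>x\<in>?D. \<forall>y\<in>carrier ?A. \<forall>t. comb ?A x t y \<in> ?D \<longrightarrow>
          iter_bracket V U F ?s m (comb ?A x t y) =
          comb F (iter_bracket V U F ?s m x) t (k (x, y, t)))"
        by (auto simp: k_def)
    qed
    then have Cn: "Cn_map (Suc m) V U F ?s"
      using IH iter_bracket_cont [OF IH order_refl] by (auto simp: C1_map_def iter_bracket.simps)
    have "iter_bracket V U F ?s (Suc m) p = comb F (iter_bracket V U F f (Suc m) p) c (iter_bracket V U F g (Suc m) p)"
      if p: "p \<in> iter_dom V U (Suc m)" for p
    proof -
      obtain q where q: "q \<in> dom1 ?A ?D" "p = triple q" using p by auto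
      then show ?thesis
        using iter_bracket_Suc(1) [OF iter_bracket_cont [OF IH order_refl] k q(1)] by (simp add: k_def)
    qed
    then show ?case using Cn eq by (auto simp: le_Suc_eq simp del: iter_dom.simps Cn_map.simps)
  qed
  then show "Cn_map n V U F ?s"
    and "\<And>j p. j \<le> n \<Longrightarrow> p \<in> iter_dom V U j \<Longrightarrow> iter_bracket V U F ?s j p =
      comb F (iter_bracket V U F f j p) c (iter_bracket V U F g j p)"
    by blast+
qed

end


text \<open>The second condition keeps base points from looking like triples. Injectivity on all
  levels at once yields a single inverse for every \<open>j\<close>.\<close>

lemma inj_embed:
  fixes h :: "'v \<Rightarrow> ('k, 'a) univ"
  assumes h: "inj h" and Pr: "\<And>v x y. h v \<noteq> Pr x y"
  shows "inj (embed h)"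
proof (rule injI)
  fix p q :: "('k, 'v) iter"
  show "embed h p = embed h q \<Longrightarrow> p = q"
  proof (induction p arbitrary: q)
    case (Base v)
    then show ?case using h Pr by (cases q) (auto simp: inj_def)
  next
    case (Triple a b t)
    then show ?case using Pr [symmetric] by (cases q) auto
  qed
qed

text \<open>\<open>CN_eval\<close> carried back to arbitrary types. Parameter space, domain and
  target receive disjoint copies over a threefold sum of atom types; the target is included because
  \<open>CN_eval\<close> adds values in it.\<close>

lemma Cn_map_eval:
  fixes G :: "('k::topological_field, 'g) tvs" and V :: "('k, 'v) tvs" and F :: "('k, 'f) tvs"
  assumes G: "topological_vector_space G" and V: "topological_vector_space V" and F: "topological_vector_space F"
    and U: "openin (vtop V) U"
    and Cn: "\<And>\<gamma>. \<gamma> \<in> carrier G \<Longrightarrow> Cn_map n V U F (\<phi> \<gamma>)"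
    and cont: "\<And>j. j \<le> n \<Longrightarrow> continuous_map
        (prod_topology (vtop G) (iter_space V U j)) (vtop F)
        (\<lambda>z. iter_bracket V U F (\<phi> (fst z)) j (snd z))"
    and lin: "\<And>\<gamma> \<eta> t x. \<gamma> \<in> carrier G \<Longrightarrow> \<eta> \<in> carrier G \<Longrightarrow> x \<in> U \<Longrightarrow>
        \<phi> (comb G \<gamma> t \<eta>) x = comb F (\<phi> \<gamma> x) t (\<phi> \<eta> x)"
  shows "Cn_map n (prod_tvs G V) (carrier G \<times> U) F (\<lambda>z. \<phi> (fst z) (snd z))"
proof -
  interpret G: topological_vector_space G by (rule G)
  interpret V: topological_vector_space V by (rule V)
  define hG :: "'g \<Rightarrow> ('k, 'g + 'v + 'f) univ" where "hG = (\<lambda>x. Atom (Inl x))"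
  define hV :: "'v \<Rightarrow> ('k, 'g + 'v + 'f) univ" where "hV = (\<lambda>x. Atom (Inr (Inl x)))"
  define hF :: "'f \<Rightarrow> ('k, 'g + 'v + 'f) univ" where "hF = (\<lambda>x. Atom (Inr (Inr x)))"
  have h: "inj hG" "inj hV" "inj hF" by (auto simp: hG_def hV_def hF_def inj_def)
  define G' where "G' = map_tvs hG G"
  define V' where "V' = map_tvs hV V"
  define F' where "F' = map_tvs hF F"
  have G': "topological_vector_space G'" and V': "topological_vector_space V'" and F': "topological_vector_space F'"
    using tvs_map G V F h by (auto simp: G'_def V'_def F'_def)
  interpret G': topological_vector_space G' by (rule G')
  interpret V': topological_vector_space V' by (rule V')
  interpret F: topological_vector_space F by (rule F)
  define B where "B = (\<lambda>j. (ubr ^^ j) V')"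
  define W where "W = rec_nat (hV ` U) (\<lambda>j. udom (B j))"
  interpret E: embedded V U F hV B W
    unfolding B_def W_def using embeddedI [OF V F U V'] tvs_iso_map [OF V h(2)] by (simp add: V'_def B_def)
  have ie: "inj (embed hV)"
    by (rule inj_embed [OF h(2)]) (simp add: hV_def)
  define e' where "e' = inv_into UNIV (embed hV)"
  have e': "e' (embed hV p) = p" for p by (simp add: e'_def ie)
  define \<psi> where "\<psi> = (\<lambda>j \<gamma> p. hF (iter_bracket V U F (\<phi> (inv_into UNIV hG \<gamma>)) j (e' p)))"
  have \<psi>: "\<psi> j (hG \<gamma>) (embed hV p) = hF (iter_bracket V U F (\<phi> \<gamma>) j p)" for j \<gamma> p
    by (simp add: \<psi>_def h e')
  have c: "continuous_map (prod_topology (vtop G') (subtopology (vtop (B j)) (W j))) (vtop F') (\<lambda>z. \<psi> j (fst z) (snd z))"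
    if j: "j \<le> n" for j
  proof -
    \<comment> \<open>The set-theoretic inverse \<open>e'\<close> is uniform in \<open>j\<close> but
      carries no continuity; \<open>k\<close> is the continuous inverse at level \<open>j\<close>,
      and the two agree on the embedded domain.\<close>
    obtain k where k: "homeomorphic_maps (vtop (iter_tvs V j)) (vtop (B j)) (embed hV) k"
      using E.iso_embed [of j] unfolding tvs_iso_def by blast
    have kp: "k (embed hV p) = p" if "p \<in> iter_dom V U j" for p
      using k subsetD [OF E.dom_subset that] topological_vector_space.topspace_vtop [OF tvs_iter [OF V]]
      by (simp add: homeomorphic_maps_def)
    have kc: "continuous_map (subtopology (vtop (B j)) (W j)) (iter_space V U j) k"
      using k kp by (auto simp: homeomorphic_maps_def continuous_map_in_subtopology continuous_map_from_subtopology
          simp flip: E.image_embed)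
    let ?S = "prod_topology (vtop G') (subtopology (vtop (B j)) (W j))"
    have "continuous_map ?S (vtop G) (\<lambda>z. inv_into UNIV hG (fst z))"
      using continuous_map_compose [OF continuous_map_fst continuous_map_inv_map_tvs [OF h(1), of G]]
      by (simp add: o_def G'_def)
    moreover have "continuous_map ?S (iter_space V U j) (\<lambda>z. k (snd z))"
      using continuous_map_compose [OF continuous_map_snd kc] by (simp add: o_def)
    ultimately have "continuous_map ?S (prod_topology (vtop G) (iter_space V U j))
        (\<lambda>z. (inv_into UNIV hG (fst z), k (snd z)))"
      by (rule continuous_map_pairedI)
    from continuous_map_into_map_tvs [OF h(3) F.topspace_vtop continuous_map_compose [OF this cont [OF j]]]
    have "continuous_map (prod_topology (vtop G') (subtopology (vtop (B j)) (W j))) (vtop F')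
        (\<lambda>z. hF (iter_bracket V U F (\<phi> (inv_into UNIV hG (fst z))) j (k (snd z))))"
      by (simp add: o_def F'_def)
    then show ?thesis
      by (rule continuous_map_eq) (auto simp: \<psi>_def e' kp simp flip: E.image_embed)
  qed
  have q: "quot_eq (B j) (W j) F' (\<psi> j \<gamma>) (\<psi> (Suc j) \<gamma>)" if j: "j < n" and \<gamma>: "\<gamma> \<in> carrier G'" for j \<gamma>
    unfolding quot_eq_def
  proof (intro ballI allI impI)
    fix a b t assume ab: "a \<in> W j" "b \<in> carrier (B j)" "comb (B j) a t b \<in> W j"
    let ?A = "iter_tvs V j"
    note iso = tvs_iter [OF V] E.tvs_B E.iso_embed
    obtain x where x: "x \<in> iter_dom V U j" "a = embed hV x" using ab(1) E.image_embed by blast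
    obtain y where y: "y \<in> carrier ?A" "b = embed hV y" using ab(2) iso_image [OF iso] by blast
    obtain \<gamma>' where g: "\<gamma> = hG \<gamma>'" "\<gamma>' \<in> carrier G" using \<gamma> by (auto simp: G'_def)
    have xA: "x \<in> carrier ?A" using x E.dom_subset by blast
    have s: "comb (B j) a t b = embed hV (comb ?A x t y)"
      using iso_comb [OF iso xA y(1)] x y by simp
    have xy: "comb ?A x t y \<in> iter_dom V U j"
      using ab(3) iso_mem [OF iso E.dom_subset xA y(1)] x y by (simp add: E.image_embed)
    have T: "tr a b t = embed hV (Triple x y t)" using x y by simp
    show "\<psi> j \<gamma> (comb (B j) a t b) = comb F' (\<psi> j \<gamma> a) t (\<psi> (Suc j) \<gamma> (tr a b t))"
      unfolding s T unfolding g(1) x(2) \<psi> E.iter_bracket_eq [OF Cn [OF g(2)] j x(1) y(1) xy]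
      by (simp add: F'_def h)
  qed
  have l: "\<psi> j (comb G' \<gamma> t \<eta>) p = comb F' (\<psi> j \<gamma> p) t (\<psi> j \<eta> p)"
    if a: "j \<le> n" "\<gamma> \<in> carrier G'" "\<eta> \<in> carrier G'" "p \<in> W j" for j \<gamma> \<eta> t p
  proof -
    obtain \<gamma>' \<eta>' where g: "\<gamma> = hG \<gamma>'" "\<gamma>' \<in> carrier G" "\<eta> = hG \<eta>'" "\<eta>' \<in> carrier G"
      using a(2,3) unfolding G'_def by auto
    obtain x where x: "x \<in> iter_dom V U j" "p = embed hV x" using a(4) E.image_embed by blast
    have s: "comb G' \<gamma> t \<eta> = hG (comb G \<gamma>' t \<eta>')"
      using h by (simp add: g G'_def)
    have "iter_bracket V U F (\<phi> (comb G \<gamma>' t \<eta>')) j =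
        iter_bracket V U F (\<lambda>x. comb F (\<phi> \<gamma>' x) t (\<phi> \<eta>' x)) j"
      by (rule iter_bracket_cong) (rule lin [OF g(2,4)])
    then show ?thesis
      unfolding s unfolding g(1,3) x(2) \<psi> using E.iter_bracket_lincomb [OF Cn [OF g(2)] Cn [OF g(4)] a(1) x(1)] h
      by (simp add: F'_def)
  qed
  have B0: "B 0 = V'" and W0: "W 0 = hV ` U" by (simp_all add: B_def W_def)
  let ?S = "{Pr \<gamma> x | \<gamma> x. \<gamma> \<in> carrier G' \<and> x \<in> W 0}"
  have "CN n (uprod G' (B 0)) ?S F' (\<lambda>p. \<psi> 0 (lft p) (rgt p))"
    by (rule CN_eval [where V = B and U = W, OF G' F' _ _ _ _ c q l])
      (use V' E.UV in \<open>auto simp: B0 W0 V'_def E.Suc_B E.Suc_W\<close>)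
  moreover have P: "topological_vector_space (uprod G' (B 0))"
    unfolding B0 by (intro tvs_uprod G' V')
  moreover have "?S \<subseteq> carrier (uprod G' (B 0))"
    using E.UV by (auto simp: B0 W0 V'_def)
  ultimately have main: "CN n (uprod G' (B 0)) ?S F (\<lambda>p. inv_into UNIV hF (\<psi> 0 (lft p) (rgt p)))"
    using CN_from_map_tvs [OF _ F _ h(3)] unfolding F'_def by blast
  \<comment> \<open>The product space is embedded by pairing the two embeddings, which matches the
    form in which \<open>CN_eval\<close> states its domain.\<close>
  define hP where "hP = (\<lambda>z. Pr (hG (fst z)) (hV (snd z)))"
  have im: "hP ` (carrier G \<times> U) = ?S"
    unfolding hP_def G'_def W0 by force
  have iso: "tvs_iso hP (prod_tvs G V) (uprod G' V')"
    unfolding tvs_iso_def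
  proof (intro conjI exI)
    define k where "k = (\<lambda>p :: ('k, 'g + 'v + 'f) univ. (inv_into UNIV hG (lft p), inv_into UNIV hV (rgt p)))"
    note id = continuous_map_ident [of "vtop (uprod G' V')"]
    have "continuous_map (vtop (uprod G' V')) (vtop (prod_tvs G V)) k"
      using continuous_map_compose [OF continuous_map_lft [OF G' V' id] continuous_map_inv_map_tvs [OF h(1), of G, folded G'_def]]
        continuous_map_compose [OF continuous_map_rgt [OF G' V' id] continuous_map_inv_map_tvs [OF h(2), of V, folded V'_def]]
      by (simp add: k_def o_def continuous_map_paired)
    moreover have "continuous_map (vtop (prod_tvs G V)) (vtop (uprod G' V')) hP"
      unfolding hP_def vtop_prod_tvs
      by (intro continuous_map_Pr G' V') (simp_all add: G'_def V'_def h G.topspace_vtop V.topspace_vtop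
          continuous_map_into_map_tvs continuous_map_fst continuous_map_snd)
    ultimately show "homeomorphic_maps (vtop (prod_tvs G V)) (vtop (uprod G' V')) hP k"
      using topological_vector_space.topspace_vtop [OF tvs_prod [OF G V]]
        topological_vector_space.topspace_vtop [OF tvs_uprod [OF G' V']]
      unfolding homeomorphic_maps_def
      by (auto simp: hP_def k_def h carrier_uprod G'_def V'_def)
    show "\<forall>x\<in>carrier (prod_tvs G V). \<forall>y\<in>carrier (prod_tvs G V). \<forall>t. hP (comb (prod_tvs G V) x t y) =
        comb (uprod G' V') (hP x) t (hP y)"
      using h by (auto simp: hP_def G'_def V'_def)
  qed
  have op: "openin (vtop (prod_tvs G V)) (carrier G \<times> U)"
    using U openin_topspace [of "vtop G"] by (simp add: G.topspace_vtop openin_prod_Times_iff)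
  have eq: "inv_into UNIV hF (\<psi> 0 (lft (hP z)) (rgt (hP z))) = \<phi> (fst z) (snd z)" if "z \<in> carrier G \<times> U" for z
    using that \<psi> [of 0 "fst z" "Base (snd z)"] h by (auto simp: hP_def inj_Base)
  show ?thesis
    by (rule Cn_map_iff_CN_iso [where h = hP and g = "\<lambda>p. inv_into UNIV hF (\<psi> 0 (lft p) (rgt p))",
          OF tvs_prod [OF G V] F op _ _ eq, THEN iffD2])
      (use P main iso im B0 in simp_all)
qed


section \<open>Locally compact fields and finite-dimensional spaces\<close>


lemma tendsto_inverse_at:
  "(a :: 'k::topological_field) \<noteq> 0 \<Longrightarrow> (f \<longlongrightarrow> a) F \<Longrightarrow> ((\<lambda>x. inverse (f x)) \<longlongrightarrow> inverse a) F"
  by (rule filterlim_compose [OF tendsto_inverse_nhds])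

text \<open>
  The scalar \<open>c\<close> is chosen so small that all \<open>c\<^sup>m\<close> with \<open>m \<ge> 1\<close> stay in the compact neighbourhood
  \<open>C\<close> of \<open>0\<close> whereas \<open>1/c\<close> does not lie in \<open>C\<close>. If \<open>0\<close> were not a cluster point of the powers, they
  would accumulate at some \<open>a \<noteq> 0\<close>; quotients of powers close to \<open>a\<close> are powers close to \<open>1\<close>, and
  dividing by \<open>c\<close> shows that \<open>1/c\<close> is a limit of points of \<open>C\<close>.
\<close>

lemma ex_small_scalar:
  assumes lc: "locally_compact_space (euclidean :: 'k::topological_field topology)"
  obtains c :: "'k::topological_field" and C D
  where "c \<noteq> 0" "compact C" "open D" "0 \<in> D" "D \<subseteq> C" "\<And>m. c ^ Suc m \<in> C"
    "\<And>A. open A \<Longrightarrow> 0 \<in> A \<Longrightarrow> \<exists>m. c ^ Suc m \<in> A"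
proof -
  have "\<exists>D C. openin euclidean D \<and> compactin euclidean C \<and> (0::'k) \<in> D \<and> D \<subseteq> C"
    using lc by (simp add: locally_compact_space_def)
  then obtain D C where DC: "open D" "compact C" "(0::'k) \<in> D" "D \<subseteq> C"
    by auto
  \<comment> \<open>Removing \<open>1\<close> serves a second purpose of the same neighbourhood:
    products of \<open>N\<close> with \<open>C\<close> stay in \<open>D\<close>, and since
    \<open>c\<close> times \<open>1/c\<close> equals \<open>1\<close>, the inverse of
    \<open>c\<close> cannot lie in \<open>C\<close>.\<close>
  let ?W = "{p \<in> topspace (prod_topology euclidean euclidean). fst p * snd p \<in> D - {1 :: 'k}}"
  have "continuous_map (prod_topology euclidean euclidean) euclidean (\<lambda>p :: 'k \<times> 'k. fst p * snd p)"
    by (intro continuous_map_scalar_mult continuous_map_fst continuous_map_snd)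
  moreover have "openin euclidean (D - {1})"
    using open_delete [OF DC(1)] by simp
  ultimately have "openin (prod_topology euclidean euclidean) ?W"
    by (rule openin_continuous_map_preimage)
  moreover have "{0} \<times> C \<subseteq> ?W" using DC by auto
  ultimately obtain N N' where N: "openin euclidean N" "0 \<in> N" "C \<subseteq> N'" "N \<times> N' \<subseteq> ?W"
    using tube_lemma_right [of euclidean euclidean ?W C 0] DC(2) by auto
  have "x * y \<in> D - {1}" if "x \<in> N" "y \<in> C" for x y
  proof -
    have "(x, y) \<in> ?W" using that N by blast
    then show ?thesis by simp
  qed
  with N(1,2) have N: "open N" "0 \<in> N" "\<And>x y. x \<in> N \<Longrightarrow> y \<in> C \<Longrightarrow> x * y \<in> D - {1}"
    by auto
  \<comment> \<open>An open set containing \<open>0\<close> is larger than \<open>{0}\<close>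
    because the field is not discrete; this provides a nonzero \<open>c\<close>.\<close>
  have "N \<inter> D \<noteq> {0}"
    using not_open_singleton_zero N(1) DC(1) by (metis open_Int)
  then obtain c where c: "c \<in> N" "c \<in> D" "c \<noteq> 0" using N(2) DC(3) by blast
  have pow: "c ^ Suc m \<in> C" for m
  proof (induction m)
    case (Suc m)
    then show ?case using N(3) [OF c(1) Suc] DC(4) by auto
  qed (use c DC in auto)
  have inv: "inverse c \<notin> C"
    using N(3) [OF c(1), of "inverse c"] c(3) by auto
  have small: "\<exists>m. c ^ Suc m \<in> A" if A: "open A" "0 \<in> A" for A
  proof (rule ccontr)
    assume no: "\<nexists>m. c ^ Suc m \<in> A"
    let ?F = "filtermap (\<lambda>m. c ^ Suc m) sequentially"
    have "?F \<noteq> bot" "eventually (\<lambda>x. x \<in> C) ?F"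
      using pow by (simp_all add: filtermap_bot_iff eventually_filtermap)
    then obtain a where a: "a \<in> C" "inf (nhds a) ?F \<noteq> bot"
      using DC(2) unfolding compact_filter by blast
    have often: "\<exists>m\<ge>M. Q (c ^ Suc m)" if Q: "eventually Q (nhds a)" for Q M
    proof (rule ccontr)
      assume "\<not> ?thesis"
      then have "eventually (\<lambda>m. \<not> Q (c ^ Suc m)) sequentially"
        unfolding eventually_sequentially by blast
      then have "eventually (\<lambda>x. \<not> Q x) ?F" by (simp add: eventually_filtermap)
      with Q have "eventually (\<lambda>x. False) (inf (nhds a) ?F)"
        unfolding eventually_inf by blast
      then show False using a(2) by (simp add: trivial_limit_def)
    qed
    have a0: "a \<noteq> 0"
    proof
      assume "a = 0"
      then have "eventually (\<lambda>x. x \<in> A) (nhds a)" using A by (simp add: eventually_nhds_in_open)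
      from often [OF this] no show False by blast
    qed
    have lim: "((\<lambda>p. fst p * inverse (snd p) * inverse c) \<longlongrightarrow> a * inverse a * inverse c) (nhds a \<times>\<^sub>F nhds a)"
      by (intro tendsto_mult tendsto_const tendsto_inverse_at a0 filterlim_fst filterlim_snd)
    have "open (- C)" using compact_imp_closed [OF DC(2)] by (simp add: open_Compl)
    moreover have "a * inverse a * inverse c \<in> - C" using a0 inv by simp
    ultimately have "eventually (\<lambda>p. fst p * inverse (snd p) * inverse c \<in> - C) (nhds a \<times>\<^sub>F nhds a)"
      by (rule topological_tendstoD [OF lim])
    then obtain Q where Q: "eventually Q (nhds a)" "\<And>x y. Q x \<Longrightarrow> Q y \<Longrightarrow> x * inverse y * inverse c \<notin> C"
      unfolding eventually_prod_same by auto
    obtain i where i: "Q (c ^ Suc i)" using often [OF Q(1)] by blast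
    \<comment> \<open>The gap of at least \<open>2\<close> leaves a positive exponent after
      cancelling \<open>c^(i+1)\<close> and one further factor \<open>c\<close>; only positive
      powers are known to lie in \<open>C\<close>.\<close>
    obtain j where j: "j \<ge> i + 2" "Q (c ^ Suc j)" using often [OF Q(1)] by blast
    then obtain l where l: "j = i + 2 + l" using le_Suc_ex by blast
    have eq: "c ^ Suc j = c ^ Suc l * c ^ Suc i * c"
      by (simp add: l power_add power2_eq_square mult_ac)
    have cancel: "u * d * c * inverse d * inverse c = u" if "d \<noteq> 0" for u d
      using c(3) that by (simp add: field_simps)
    have "c ^ Suc j * inverse (c ^ Suc i) * inverse c = c ^ Suc l"
      unfolding eq by (rule cancel) (rule power_not_zero [OF c(3)])
    then show False using Q(2) [OF j(2) i] pow by metis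
  qed
  show thesis
    using that [OF c(3) DC(2,1,3,4) pow small] .
qed

section \<open>Bases and local compactness of finite-dimensional spaces\<close>

context topological_vector_space
begin

lemma lincomb_linear:
  assumes "finite B" "B \<subseteq> carrier V"
  shows "(\<Oplus>b\<in>B. (c b + t * d b) \<odot> b) = (\<Oplus>b\<in>B. c b \<odot> b) \<oplus> t \<odot> (\<Oplus>b\<in>B. d b \<odot> b)"
proof -
  have B: "b \<in> B \<Longrightarrow> b \<in> carrier V" for b using assms by auto
  have "t \<odot> (\<Oplus>b\<in>B. d b \<odot> b) = (\<Oplus>b\<in>B. t \<odot> (d b \<odot> b))"
    using assms B by (intro finsum_smult_ldistr) auto
  moreover have "(\<Oplus>b\<in>B. (c b + t * d b) \<odot> b) = (\<Oplus>b\<in>B. c b \<odot> b \<oplus> t \<odot> (d b \<odot> b))"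
    using B by (intro M.finsum_cong') (auto simp: smult_add_left smult_smult)
  moreover have "\<dots> = (\<Oplus>b\<in>B. c b \<odot> b) \<oplus> (\<Oplus>b\<in>B. t \<odot> (d b \<odot> b))"
    using B by (intro M.finsum_addf) auto
  ultimately show ?thesis by simp
qed

lemma continuous_map_lincomb:
  assumes "finite B" "B \<subseteq> carrier V" "\<And>b. b \<in> B \<Longrightarrow> continuous_map S euclidean (f b)"
  shows "continuous_map S (vtop V) (\<lambda>s. \<Oplus>b\<in>B. f b s \<odot> b)"
  using assms
proof (induction rule: finite_induct)
  case empty
  then show ?case by (simp add: topspace_vtop)
next
  case (insert b B)
  have "continuous_map S (vtop V) (\<lambda>s. f b s \<odot> b \<oplus> (\<Oplus>b\<in>B. f b s \<odot> b))"
    using insert by (intro continuous_map_add continuous_map_smult) (auto simp: topspace_vtop)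
  then show ?case
    by (rule continuous_map_eq, subst M.finsum_insert) (use insert in auto)
qed

lemma lincomb_mem: "B \<subseteq> carrier V \<Longrightarrow> (\<Oplus>b\<in>B. c b \<odot> b) \<in> carrier V"
  by (intro M.finsum_closed) auto

lemma lincomb_cong: "B \<subseteq> carrier V \<Longrightarrow> (\<And>b. b \<in> B \<Longrightarrow> c b = d b) \<Longrightarrow> (\<Oplus>b\<in>B. c b \<odot> b) = (\<Oplus>b\<in>B. d b \<odot> b)"
  by (intro M.finsum_cong') auto

text \<open>A finite spanning set of least cardinality is independent: a nontrivial relation would
  allow one vector to be dropped.\<close>

lemma ex_basis:
  assumes "finite_dimensional_tvs V"
  obtains B where "finite B" "B \<subseteq> carrier V" "\<And>x. x \<in> carrier V \<Longrightarrow> \<exists>c. x = (\<Oplus>b\<in>B. c b \<odot> b)"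
    "\<And>c b. (\<Oplus>b\<in>B. c b \<odot> b) = \<zero> \<Longrightarrow> b \<in> B \<Longrightarrow> c b = 0"
proof -
  define P where "P = (\<lambda>B. finite B \<and> B \<subseteq> carrier V \<and> (\<forall>x\<in>carrier V. \<exists>c. x = (\<Oplus>b\<in>B. c b \<odot> b)))"
  have "\<exists>B. P B" using assms by (simp add: finite_dimensional_tvs_def P_def)
  then obtain B where B: "P B" and min: "\<And>B'. P B' \<Longrightarrow> card B \<le> card B'"
    using ex_has_least_nat [of P _ card] by blast
  have Bc: "finite B" "B \<subseteq> carrier V" using B by (auto simp: P_def)
  have "c b0 = 0" if c: "(\<Oplus>b\<in>B. c b \<odot> b) = \<zero>" and b0: "b0 \<in> B" for c b0
  proof (rule ccontr)
    assume nz: "c b0 \<noteq> 0"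
    have "\<exists>e. x = (\<Oplus>b\<in>B - {b0}. e b \<odot> b)" if x: "x \<in> carrier V" for x
    proof -
      obtain d where d: "x = (\<Oplus>b\<in>B. d b \<odot> b)" using B x by (auto simp: P_def)
      \<comment> \<open>The multiple of the relation is chosen so that the coefficient at
        \<open>b0\<close> vanishes.\<close>
      define e where "e = (\<lambda>b. d b + (- (d b0 / c b0)) * c b)"
      have "x = (\<Oplus>b\<in>B. e b \<odot> b)"
        unfolding e_def lincomb_linear [OF Bc] c using d x by simp
      also have "\<dots> = (\<Oplus>b\<in>insert b0 (B - {b0}). e b \<odot> b)"
        using b0 by (simp add: insert_absorb)
      also have "\<dots> = e b0 \<odot> b0 \<oplus> (\<Oplus>b\<in>B - {b0}. e b \<odot> b)"
        using Bc b0 by (intro M.finsum_insert) auto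
      also have "e b0 = 0" using nz by (simp add: e_def)
      finally have "x = 0 \<odot> b0 \<oplus> (\<Oplus>b\<in>B - {b0}. e b \<odot> b)" .
      moreover have "b0 \<in> carrier V" "(\<Oplus>b\<in>B - {b0}. e b \<odot> b) \<in> carrier V"
        using Bc b0 by (auto intro!: lincomb_mem)
      ultimately show ?thesis by auto
    qed
    then have "P (B - {b0})" using Bc by (auto simp: P_def)
    from min [OF this] show False
      using Bc(1) b0 by (metis card_Diff1_less not_le)
  qed
  then show thesis using that Bc B by (auto simp: P_def)
qed

lemma homeomorphic_translation:
  assumes x: "x \<in> carrier V"
  shows "homeomorphic_maps (vtop V) (vtop V) (\<lambda>z. x \<oplus> z) (\<lambda>z. (-1) \<odot> x \<oplus> z)"
proof -
  have "1 \<odot> x \<oplus> (-1) \<odot> x = \<zero>" using smult_add_left [OF x, of 1 "-1"] x by simp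
  then have *: "x \<oplus> (-1) \<odot> x = \<zero>" using x by simp
  have 1: "x \<oplus> ((-1) \<odot> x \<oplus> z) = z" if "z \<in> carrier V" for z
    using x that * by (simp flip: M.a_assoc)
  have "(-1) \<odot> x \<oplus> x = \<zero>" using * x M.a_comm by simp
  then have 2: "(-1) \<odot> x \<oplus> (x \<oplus> z) = z" if "z \<in> carrier V" for z
    using x that by (simp flip: M.a_assoc)
  show ?thesis
    unfolding homeomorphic_maps_def
    using x 1 2 by (auto simp: topspace_vtop intro!: continuous_map_add continuous_map_ident)
qed

text \<open>Translations are homeomorphisms and carry the compact neighbourhood of zero to every
  point.\<close>

lemma locally_compact_if_compact_nhd_zero:
  assumes "openin (vtop V) W" "compactin (vtop V) K" "\<zero> \<in> W" "W \<subseteq> K"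
  shows "locally_compact_space (vtop V)"
  unfolding locally_compact_space_def topspace_vtop
proof (intro ballI exI conjI)
  fix x assume x: "x \<in> carrier V"
  note h = homeomorphic_translation [OF x]
  have "homeomorphic_map (vtop V) (vtop V) (\<lambda>z. x \<oplus> z)"
    using h homeomorphic_map_maps by blast
  then show "openin (vtop V) ((\<lambda>z. x \<oplus> z) ` W)"
    using assms(1) homeomorphic_map_openness_eq by blast
  show "compactin (vtop V) ((\<lambda>z. x \<oplus> z) ` K)"
    using h by (intro image_compactin [OF assms(2)]) (simp add: homeomorphic_maps_def)
  show "x \<in> (\<lambda>z. x \<oplus> z) ` W" using x by (intro image_eqI [OF _ assms(3)]) simp
  show "(\<lambda>z. x \<oplus> z) ` W \<subseteq> (\<lambda>z. x \<oplus> z) ` K" using assms(4) by blast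
qed

text \<open>The compact box \<open>K\<close> of coordinates has a compact image under
  \<open>T\<close>; the point is that this image contains a neighbourhood \<open>W\<close> of zero.
  If \<open>z\<close> in \<open>W\<close> were outside the image, its coordinates could be shrunk by
  powers of \<open>c\<close> until they enter \<open>K\<close>, and on entering they lie in the
  shell \<open>S\<close>. But the image of \<open>S\<close> is compact and misses zero, so
  \<open>W\<close> can be chosen such that no multiple of its points by a scalar in \<open>C\<close>
  meets that image.\<close>

proposition finite_dimensional_imp_locally_compact:
  assumes lc: "locally_compact_space (euclidean :: 'k topology)"
    and fd: "finite_dimensional_tvs V"
  shows "locally_compact_space (vtop V)"
proof -
  obtain c :: 'k and C D where c: "c \<noteq> 0" and C: "compact C" and D: "open D" "0 \<in> D" "D \<subseteq> C"
    and pow: "\<And>m. c ^ Suc m \<in> C" and small: "\<And>A. open A \<Longrightarrow> 0 \<in> A \<Longrightarrow> \<exists>m. c ^ Suc m \<in> A"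
    using ex_small_scalar [OF lc] by blast
  obtain B where B: "finite B" "B \<subseteq> carrier V"
    and span: "\<And>x. x \<in> carrier V \<Longrightarrow> \<exists>c. x = (\<Oplus>b\<in>B. c b \<odot> b)"
    and indep: "\<And>c b. (\<Oplus>b\<in>B. c b \<odot> b) = \<zero> \<Longrightarrow> b \<in> B \<Longrightarrow> c b = 0"
    using ex_basis [OF fd] by blast
  let ?P = "product_topology (\<lambda>_. euclidean :: 'k topology) B"
  define T where "T = (\<lambda>x. \<Oplus>b\<in>B. x b \<odot> b)"
  have T: "continuous_map ?P (vtop V) T"
    unfolding T_def using B by (intro continuous_map_lincomb continuous_map_product_projection)
  define sc where "sc = (\<lambda>t x. restrict (\<lambda>b. t * x b :: 'k) B)"
  have T_sc: "T (sc t x) = t \<odot> T x" for t x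
  proof -
    have "T (sc t x) = (\<Oplus>b\<in>B. (0 + t * x b) \<odot> b)"
      unfolding T_def by (rule lincomb_cong [OF B(2)]) (simp add: sc_def)
    also have "\<dots> = (\<Oplus>b\<in>B. 0 \<odot> b) \<oplus> t \<odot> T x"
      unfolding T_def by (rule lincomb_linear [OF B])
    also have "(\<Oplus>b\<in>B. 0 \<odot> b) = (\<Oplus>b\<in>B. \<zero>)"
      using B by (intro M.finsum_cong') auto
    finally show ?thesis
      using lincomb_mem [OF B(2)] by (simp add: T_def)
  qed
  define K where "K = PiE B (\<lambda>_. C)"
  define Q where "Q = PiE B (\<lambda>_. D)"
  have K: "compactin ?P K" unfolding K_def by (simp add: compactin_PiE C)
  have Q: "openin ?P Q" unfolding Q_def using B(1) D(1) by (simp add: openin_PiE)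
  have QK: "Q \<subseteq> K" unfolding Q_def K_def using D(3) by (intro PiE_mono) auto
  have sc_cont: "continuous_map ?P ?P (sc t)" for t
  proof -
    have "continuous_map ?P euclidean (\<lambda>x. t * x b)" if "b \<in> B" for b
      by (intro continuous_map_scalar_mult continuous_map_product_projection [OF that]) simp
    then show ?thesis
      by (auto simp: continuous_map_componentwise sc_def PiE_def)
  qed
  \<comment> \<open>a compact shell that every orbit \<open>(c\<^sup>m x)\<^sub>m\<close> starting outside \<open>K\<close> has to meet\<close>
  define S where "S = {x \<in> K. sc (inverse c) x \<notin> Q}"
  have S: "compactin ?P S"
  proof -
    have "openin ?P {x \<in> topspace ?P. sc (inverse c) x \<in> Q}"
      by (rule openin_continuous_map_preimage [OF sc_cont Q])
    then have "closedin ?P (topspace ?P - {x \<in> topspace ?P. sc (inverse c) x \<in> Q})"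
      by (rule closedin_diff [OF closedin_topspace])
    from compact_Int_closedin [OF K this] show ?thesis
      using compactin_subset_topspace [OF K] by (auto simp: S_def Int_def elim!: back_subst [of "compactin _"])
  qed
  have TS: "compactin (vtop V) (T ` S)" by (rule image_compactin [OF S T])
  \<comment> \<open>By independence zero has only the zero coordinates, and these lie in
    \<open>Q\<close> after any rescaling, hence not in \<open>S\<close>.\<close>
  have "\<zero> \<notin> T ` S"
  proof
    assume "\<zero> \<in> T ` S"
    then obtain x where x: "x \<in> S" "T x = \<zero>" by auto
    then have "x b = 0" if "b \<in> B" for b
      using indep [of x b] that by (simp add: T_def)
    then have "sc (inverse c) x \<in> Q" using D(2) by (auto simp: sc_def Q_def)
    then show False using x by (simp add: S_def)
  qed
  have oTS: "openin (vtop V) (carrier V - T ` S)"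
    using compactin_imp_closedin [OF Hausdorff_vtop TS] by (metis openin_diff openin_topspace topspace_vtop)
  have "continuous_map (prod_topology euclidean (vtop V)) (vtop V) (\<lambda>p. fst p \<odot> snd p)"
    by (intro continuous_map_smult continuous_map_fst continuous_map_snd)
  \<comment> \<open>The tube lemma around \<open>C\<close> times zero gives one \<open>W\<close> for
    all scalars in the compact set \<open>C\<close>, in particular for all positive powers of
    \<open>c\<close>.\<close>
  let ?O = "{p \<in> topspace (prod_topology euclidean (vtop V)). fst p \<odot> snd p \<in> carrier V - T ` S}"
  have 1: "openin (prod_topology euclidean (vtop V)) ?O"
    by (rule openin_continuous_map_preimage [OF \<open>continuous_map _ _ (\<lambda>p. fst p \<odot> snd p)\<close> oTS])
  have 2: "C \<times> {\<zero>} \<subseteq> ?O"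
    using \<open>\<zero> \<notin> T ` S\<close> by (auto simp: topspace_vtop)
  have "compactin euclidean C" "\<zero> \<in> topspace (vtop V)"
    using C by (simp_all add: topspace_vtop)
  from tube_lemma_left [OF 1 this 2] obtain N W where N: "C \<subseteq> N" "N \<times> W \<subseteq> ?O" and W: "openin (vtop V) W" "\<zero> \<in> W"
    by blast
  have CW: "t \<odot> z \<notin> T ` S" if "t \<in> C" "z \<in> W" for t z
  proof -
    have "(t, z) \<in> ?O" using that N by blast
    then show ?thesis by simp
  qed
  have "W \<subseteq> T ` K"
  proof
    fix z assume z: "z \<in> W"
    then have "z \<in> carrier V" using open_subset_carrier [OF W(1)] by blast
    then obtain x' where x': "z = T x'" using span unfolding T_def by blast
    define x where "x = restrict x' B"
    have Tx: "T x = z"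
      unfolding x' T_def x_def by (rule lincomb_cong [OF B(2)]) simp
    have xe: "x \<in> PiE B (\<lambda>_. UNIV)" by (simp add: x_def)
    show "z \<in> T ` K"
    proof (rule ccontr)
      assume "z \<notin> T ` K"
      then have xK: "x \<notin> K" using Tx by blast
      have "\<exists>m. sc (c ^ Suc m) x \<in> K"
      proof -
        \<comment> \<open>Finitely many coordinates give finitely many open conditions on the
          scalar, all satisfied at \<open>0\<close>; some power of \<open>c\<close> satisfies them
          all.\<close>
        let ?A = "\<Inter>b\<in>B. {t. t * x b \<in> D}"
        have "open {t. t * x b \<in> D}" for b
        proof -
          have "continuous_map euclidean euclidean (\<lambda>t. t * x b)"
            by (rule continuous_map_scalar_mult [OF continuous_map_ident]) simp
          moreover have "openin euclidean D" using D(1) by simp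
          ultimately have "openin euclidean {t \<in> topspace euclidean. t * x b \<in> D}"
            by (rule openin_continuous_map_preimage)
          then show ?thesis by simp
        qed
        then have "open ?A" using B(1) by (intro open_INT) auto
        moreover have "0 \<in> ?A" using D(2) by simp
        ultimately obtain m where "c ^ Suc m \<in> ?A" using small by blast
        then have "sc (c ^ Suc m) x \<in> Q" unfolding Q_def sc_def by (intro restrict_PiE_iff [THEN iffD2]) blast
        then show ?thesis using QK by blast
      qed
      then obtain m where m: "sc (c ^ Suc m) x \<in> K" "\<And>i. i < m \<Longrightarrow> sc (c ^ Suc i) x \<notin> K"
        using exists_least_iff [of "\<lambda>m. sc (c ^ Suc m) x \<in> K"] by blast
      \<comment> \<open>Undoing one factor \<open>c\<close> leads to the exponent before the least
        one. For \<open>m = 0\<close> this is \<open>x\<close> itself, which is outside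
        \<open>K\<close> by assumption, so the shell is met in this case as well.\<close>
      have "sc (inverse c) (sc (c ^ Suc m) x) = sc (c ^ m) x"
        using c by (auto simp: sc_def)
      moreover have "sc (c ^ m) x \<notin> K"
      proof (cases m)
        case 0
        have "sc 1 x = x" using xe by (auto simp: sc_def PiE_def extensional_restrict)
        then show ?thesis using 0 xK by simp
      next
        case (Suc i)
        then show ?thesis using m(2) [of i] by simp
      qed
      ultimately have "sc (c ^ Suc m) x \<in> S" using m(1) QK by (auto simp: S_def)
      moreover have "T (sc (c ^ Suc m) x) = c ^ Suc m \<odot> z" using T_sc Tx by simp
      ultimately show False using CW [OF pow [of m] z] by (metis imageI)
    qed
  qed
  then show ?thesis
    using locally_compact_if_compact_nhd_zero [OF W(1) image_compactin [OF K T] W(2)] by blast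
qed

end

lemma locally_compact_map_tvs:
  assumes "inj h" "topological_vector_space V" "locally_compact_space (vtop V)"
  shows "locally_compact_space (vtop (map_tvs h V))"
proof -
  have "tvs_iso h V (map_tvs h V)" using assms by (simp add: tvs_iso_map)
  then have "vtop V homeomorphic_space vtop (map_tvs h V)"
    by (auto simp: tvs_iso_def homeomorphic_space_def)
  then show ?thesis using assms(3) homeomorphic_locally_compact_space by blast
qed

text \<open>Each level adds a scalar factor, so local compactness of the field is used here besides
  that of \<open>V\<close>.\<close>

lemma locally_compact_iter_tvs:
  assumes "locally_compact_space (euclidean :: 'k::topological_field topology)"
    and V: "topological_vector_space (V :: ('k, 'v) tvs)" and "locally_compact_space (vtop V)"
  shows "locally_compact_space (vtop (iter_tvs V j))"
proof (induction j)
  case 0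
  then show ?case using assms by (simp add: locally_compact_map_tvs inj_Base)
next
  case (Suc j)
  then have "locally_compact_space (vtop (prod_tvs (iter_tvs V j) (prod_tvs (iter_tvs V j) scalar_tvs)))"
    using assms(1) by (simp add: locally_compact_space_prod_topology)
  moreover have "topological_vector_space (prod_tvs (iter_tvs V j) (prod_tvs (iter_tvs V j) scalar_tvs))"
    by (intro tvs_prod tvs_iter tvs_scalar V)
  ultimately show ?case
    unfolding iter_tvs.simps by (intro locally_compact_map_tvs inj_triple)
qed


section \<open>Compact-open topologies\<close>


lemma topspace_initial_topology [simp]: "topspace (initial_topology S I g T) = S"
  by (auto simp: initial_topology_def)

lemma continuous_map_into_initial_topology:
  assumes "\<And>a. a \<in> topspace A \<Longrightarrow> f a \<in> S"
    and "\<And>i. i \<in> I \<Longrightarrow> continuous_map A (T i) (\<lambda>a. g i (f a))"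
  shows "continuous_map A (initial_topology S I g T) f"
  unfolding initial_topology_def
proof (rule continuous_on_generated_topo)
  fix U assume "U \<in> insert S {{s \<in> S. g i s \<in> W} | i W. i \<in> I \<and> openin (T i) W}"
  then consider "U = S" | i W where "i \<in> I" "openin (T i) W" "U = {s \<in> S. g i s \<in> W}" by blast
  then show "openin A (f -` U \<inter> topspace A)"
  proof cases
    case 1
    then have "f -` U \<inter> topspace A = topspace A" using assms(1) by auto
    then show ?thesis by simp
  next
    case 2
    then have "f -` U \<inter> topspace A = {a \<in> topspace A. g i (f a) \<in> W}" using assms(1) by auto
    then show ?thesis using openin_continuous_map_preimage [OF assms(2) [OF 2(1)] 2(2)] by simp
  qed
qed (use assms(1) in auto)

lemma continuous_map_initial_component:
  assumes "i \<in> I" "\<And>s. s \<in> S \<Longrightarrow> g i s \<in> topspace (T i)"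
  shows "continuous_map (initial_topology S I g T) (T i) (g i)"
  unfolding continuous_map_def topspace_initial_topology
proof (intro conjI allI impI)
  fix W assume "openin (T i) W"
  then show "openin (initial_topology S I g T) {s \<in> S. g i s \<in> W}"
    unfolding initial_topology_def using assms(1) by (intro topology_generated_by_Basis) blast
qed (use assms(2) in auto)

text \<open>The subbasic set with \<open>K\<close> empty and \<open>W\<close> the whole space
  already contains every continuous extensional function.\<close>

lemma topspace_compact_open:
  "topspace (compact_open_topology A B) = {f \<in> extensional (topspace A). continuous_map A B f}"
proof -
  have "compactin A {}" "openin B (topspace B)" by auto
  then have "{f \<in> extensional (topspace A). continuous_map A B f} \<in>
     {{f \<in> extensional (topspace A). continuous_map A B f \<and> f ` K \<subseteq> W} | K W. compactin A K \<and> openin B W}"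
    by blast
  then show ?thesis
    unfolding compact_open_topology_def topology_generated_by_topspace by blast
qed

text \<open>Currying: if \<open>f s\<close> maps \<open>K\<close> into \<open>W\<close>, the tube
  lemma around \<open>{s}\<close> times \<open>K\<close> yields a neighbourhood of \<open>s\<close>
  with the same property.\<close>

lemma continuous_map_into_compact_open:
  assumes h: "continuous_map (prod_topology S A) B (\<lambda>z. f (fst z) (snd z))"
    and ext: "\<And>s. s \<in> topspace S \<Longrightarrow> f s \<in> extensional (topspace A)"
  shows "continuous_map S (compact_open_topology A B) f"
  unfolding compact_open_topology_def
proof (rule continuous_on_generated_topo)
  have cont: "continuous_map A B (f s)" if "s \<in> topspace S" for s
  proof -
    have "continuous_map A (prod_topology S A) (\<lambda>x. (s, x))"
      using that by (simp add: continuous_map_paired continuous_map_ident)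
    from continuous_map_compose [OF this h] show ?thesis by (simp add: o_def)
  qed
  show "f ` topspace S \<subseteq> \<Union> {{f \<in> extensional (topspace A). continuous_map A B f \<and> f ` K \<subseteq> W} | K W. compactin A K \<and> openin B W}"
    using topspace_compact_open [of A B] cont ext
    unfolding compact_open_topology_def topology_generated_by_topspace by blast
  fix U assume "U \<in> {{f \<in> extensional (topspace A). continuous_map A B f \<and> f ` K \<subseteq> W} | K W. compactin A K \<and> openin B W}"
  then obtain K W where K: "compactin A K" and W: "openin B W"
    and U: "U = {f \<in> extensional (topspace A). continuous_map A B f \<and> f ` K \<subseteq> W}" by blast
  let ?O = "{z \<in> topspace (prod_topology S A). f (fst z) (snd z) \<in> W}"
  have O: "openin (prod_topology S A) ?O"
    by (rule openin_continuous_map_preimage [OF h W])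
  show "openin S (f -` U \<inter> topspace S)"
  proof (subst openin_subopen, intro ballI)
    fix s assume s: "s \<in> f -` U \<inter> topspace S"
    then have "{s} \<times> K \<subseteq> ?O"
      using compactin_subset_topspace [OF K] by (auto simp: U)
    then obtain N N' where N: "openin S N" "s \<in> N" "K \<subseteq> N'" "N \<times> N' \<subseteq> ?O"
      using tube_lemma_right [OF O K, of s] s by auto
    then have "N \<subseteq> f -` U \<inter> topspace S"
      using cont ext openin_subset [OF N(1)] by (auto simp: U subset_iff)
    then show "\<exists>T. openin S T \<and> s \<in> T \<and> T \<subseteq> f -` U \<inter> topspace S"
      using N by blast
  qed
qed

text \<open>Local compactness fits a compact \<open>K\<close> between an open \<open>N\<close>
  containing \<open>x\<close> and the preimage of \<open>W\<close> under \<open>f\<close>. Functions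
  mapping \<open>K\<close> into \<open>W\<close> then send all of \<open>N\<close> into
  \<open>W\<close>.\<close>

lemma continuous_map_compact_open_eval:
  assumes A: "locally_compact_space A" "Hausdorff_space A"
  shows "continuous_map (prod_topology (compact_open_topology A B) A) B (\<lambda>z. fst z (snd z))"
  unfolding continuous_map_def
proof (intro conjI allI impI)
  show "(\<lambda>z. fst z (snd z)) \<in> topspace (prod_topology (compact_open_topology A B) A) \<rightarrow> topspace B"
    by (auto simp: topspace_compact_open continuous_map_def Pi_iff)
  fix W assume W: "openin B W"
  let ?T = "prod_topology (compact_open_topology A B) A"
  show "openin ?T {z \<in> topspace ?T. fst z (snd z) \<in> W}"
    unfolding openin_prod_topology_alt
  proof (intro allI impI)
    fix f x assume fx: "(f, x) \<in> {z \<in> topspace ?T. fst z (snd z) \<in> W}"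
    then have f: "f \<in> extensional (topspace A)" "continuous_map A B f" and x: "x \<in> topspace A" "f x \<in> W"
      by (auto simp: topspace_compact_open)
    have "neighbourhood_base_of (compactin A) A"
      using A locally_compact_space_neighbourhood_base by blast
    note nb = this [unfolded neighbourhood_base_of, rule_format, of "{x \<in> topspace A. f x \<in> W}" x]
    have "openin A {x \<in> topspace A. f x \<in> W}"
      by (rule openin_continuous_map_preimage [OF f(2) W])
    with nb obtain N K where N: "openin A N" "compactin A K" "x \<in> N" "N \<subseteq> K" "K \<subseteq> {x \<in> topspace A. f x \<in> W}"
      using x by auto
    let ?G = "{g \<in> extensional (topspace A). continuous_map A B g \<and> g ` K \<subseteq> W}"
    have "openin (compact_open_topology A B) ?G"
      unfolding compact_open_topology_def using N(2) W by (intro topology_generated_by_Basis) blast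
    moreover have "f \<in> ?G" using f N(5) by auto
    moreover have "?G \<times> N \<subseteq> {z \<in> topspace ?T. fst z (snd z) \<in> W}"
    proof (intro subsetI)
      fix z assume "z \<in> ?G \<times> N"
      then obtain g y where z: "z = (g, y)" "g \<in> ?G" "y \<in> N" by blast
      then have "g y \<in> W" using N(4) by blast
      then show "z \<in> {z \<in> topspace ?T. fst z (snd z) \<in> W}"
        using z openin_subset [OF N(1)] by (auto simp: topspace_compact_open)
    qed
    ultimately show "\<exists>U V. openin (compact_open_topology A B) U \<and> openin A V \<and> f \<in> U \<and> x \<in> V \<and>
        U \<times> V \<subseteq> {z \<in> topspace ?T. fst z (snd z) \<in> W}"
      using N(1,3) by (intro exI [of _ ?G] exI [of _ N] conjI)
  qed
qed

section \<open>Maps of order \<open>k\<close> and the topology on spaces of such maps\<close>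

lemma Ck_map_iff: "Ck_map k V U F f \<longleftrightarrow> (\<forall>n. enat n \<le> k \<longrightarrow> Cn_map n V U F f)"
  by (cases k) (auto simp: Ck_map_def intro: Cn_map_mono)

lemma Ck_map_cong: "(\<And>x. x \<in> U \<Longrightarrow> f x = g x) \<Longrightarrow> Ck_map k V U F f \<longleftrightarrow> Ck_map k V U F g"
  unfolding Ck_map_iff using Cn_map_cong [of U f g] by blast

lemma Ck_map_cont: "Ck_map k V U F f \<Longrightarrow> cont_on V U F f"
proof -
  assume "Ck_map k V U F f"
  moreover have "enat 0 \<le> k" by (simp add: enat_0)
  ultimately have "Cn_map 0 V U F f" unfolding Ck_map_iff by blast
  then show ?thesis by (rule Cn_map_cont)
qed

lemma Ck_map_subset:
  assumes "topological_vector_space V" "topological_vector_space F"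
    and "openin (vtop V) U" "openin (vtop V) U'" "U' \<subseteq> U" "Ck_map k V U F f"
  shows "Ck_map k V U' F f"
  using assms Cn_map_subset unfolding Ck_map_iff by blast

lemma Ck_map_compose:
  assumes "topological_vector_space V" "topological_vector_space W" "topological_vector_space F"
    and "openin (vtop V) U" "openin (vtop W) U'"
    and "Ck_map k V U W f" "Ck_map k W U' F g" "\<And>x. x \<in> U \<Longrightarrow> f x \<in> U'"
  shows "Ck_map k V U F (\<lambda>x. g (f x))"
  unfolding Ck_map_iff
proof (intro allI impI)
  fix n assume "enat n \<le> k"
  then have "Cn_map n V U W f" "Cn_map n W U' F g" using assms(6,7) by (simp_all add: Ck_map_iff)
  then show "Cn_map n V U F (\<lambda>x. g (f x))" by (rule Cn_map_compose [OF assms(1-5) _ _ assms(8)])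
qed

lemma Ck_map_local:
  assumes "topological_vector_space V" "topological_vector_space F" "openin (vtop V) U"
    and "\<And>x. x \<in> U \<Longrightarrow> \<exists>U'. openin (vtop V) U' \<and> x \<in> U' \<and> U' \<subseteq> U \<and> Ck_map k V U' F f"
  shows "Ck_map k V U F f"
  unfolding Ck_map_iff
proof (intro allI impI)
  fix n assume n: "enat n \<le> k"
  show "Cn_map n V U F f"
  proof (rule Cn_map_local [OF assms(1-3)])
    fix x assume "x \<in> U"
    then obtain U' where "openin (vtop V) U'" "x \<in> U'" "U' \<subseteq> U" "Ck_map k V U' F f"
      using assms(4) by blast
    with n show "\<exists>U'. openin (vtop V) U' \<and> x \<in> U' \<and> U' \<subseteq> U \<and> Cn_map n V U' F f"
      unfolding Ck_map_iff by (intro exI [of _ U']) simp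
  qed
qed

definition Ck_space ::
    "enat \<Rightarrow> ('k::topological_field, 'v) tvs \<Rightarrow> 'v set \<Rightarrow> ('k, 'f) tvs \<Rightarrow> ('v \<Rightarrow> 'f) set" where
  "Ck_space k V U F = {f \<in> extensional U. Ck_map k V U F f}"

text \<open>Gives access to the results of \<open>embedded\<close> when the embedding itself is of
  no interest.\<close>

lemma ex_embedded:
  assumes V: "topological_vector_space (V :: ('k::topological_field, 'v) tvs)" and F: "topological_vector_space F"
    and U: "openin (vtop V) U"
  obtains B W where "embedded V U F (Atom :: 'v \<Rightarrow> ('k, 'v) univ) B W"
proof (rule that)
  have i: "inj (Atom :: 'v \<Rightarrow> ('k, 'v) univ)" by (simp add: inj_def)
  show "embedded V U F (Atom :: 'v \<Rightarrow> ('k, 'v) univ) (\<lambda>j. (ubr ^^ j) (map_tvs Atom V))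
      (rec_nat (Atom ` U) (\<lambda>j. udom ((ubr ^^ j) (map_tvs Atom V))))"
    by (rule embeddedI [OF V F U tvs_map [OF V i] tvs_iso_map [OF V i]])
qed

lemma topspace_iter_dom:
  assumes V: "topological_vector_space V" and F: "topological_vector_space F" and U: "openin (vtop V) U"
  shows "topspace (iter_space V U j) = iter_dom V U j"
  using iter_dom_subset [OF topological_vector_space.open_subset_carrier [OF V U]]
    topological_vector_space.topspace_vtop [OF tvs_iter [OF V]] by auto

lemma iter_bracket_extensional: "iter_bracket V U F f j \<in> extensional (iter_dom V U j)"
  by (cases j) (auto simp: iter_bracket.simps simp del: iter_dom.simps)

context
  fixes V :: "('k::topological_field, 'v) tvs" and U :: "'v set" and F :: "('k, 'f) tvs" and k :: enat
  assumes V: "topological_vector_space V" and F: "topological_vector_space F" and U: "openin (vtop V) U"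
begin

lemma Ck_iter_bracket_mem:
  assumes "enat j \<le> k" "f \<in> Ck_space k V U F"
  shows "iter_bracket V U F f j \<in> topspace (compact_open_topology (iter_space V U j) (vtop F))"
proof -
  obtain B W where E: "embedded V U F (Atom :: 'v \<Rightarrow> ('k, 'v) univ) B W"
    by (rule ex_embedded [OF V F U])
  have "Cn_map j V U F f" using assms by (simp add: Ck_space_def Ck_map_iff)
  from embedded.iter_bracket_cont [OF E this order_refl] iter_bracket_extensional
  show ?thesis
    unfolding topspace_compact_open topspace_iter_dom [OF V F U] by blast
qed

lemma Ck_topology_alt:
  "Ck_topology k V U F = initial_topology (Ck_space k V U F) {j. enat j \<le> k} (\<lambda>j f. iter_bracket V U F f j)
     (\<lambda>j. compact_open_topology (iter_space V U j) (vtop F))"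
  by (simp add: Ck_topology_def Ck_space_def)

lemma topspace_Ck_topology [simp]: "topspace (Ck_topology k V U F) = Ck_space k V U F"
  by (simp add: Ck_topology_alt)

text \<open>The bracket is continuous into a compact-open topology by definition of the topology on
  the function space; evaluation is continuous there because \<open>iter_dom\<close> is open in a
  locally compact space.\<close>

lemma Ck_topology_eval:
  assumes lc: "locally_compact_space (euclidean :: 'k topology)" "locally_compact_space (vtop V)"
    and j: "enat j \<le> k"
  shows "continuous_map (prod_topology (Ck_topology k V U F) (iter_space V U j)) (vtop F) (\<lambda>z. iter_bracket V U F (fst z) j (snd z))"
proof -
  obtain B W where E: "embedded V U F (Atom :: 'v \<Rightarrow> ('k, 'v) univ) B W"
    by (rule ex_embedded [OF V F U])
  have H: "Hausdorff_space (vtop (iter_tvs V j))"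
    using topological_vector_space.Hausdorff_vtop [OF tvs_iter [OF V]] .
  have "locally_compact_space (iter_space V U j)"
    by (rule locally_compact_space_open_subset) (use H embedded.openin_iter_dom [OF E] locally_compact_iter_tvs [OF lc(1) V lc(2)] in auto)
  moreover have "Hausdorff_space (iter_space V U j)" using H by (rule Hausdorff_space_subtopology)
  ultimately have ev: "continuous_map (prod_topology (compact_open_topology (iter_space V U j) (vtop F)) (iter_space V U j)) (vtop F) (\<lambda>z. fst z (snd z))"
    by (rule continuous_map_compact_open_eval)
  have "continuous_map (Ck_topology k V U F) (compact_open_topology (iter_space V U j) (vtop F)) (\<lambda>f. iter_bracket V U F f j)"
    unfolding Ck_topology_alt
    using continuous_map_initial_component [where i = j and g = "\<lambda>j f. iter_bracket V U F f j"
        and I = "{j. enat j \<le> k}" and S = "Ck_space k V U F" and T = "\<lambda>j. compact_open_topology (iter_space V U j) (vtop F)"]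
      j Ck_iter_bracket_mem by blast
  from continuous_map_compose [OF continuous_map_fst this]
  have "continuous_map (prod_topology (Ck_topology k V U F) (iter_space V U j)) (prod_topology (compact_open_topology (iter_space V U j) (vtop F)) (iter_space V U j))
     (\<lambda>z. (iter_bracket V U F (fst z) j, snd z))"
    by (intro continuous_map_pairedI continuous_map_snd) (simp add: o_def)
  from continuous_map_compose [OF this ev] show ?thesis by (simp add: o_def)
qed

text \<open>Counterpart of the previous lemma: joint continuity of the brackets is enough for
  continuity into the function space. It serves to make the vector operations continuous.\<close>

lemma continuous_map_into_Ck_topology:
  assumes "\<And>s. s \<in> topspace S \<Longrightarrow> f s \<in> Ck_space k V U F"
    and "\<And>j. enat j \<le> k \<Longrightarrow> continuous_map (prod_topology S (iter_space V U j)) (vtop F)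
        (\<lambda>z. iter_bracket V U F (f (fst z)) j (snd z))"
  shows "continuous_map S (Ck_topology k V U F) f"
  unfolding Ck_topology_alt
proof (rule continuous_map_into_initial_topology)
  fix j assume "j \<in> {j. enat j \<le> k}"
  then have "continuous_map (prod_topology S (iter_space V U j)) (vtop F) (\<lambda>z. iter_bracket V U F (f (fst z)) j (snd z))"
    using assms(2) by simp
  then show "continuous_map S (compact_open_topology (iter_space V U j) (vtop F)) (\<lambda>s. iter_bracket V U F (f s) j)"
    by (rule continuous_map_into_compact_open)
      (simp add: topspace_iter_dom [OF V F U] iter_bracket_extensional del: topspace_subtopology)
qed (rule assms(1))

end


section \<open>Evaluation on manifolds\<close>


lemma
  assumes "is_chart S Z (U, \<kappa>)"
  shows chart_open: "openin S U" and chart_image_open: "openin (vtop Z) (\<kappa> ` U)"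
    and chart_inj: "inj_on \<kappa> U"
    and chart_cont: "continuous_map (subtopology S U) (subtopology (vtop Z) (\<kappa> ` U)) \<kappa>"
    and chart_subset_open: "\<And>A. openin S A \<Longrightarrow> A \<subseteq> U \<Longrightarrow> openin (vtop Z) (\<kappa> ` A)"
proof -
  have U: "openin S U" and V: "openin (vtop Z) (\<kappa> ` U)"
    and h: "homeomorphic_map (subtopology S U) (subtopology (vtop Z) (\<kappa> ` U)) \<kappa>"
    using assms by (auto simp: is_chart_def)
  show "openin S U" "openin (vtop Z) (\<kappa> ` U)" by (fact U, fact V)
  have "topspace (subtopology S U) = U" using openin_subset [OF U] by auto
  then show "inj_on \<kappa> U" using h homeomorphic_imp_injective_map by metis
  show "continuous_map (subtopology S U) (subtopology (vtop Z) (\<kappa> ` U)) \<kappa>"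
    using h homeomorphic_imp_continuous_map by blast
  fix A assume A: "openin S A" "A \<subseteq> U"
  then have "openin (subtopology S U) A"
    by (metis inf.absorb_iff2 openin_subtopology_Int2)
  then have "openin (subtopology (vtop Z) (\<kappa> ` U)) (\<kappa> ` A)"
    using homeomorphic_imp_open_map [OF h] by (simp add: open_map_def)
  then show "openin (vtop Z) (\<kappa> ` A)"
    using openin_trans_full V by blast
qed

lemma model_tvs_manifold [simp]: "model (tvs_manifold E) = E"
  and mtop_tvs_manifold [simp]: "mtop (tvs_manifold E) = vtop E"
  and atlas_tvs_manifold [simp]: "atlas (tvs_manifold E) = {(carrier E, id)}"
  by (simp_all add: tvs_manifold_def)

lemma Ck_map_ident:
  "topological_vector_space V \<Longrightarrow> openin (vtop V) U \<Longrightarrow> Ck_map k V U V (\<lambda>x. x)"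
  by (simp add: Ck_map_iff Cn_map_ident)

lemma id_chart_tvs_manifold:
  assumes E: "topological_vector_space E"
  shows "(carrier E, id) \<in> charts k (tvs_manifold E)"
proof -
  interpret E: topological_vector_space E by fact
  have "openin (vtop E) (carrier E)" using openin_topspace [of "vtop E"] by (simp add: E.topspace_vtop)
  then have "Ck_map k E (carrier E) E (\<lambda>x. x)" by (rule Ck_map_ident [OF E])
  moreover have "inv_into (carrier E) id x = x" if "x \<in> carrier E" for x
    using inv_into_f_f [of id "carrier E" x] that by simp
  ultimately have "Ck_map k E (carrier E) E (id \<circ> inv_into (carrier E) id)"
    by (subst Ck_map_cong [where g = "\<lambda>x. x"]) auto
  then show ?thesis
    using \<open>openin (vtop E) (carrier E)\<close> by (simp add: charts_def is_chart_def compatible_charts_def)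
qed

text \<open>Compatibility with the only chart of the atlas, the identity, amounts to
  \<open>\<mu>\<close> being of class \<open>C^k\<close> on its domain.\<close>

lemma
  assumes E: "topological_vector_space E" and c: "(W, \<mu>) \<in> charts k (tvs_manifold E)"
  shows tvs_chart_open: "openin (vtop E) W" and tvs_chart_Ck: "Ck_map k E W E \<mu>"
proof -
  interpret E: topological_vector_space E by fact
  show W: "openin (vtop E) W" using c by (auto simp: charts_def is_chart_def)
  have WE: "W \<subseteq> carrier E" by (rule E.open_subset_carrier [OF W])
  have "Ck_map k E (id ` (W \<inter> carrier E)) E (\<mu> \<circ> inv_into (carrier E) id)"
    using c by (simp add: charts_def compatible_charts_def)
  moreover have "id ` (W \<inter> carrier E) = W" using WE by auto
  moreover have "inv_into (carrier E) id x = x" if "x \<in> W" for x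
    using inv_into_f_f [of id "carrier E" x] that WE by auto
  ultimately show "Ck_map k E W E \<mu>"
    using Ck_map_cong [of W \<mu> "\<mu> \<circ> inv_into (carrier E) id" k E E] by simp
qed

text \<open>Near a point \<open>f\<close> in the chart \<open>\<kappa>\<close> is \<open>f\<close>
  in an atlas chart \<open>\<kappa>'\<close> after the change of charts, and a chart of
  \<open>E\<close> is composed on the left. The chain rule handles this factorisation, and locality
  assembles the pieces.\<close>

lemma Ck_manifold_map_tvsI:
  assumes Z: "topological_vector_space (model N)" and E: "topological_vector_space E"
    and atl: "\<And>c. c \<in> atlas N \<Longrightarrow> is_chart (mtop N) (model N) c"
    and cov: "\<And>x. x \<in> topspace (mtop N) \<Longrightarrow> \<exists>U \<kappa>. (U, \<kappa>) \<in> atlas N \<and> x \<in> U"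
    and Ck: "\<And>U \<kappa>. (U, \<kappa>) \<in> atlas N \<Longrightarrow> Ck_map k (model N) (\<kappa> ` U) E (\<lambda>z. f (inv_into U \<kappa> z))"
  shows "Ck_manifold_map k N (tvs_manifold E) f"
proof -
  let ?Z = "model N"
  have cont: "continuous_map (mtop N) (vtop E) f"
  proof (rule continuous_map_local)
    fix x assume "x \<in> topspace (mtop N)"
    then obtain U \<kappa> where c: "(U, \<kappa>) \<in> atlas N" "x \<in> U" using cov by blast
    note ch = atl [OF c(1)]
    have "continuous_map (subtopology (mtop N) U) (vtop E) f"
      by (rule continuous_map_eq [OF continuous_map_compose [OF chart_cont [OF ch] Ck_map_cont [OF Ck [OF c(1)]]]])
        (simp add: inv_into_f_f [OF chart_inj [OF ch]])
    then show "\<exists>A. openin (mtop N) A \<and> x \<in> A \<and> continuous_map (subtopology (mtop N) A) (vtop E) f"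
      using chart_open [OF ch] c(2) by blast
  qed
  have "Ck_map k ?Z (\<kappa> ` (U \<inter> f -` W)) E (\<lambda>y. \<mu> (f (inv_into U \<kappa> y)))"
    if c: "(U, \<kappa>) \<in> charts k N" and w: "(W, \<mu>) \<in> charts k (tvs_manifold E)" for U \<kappa> W \<mu>
  proof (rule Ck_map_local [OF Z E])
    have ch: "is_chart (mtop N) ?Z (U, \<kappa>)"
      and comp: "\<And>c'. c' \<in> atlas N \<Longrightarrow> compatible_charts k ?Z (U, \<kappa>) c'"
      using c by (auto simp: charts_def)
    note W = tvs_chart_open [OF E w] and \<mu> = tvs_chart_Ck [OF E w]
    let ?f = "{x \<in> topspace (mtop N). f x \<in> W}"
    have of: "openin (mtop N) ?f" by (rule openin_continuous_map_preimage [OF cont W])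
    \<comment> \<open>The plain preimage may contain points outside the manifold; intersecting with
      \<open>U\<close> removes them, and openness becomes available.\<close>
    have eq: "U \<inter> f -` W = U \<inter> ?f" using openin_subset [OF chart_open [OF ch]] by auto
    have oU: "openin (mtop N) (U \<inter> f -` W)"
      unfolding eq by (intro openin_Int chart_open [OF ch] of)
    show "openin (vtop ?Z) (\<kappa> ` (U \<inter> f -` W))"
      by (rule chart_subset_open [OF ch oU]) simp
    fix y assume "y \<in> \<kappa> ` (U \<inter> f -` W)"
    then obtain x where x: "x \<in> U" "f x \<in> W" "y = \<kappa> x" by blast
    then have "x \<in> topspace (mtop N)" using openin_subset [OF chart_open [OF ch]] by auto
    then obtain U' \<kappa>' where c': "(U', \<kappa>') \<in> atlas N" "x \<in> U'" using cov by blast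
    note ch' = atl [OF c'(1)]
    note inv = inv_into_f_f [OF chart_inj [OF ch]] and inv' = inv_into_f_f [OF chart_inj [OF ch']]
    \<comment> \<open>The part of the chart image on which both charts are defined and
      \<open>f\<close> lands in \<open>W\<close>, so that all three factors can be composed.\<close>
    let ?A = "\<kappa> ` (U \<inter> U' \<inter> f -` W)"
    have oUU: "openin (mtop N) (U \<inter> U')" by (intro openin_Int chart_open [OF ch] chart_open [OF ch'])
    have oA: "openin (mtop N) (U \<inter> U' \<inter> f -` W)"
      using openin_Int [OF oU chart_open [OF ch']] by (simp add: Int_ac)
    have A: "openin (vtop ?Z) ?A" by (rule chart_subset_open [OF ch oA]) auto
    have "Ck_map k ?Z (\<kappa> ` (U \<inter> U')) ?Z (\<lambda>y. \<kappa>' (inv_into U \<kappa> y))"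
      using comp [OF c'(1)] by (simp add: compatible_charts_def o_def)
    then have t: "Ck_map k ?Z ?A ?Z (\<lambda>y. \<kappa>' (inv_into U \<kappa> y))"
      by (rule Ck_map_subset [OF Z Z chart_subset_open [OF ch oUU] A, rotated 2]) auto
    have 1: "Ck_map k ?Z ?A E (\<lambda>y. f (inv_into U' \<kappa>' (\<kappa>' (inv_into U \<kappa> y))))"
      by (rule Ck_map_compose [OF Z Z E A chart_image_open [OF ch'] t Ck [OF c'(1)]]) (auto simp: inv)
    have "Ck_map k ?Z ?A E (\<lambda>y. \<mu> (f (inv_into U' \<kappa>' (\<kappa>' (inv_into U \<kappa> y)))))"
      by (rule Ck_map_compose [OF Z E E A W 1 \<mu>]) (auto simp: inv inv')
    then have "Ck_map k ?Z ?A E (\<lambda>y. \<mu> (f (inv_into U \<kappa> y)))"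
      by (rule Ck_map_cong [THEN iffD1, rotated]) (auto simp: inv inv')
    moreover have "y \<in> ?A" "?A \<subseteq> \<kappa> ` (U \<inter> f -` W)" using x c' by auto
    ultimately show "\<exists>V. openin (vtop ?Z) V \<and> y \<in> V \<and> V \<subseteq> \<kappa> ` (U \<inter> f -` W) \<and> Ck_map k ?Z V E (\<lambda>y. \<mu> (f (inv_into U \<kappa> y)))"
      using A by blast
  qed
  then show ?thesis
    using cont by (auto simp: Ck_manifold_map_def o_def)
qed

text \<open>The identity belongs to the maximal atlas of \<open>E\<close>, so one instance of the
  definition suffices.\<close>

lemma Ck_manifold_map_tvsD:
  assumes E: "topological_vector_space E" and f: "Ck_manifold_map k N (tvs_manifold E) f"
    and c: "(U, \<kappa>) \<in> charts k N"
  shows "Ck_map k (model N) (\<kappa> ` U) E (\<lambda>z. f (inv_into U \<kappa> z))"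
proof -
  have ch: "is_chart (mtop N) (model N) (U, \<kappa>)" using c by (auto simp: charts_def)
  have "continuous_map (mtop N) (vtop E) f" using f by (simp add: Ck_manifold_map_def)
  then have "f x \<in> carrier E" if "x \<in> U" for x
    using that openin_subset [OF chart_open [OF ch]] topological_vector_space.topspace_vtop [OF E]
    by (auto simp: continuous_map_def)
  then have "U \<inter> f -` carrier E = U" by auto
  moreover have "Ck_map k (model N) (\<kappa> ` (U \<inter> f -` carrier E)) E (id \<circ> f \<circ> inv_into U \<kappa>)"
    using f c id_chart_tvs_manifold [OF E, of k] unfolding Ck_manifold_map_def by fastforce
  ultimately show ?thesis by (simp add: o_def)
qed

lemma Cn_map_const:
  fixes V :: "('k::topological_field, 'v) tvs"
  assumes V: "topological_vector_space V" and F: "topological_vector_space F"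
    and U: "openin (vtop V) U" and c: "c \<in> carrier F"
  shows "Cn_map n V U F (\<lambda>_. c)"
proof -
  have i: "inj (Atom :: 'v \<Rightarrow> ('k, 'v) univ)" by (simp add: inj_def)
  have "(Atom :: 'v \<Rightarrow> ('k, 'v) univ) ` U \<subseteq> carrier (map_tvs Atom V)"
    using topological_vector_space.open_subset_carrier [OF V U] by auto
  then show ?thesis
    unfolding Cn_map_iff_CN_map [OF V F U i] by (intro CN_const tvs_map V F i c)
qed

section \<open>The function space as a topological vector space, and its evaluation map\<close>

locale Ck_function_space = Ck_manifold k M
  for k :: enat and M :: "('k::topological_field, 'm, 'z) manifold_data" +
  fixes E :: "('k, 'e) tvs"
  assumes lcK: "locally_compact_space (euclidean :: 'k topology)"
    and lcZ: "locally_compact_space (vtop (model M))"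
    and tvs_E: "topological_vector_space E"
begin

interpretation E: topological_vector_space E by (rule tvs_E)
interpretation Z: topological_vector_space "model M" by (rule tvs_model)

abbreviation "Z \<equiv> model M"
abbreviation "G \<equiv> Ck_tvs k M E"
abbreviation "Ck_funs \<equiv> Ck_functions k M E"
abbreviation "pts \<equiv> topspace (mtop M)"

text \<open>The chart representation that defines the topology of \<open>Ck_tvs\<close>, restricted
  so that it is a point of the function space on the chart image.\<close>

definition rep :: "'m set \<times> ('m \<Rightarrow> 'z) \<Rightarrow> ('m \<Rightarrow> 'e) \<Rightarrow> ('z \<Rightarrow> 'e)" where
  "rep = (\<lambda>(U, \<kappa>) \<gamma>. restrict (\<gamma> \<circ> inv_into U \<kappa>) (\<kappa> ` U))"

text \<open>Addition and scalar multiplication are both special cases, so closure and continuity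
  need to be shown for one operation only.\<close>

definition lin :: "('m \<Rightarrow> 'e) \<Rightarrow> 'k \<Rightarrow> ('m \<Rightarrow> 'e) \<Rightarrow> ('m \<Rightarrow> 'e)" where
  "lin \<gamma> t \<eta> = (\<lambda>x\<in>pts. comb E (\<gamma> x) t (\<eta> x))"

lemma carrier_G [simp]: "carrier G = Ck_funs"
  and add_G: "\<gamma> \<oplus>\<^bsub>G\<^esub> \<eta> = (\<lambda>x\<in>pts. \<gamma> x \<oplus>\<^bsub>E\<^esub> \<eta> x)"
  and smult_G: "t \<odot>\<^bsub>G\<^esub> \<gamma> = (\<lambda>x\<in>pts. t \<odot>\<^bsub>E\<^esub> \<gamma> x)"
  and zero_G: "\<zero>\<^bsub>G\<^esub> = (\<lambda>x\<in>pts. \<zero>\<^bsub>E\<^esub>)"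
  and vtop_G: "vtop G = initial_topology Ck_funs (charts k M) rep (\<lambda>(U, \<kappa>). Ck_topology k Z (\<kappa> ` U) E)"
  by (simp_all add: Ck_tvs_def rep_def)

lemma atlas_subset_charts: "c \<in> atlas M \<Longrightarrow> c \<in> charts k M"
  unfolding charts_def mem_Collect_eq by (intro conjI ballI atlas_charts atlas_compatible)

lemma ex_chart: "x \<in> pts \<Longrightarrow> \<exists>U \<kappa>. (U, \<kappa>) \<in> atlas M \<and> x \<in> U"
proof -
  assume "x \<in> pts"
  then have "x \<in> (\<Union>(U, \<kappa>)\<in>atlas M. U)" by (simp only: atlas_covers)
  then show ?thesis by blast
qed

lemma charts_is_chart: "c \<in> charts k M \<Longrightarrow> is_chart (mtop M) Z c"
  by (simp add: charts_def)

lemma Ck_funs_ext: "\<gamma> \<in> Ck_funs \<Longrightarrow> \<gamma> \<in> extensional pts"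
  by (simp add: Ck_functions_def)

lemma Ck_funs_mem: "\<gamma> \<in> Ck_funs \<Longrightarrow> x \<in> pts \<Longrightarrow> \<gamma> x \<in> carrier E"
  by (auto simp: Ck_functions_def Ck_manifold_map_def continuous_map_def E.topspace_vtop)

lemma Ck_funs_I:
  assumes "\<gamma> \<in> extensional pts"
    and "\<And>U \<kappa>. (U, \<kappa>) \<in> atlas M \<Longrightarrow> Ck_map k Z (\<kappa> ` U) E (\<lambda>z. \<gamma> (inv_into U \<kappa> z))"
  shows "\<gamma> \<in> Ck_funs"
proof -
  have "Ck_manifold_map k M (tvs_manifold E) \<gamma>"
    by (rule Ck_manifold_map_tvsI [OF tvs_model tvs_E atlas_charts ex_chart assms(2)])
  then show ?thesis using assms(1) by (simp add: Ck_functions_def)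
qed

lemma chart_pts: "(U, \<kappa>) \<in> charts k M \<Longrightarrow> z \<in> \<kappa> ` U \<Longrightarrow> inv_into U \<kappa> z \<in> pts"
proof -
  assume c: "(U, \<kappa>) \<in> charts k M" and z: "z \<in> \<kappa> ` U"
  have "U \<subseteq> pts" by (rule openin_subset [OF chart_open [OF charts_is_chart [OF c]]])
  then show ?thesis using inv_into_into [OF z] by blast
qed

lemma rep_mem:
  assumes "\<gamma> \<in> Ck_funs" and c: "(U, \<kappa>) \<in> charts k M"
  shows "rep (U, \<kappa>) \<gamma> \<in> Ck_space k Z (\<kappa> ` U) E"
proof -
  have "Ck_map k Z (\<kappa> ` U) E (\<lambda>z. \<gamma> (inv_into U \<kappa> z))"
    using assms tvs_E by (intro Ck_manifold_map_tvsD) (auto simp: Ck_functions_def)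
  then have "Ck_map k Z (\<kappa> ` U) E (rep (U, \<kappa>) \<gamma>)"
    by (rule Ck_map_cong [THEN iffD1, rotated]) (simp add: rep_def)
  then show ?thesis by (simp add: Ck_space_def rep_def)
qed

lemma rep_lin:
  assumes "(U, \<kappa>) \<in> charts k M" "z \<in> \<kappa> ` U"
  shows "rep (U, \<kappa>) (lin \<gamma> t \<eta>) z = comb E (rep (U, \<kappa>) \<gamma> z) t (rep (U, \<kappa>) \<eta> z)"
  using assms chart_pts [OF assms] by (simp add: rep_def lin_def)

lemma iter_bracket_rep_lin:
  assumes "\<gamma> \<in> Ck_funs" "\<eta> \<in> Ck_funs" and c: "(U, \<kappa>) \<in> charts k M" and j: "enat j \<le> k"
    and p: "p \<in> iter_dom Z (\<kappa> ` U) j"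
  shows "iter_bracket Z (\<kappa> ` U) E (rep (U, \<kappa>) (lin \<gamma> t \<eta>)) j p =
     comb E (iter_bracket Z (\<kappa> ` U) E (rep (U, \<kappa>) \<gamma>) j p) t (iter_bracket Z (\<kappa> ` U) E (rep (U, \<kappa>) \<eta>) j p)"
proof -
  obtain B W where e: "embedded Z (\<kappa> ` U) E (Atom :: 'z \<Rightarrow> ('k, 'z) univ) B W"
    by (rule ex_embedded [OF tvs_model tvs_E chart_image_open [OF charts_is_chart [OF c]]])
  have "iter_bracket Z (\<kappa> ` U) E (rep (U, \<kappa>) (lin \<gamma> t \<eta>)) j =
     iter_bracket Z (\<kappa> ` U) E (\<lambda>z. comb E (rep (U, \<kappa>) \<gamma> z) t (rep (U, \<kappa>) \<eta> z)) j"
    by (rule iter_bracket_cong) (rule rep_lin [OF c])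
  moreover have "Cn_map j Z (\<kappa> ` U) E (rep (U, \<kappa>) \<gamma>)" "Cn_map j Z (\<kappa> ` U) E (rep (U, \<kappa>) \<eta>)"
    using rep_mem [OF _ c] assms(1,2) j by (auto simp: Ck_space_def Ck_map_iff)
  ultimately show ?thesis
    using embedded.iter_bracket_lincomb [OF e _ _ order_refl p] by simp
qed

lemma lin_mem:
  assumes "\<gamma> \<in> Ck_funs" "\<eta> \<in> Ck_funs"
  shows "lin \<gamma> t \<eta> \<in> Ck_funs"
proof (rule Ck_funs_I)
  fix U \<kappa> assume "(U, \<kappa>) \<in> atlas M"
  then have c: "(U, \<kappa>) \<in> charts k M" by (rule atlas_subset_charts)
  obtain B W where e: "embedded Z (\<kappa> ` U) E (Atom :: 'z \<Rightarrow> ('k, 'z) univ) B W"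
    by (rule ex_embedded [OF tvs_model tvs_E chart_image_open [OF charts_is_chart [OF c]]])
  have "Ck_map k Z (\<kappa> ` U) E (\<lambda>z. comb E (rep (U, \<kappa>) \<gamma> z) t (rep (U, \<kappa>) \<eta> z))"
    using rep_mem [OF _ c] assms embedded.Cn_map_lincomb [OF e] by (simp add: Ck_space_def Ck_map_iff)
  then show "Ck_map k Z (\<kappa> ` U) E (\<lambda>z. lin \<gamma> t \<eta> (inv_into U \<kappa> z))"
    by (rule Ck_map_cong [THEN iffD1, rotated]) (simp add: rep_lin [OF c, symmetric], simp add: rep_def)
qed (simp add: lin_def)

lemma zero_mem: "(\<lambda>x\<in>pts. \<zero>\<^bsub>E\<^esub>) \<in> Ck_funs"
proof (rule Ck_funs_I)
  fix U \<kappa> assume "(U, \<kappa>) \<in> atlas M"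
  then have c: "(U, \<kappa>) \<in> charts k M" by (rule atlas_subset_charts)
  have "Ck_map k Z (\<kappa> ` U) E (\<lambda>_. \<zero>\<^bsub>E\<^esub>)"
    unfolding Ck_map_iff by (intro allI impI Cn_map_const tvs_model tvs_E chart_image_open [OF charts_is_chart [OF c]]) simp
  then show "Ck_map k Z (\<kappa> ` U) E (\<lambda>z. (\<lambda>x\<in>pts. \<zero>\<^bsub>E\<^esub>) (inv_into U \<kappa> z))"
    by (rule Ck_map_cong [THEN iffD1, rotated]) (simp add: chart_pts [OF c])
qed simp

lemma topspace_G: "topspace (vtop G) = Ck_funs"
  by (simp add: vtop_G)

text \<open>The analytic input used three times: for continuity of the vector operations, for
  continuity of point evaluations, and for \<open>Cn_map_eval\<close>.\<close>

lemma continuous_map_iter_bracket_rep: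
  assumes c: "(U, \<kappa>) \<in> charts k M" and j: "enat j \<le> k"
  shows "continuous_map
      (prod_topology (vtop G) (iter_space Z (\<kappa> ` U) j)) (vtop E)
      (\<lambda>z. iter_bracket Z (\<kappa> ` U) E (rep (U, \<kappa>) (fst z)) j (snd z))"
proof -
  let ?D = "subtopology (vtop (iter_tvs Z j)) (iter_dom Z (\<kappa> ` U) j)"
  note o = chart_image_open [OF charts_is_chart [OF c]]
  have "continuous_map (vtop G) (Ck_topology k Z (\<kappa> ` U) E) (rep (U, \<kappa>))"
    unfolding vtop_G
    using continuous_map_initial_component [where i = "(U, \<kappa>)" and I = "charts k M" and S = Ck_funs and g = rep
        and T = "\<lambda>(U, \<kappa>). Ck_topology k Z (\<kappa> ` U) E"] c rep_mem
    by (simp add: topspace_Ck_topology [OF tvs_model tvs_E o])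
  from continuous_map_compose [OF continuous_map_fst this]
  have "continuous_map (prod_topology (vtop G) ?D) (prod_topology (Ck_topology k Z (\<kappa> ` U) E) ?D)
      (\<lambda>z. (rep (U, \<kappa>) (fst z), snd z))"
    by (intro continuous_map_pairedI continuous_map_snd) (simp add: o_def)
  from continuous_map_compose [OF this Ck_topology_eval [OF tvs_model tvs_E o lcK lcZ j]]
  show ?thesis by (simp add: o_def)
qed

text \<open>The brackets of a combination are the combinations of the brackets, which are jointly
  continuous in function and point; \<open>continuous_map_into_Ck_topology\<close> converts this
  into continuity of the function-valued map.\<close>

lemma continuous_map_lin:
  assumes f: "continuous_map S (vtop G) f" and g: "continuous_map S (vtop G) g" and t: "continuous_map S euclidean t"
  shows "continuous_map S (vtop G) (\<lambda>s. lin (f s) (t s) (g s))"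
proof -
  have mem: "f s \<in> Ck_funs" "g s \<in> Ck_funs" if "s \<in> topspace S" for s
    using f g that by (auto simp: continuous_map_def topspace_G)
  have "continuous_map S (initial_topology Ck_funs (charts k M) rep (\<lambda>(U, \<kappa>). Ck_topology k Z (\<kappa> ` U) E))
      (\<lambda>s. lin (f s) (t s) (g s))"
  proof (rule continuous_map_into_initial_topology)
    fix c assume "c \<in> charts k M"
    moreover obtain U \<kappa> where c_def: "c = (U, \<kappa>)" by (cases c)
    ultimately have c: "(U, \<kappa>) \<in> charts k M" by simp
    note o = chart_image_open [OF charts_is_chart [OF c]]
    have "continuous_map S (Ck_topology k Z (\<kappa> ` U) E) (\<lambda>s. rep (U, \<kappa>) (lin (f s) (t s) (g s)))"
    proof (rule continuous_map_into_Ck_topology [OF tvs_model tvs_E o])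
      fix j assume j: "enat j \<le> k"
      let ?D = "subtopology (vtop (iter_tvs Z j)) (iter_dom Z (\<kappa> ` U) j)"
      let ?b = "\<lambda>\<gamma>. iter_bracket Z (\<kappa> ` U) E (rep (U, \<kappa>) \<gamma>) j"
      note ev = continuous_map_iter_bracket_rep [OF c j]
      have *: "continuous_map (prod_topology S ?D) (vtop E) (\<lambda>z. ?b (h (fst z)) (snd z))"
        if h: "continuous_map S (vtop G) h" for h
      proof -
        have "continuous_map (prod_topology S ?D) (prod_topology (vtop G) ?D) (\<lambda>z. (h (fst z), snd z))"
          using continuous_map_compose [OF continuous_map_fst h]
          by (intro continuous_map_pairedI continuous_map_snd) (simp add: o_def)
        from continuous_map_compose [OF this ev] show ?thesis by (simp add: o_def)
      qed
      have "continuous_map (prod_topology S ?D) euclidean (\<lambda>z. t (fst z))"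
        using continuous_map_compose [OF continuous_map_fst t] by (simp add: o_def)
      then have "continuous_map (prod_topology S ?D) (vtop E)
          (\<lambda>z. comb E (?b (f (fst z)) (snd z)) (t (fst z)) (?b (g (fst z)) (snd z)))"
        by (intro E.continuous_map_add E.continuous_map_smult * f g)
      then show "continuous_map (prod_topology S ?D) (vtop E) (\<lambda>z. ?b (lin (f (fst z)) (t (fst z)) (g (fst z))) (snd z))"
        by (rule continuous_map_eq) (auto simp: iter_bracket_rep_lin [OF mem c j])
    qed (use rep_mem [OF lin_mem [OF mem] c] in blast)
    then show "continuous_map S (case c of (U, \<kappa>) \<Rightarrow> Ck_topology k Z (\<kappa> ` U) E) (\<lambda>s. rep c (lin (f s) (t s) (g s)))"
      by (simp add: c_def)
  qed (use lin_mem mem in auto)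
  then show ?thesis by (simp add: vtop_G)
qed

lemma add_eq_lin: "\<gamma> \<in> Ck_funs \<Longrightarrow> \<eta> \<in> Ck_funs \<Longrightarrow> \<gamma> \<oplus>\<^bsub>G\<^esub> \<eta> = lin \<gamma> 1 \<eta>"
  by (auto simp: add_G lin_def Ck_funs_mem intro!: restrict_ext)

lemma smult_eq_lin: "\<gamma> \<in> Ck_funs \<Longrightarrow> t \<odot>\<^bsub>G\<^esub> \<gamma> = lin (\<lambda>x\<in>pts. \<zero>\<^bsub>E\<^esub>) t \<gamma>"
  by (auto simp: smult_G lin_def Ck_funs_mem intro!: restrict_ext)

lemma comb_eq_lin: "comb G \<gamma> t \<eta> = lin \<gamma> t \<eta>"
  by (auto simp: add_G smult_G lin_def intro!: restrict_ext)

lemma Ck_funs_eqI: "\<gamma> \<in> extensional pts \<Longrightarrow> \<eta> \<in> extensional pts \<Longrightarrow> (\<And>x. x \<in> pts \<Longrightarrow> \<gamma> x = \<eta> x) \<Longrightarrow> \<gamma> = \<eta>"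
  by (rule extensionalityI)

text \<open>In a chart around \<open>x\<close> the value \<open>\<gamma> x\<close> is the bracket of
  level \<open>0\<close> at the fixed point \<open>Base (\<kappa> x)\<close>.\<close>

lemma continuous_map_point_eval:
  assumes x: "x \<in> pts"
  shows "continuous_map (vtop G) (vtop E) (\<lambda>\<gamma>. \<gamma> x)"
proof -
  obtain U \<kappa> where c: "(U, \<kappa>) \<in> charts k M" "x \<in> U"
    using ex_chart [OF x] atlas_subset_charts by blast
  have 0: "enat 0 \<le> k" by (simp add: enat_0)
  let ?D = "subtopology (vtop (iter_tvs Z 0)) (iter_dom Z (\<kappa> ` U) 0)"
  have "Base (\<kappa> x) \<in> iter_dom Z (\<kappa> ` U) 0" using c by simp
  then have "Base (\<kappa> x) \<in> topspace ?D"
    using topspace_iter_dom [OF tvs_model tvs_E chart_image_open [OF charts_is_chart [OF c(1)]]] by metis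
  then have "continuous_map (vtop G) (prod_topology (vtop G) ?D) (\<lambda>\<gamma>. (\<gamma>, Base (\<kappa> x)))"
    by (intro continuous_map_pairedI continuous_map_ident) simp
  from continuous_map_compose [OF this continuous_map_iter_bracket_rep [OF c(1) 0]]
  have *: "continuous_map (vtop G) (vtop E) (\<lambda>\<gamma>. iter_bracket Z (\<kappa> ` U) E (rep (U, \<kappa>) \<gamma>) 0 (Base (\<kappa> x)))"
    by (simp only: o_def fst_conv snd_conv)
  have "iter_bracket Z (\<kappa> ` U) E (rep (U, \<kappa>) \<gamma>) 0 (Base (\<kappa> x)) = \<gamma> x" for \<gamma>
    using c inv_into_f_f [OF chart_inj [OF charts_is_chart [OF c(1)]]]
    by (subst iter_bracket_0) (auto simp: rep_def)
  with * show ?thesis by (rule continuous_map_eq)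
qed

lemma tvs_G: "topological_vector_space G"
proof (rule topological_vector_spaceI)
  show "topspace (vtop G) = carrier G" by (simp add: topspace_G)
  have "continuous_map (prod_topology (vtop G) (vtop G)) (vtop G) (\<lambda>p. lin (fst p) 1 (snd p))"
    by (intro continuous_map_lin continuous_map_fst continuous_map_snd) simp
  then show "continuous_map (prod_topology (vtop G) (vtop G)) (vtop G) (\<lambda>(x, y). x \<oplus>\<^bsub>G\<^esub> y)"
    by (rule continuous_map_eq) (auto simp: topspace_G add_eq_lin)
  have "continuous_map (prod_topology euclidean (vtop G)) (vtop G) (\<lambda>p. lin (\<lambda>x\<in>pts. \<zero>\<^bsub>E\<^esub>) (fst p) (snd p))"
    by (intro continuous_map_lin continuous_map_fst continuous_map_snd) (simp add: topspace_G zero_mem)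
  then show "continuous_map (prod_topology euclidean (vtop G)) (vtop G) (\<lambda>(c, x). c \<odot>\<^bsub>G\<^esub> x)"
    by (rule continuous_map_eq) (auto simp: topspace_G smult_eq_lin)
  \<comment> \<open>Point evaluations make the inclusion into the product of copies of
    \<open>E\<close> continuous, and a continuous injection into a Hausdorff space pulls the
    property back.\<close>
  show "Hausdorff_space (vtop G)"
  proof (rule Hausdorff_space_injective_preimage)
    show "Hausdorff_space (product_topology (\<lambda>_. vtop E) pts)"
      by (simp add: Hausdorff_space_product_topology E.Hausdorff_vtop)
    show "continuous_map (vtop G) (product_topology (\<lambda>_. vtop E) pts) (\<lambda>\<gamma>. \<gamma>)"
      unfolding continuous_map_componentwise using Ck_funs_ext continuous_map_point_eval by (auto simp: topspace_G)
    show "inj_on (\<lambda>\<gamma>. \<gamma>) (topspace (vtop G))" by simp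
  qed
  show "x \<oplus>\<^bsub>G\<^esub> y \<in> carrier G" if "x \<in> carrier G" "y \<in> carrier G" for x y
    using that lin_mem by (simp add: add_eq_lin)
  show "x \<oplus>\<^bsub>G\<^esub> y = y \<oplus>\<^bsub>G\<^esub> x" if "x \<in> carrier G" "y \<in> carrier G" for x y
    using that unfolding add_G by (intro restrict_ext E.M.a_comm Ck_funs_mem) auto
  show "\<zero>\<^bsub>G\<^esub> \<in> carrier G" by (simp add: zero_G zero_mem)
  show "c \<odot>\<^bsub>G\<^esub> x \<in> carrier G" if "x \<in> carrier G" for c x
    using that lin_mem zero_mem by (simp add: smult_eq_lin)
  show "\<zero>\<^bsub>G\<^esub> \<oplus>\<^bsub>G\<^esub> x = x" "1 \<odot>\<^bsub>G\<^esub> x = x" "0 \<odot>\<^bsub>G\<^esub> x = \<zero>\<^bsub>G\<^esub>" if "x \<in> carrier G" for x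
    using that by (auto intro!: Ck_funs_eqI simp: Ck_funs_ext Ck_funs_mem add_G smult_G zero_G)
qed (auto intro!: Ck_funs_eqI simp: Ck_funs_mem add_G smult_G E.M.a_assoc E.smult_add_left E.smult_add_right E.smult_smult)

text \<open>For each finite \<open>n\<close> up to \<open>k\<close> the general evaluation result
  applies with parameter space \<open>G\<close>, the family being the chart representations, which
  depend linearly on the parameter.\<close>

lemma Ck_map_eval_rep:
  assumes c: "(U, \<kappa>) \<in> charts k M"
  shows "Ck_map k (prod_tvs G Z) (Ck_funs \<times> \<kappa> ` U) E (\<lambda>z. rep (U, \<kappa>) (fst z) (snd z))"
  unfolding Ck_map_iff
proof (intro allI impI)
  fix n assume n: "enat n \<le> k"
  have "Cn_map n (prod_tvs G Z) (carrier G \<times> \<kappa> ` U) E (\<lambda>z. rep (U, \<kappa>) (fst z) (snd z))"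
  proof (rule Cn_map_eval [OF tvs_G tvs_model tvs_E chart_image_open [OF charts_is_chart [OF c]]])
    show "Cn_map n Z (\<kappa> ` U) E (rep (U, \<kappa>) \<gamma>)" if "\<gamma> \<in> carrier G" for \<gamma>
      using rep_mem [OF _ c, of \<gamma>] that n by (simp add: Ck_space_def Ck_map_iff)
    show "continuous_map (prod_topology (vtop G) (iter_space Z (\<kappa> ` U) j)) (vtop E)
        (\<lambda>z. iter_bracket Z (\<kappa> ` U) E (rep (U, \<kappa>) (fst z)) j (snd z))" if "j \<le> n" for j
      using that n by (intro continuous_map_iter_bracket_rep c) (metis enat_ord_simps(1) order_trans)
    show "rep (U, \<kappa>) (comb G \<gamma> t \<eta>) x = comb E (rep (U, \<kappa>) \<gamma> x) t (rep (U, \<kappa>) \<eta> x)"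
      if "x \<in> \<kappa> ` U" for \<gamma> \<eta> t x
      unfolding comb_eq_lin by (rule rep_lin [OF c that])
  qed
  then show "Cn_map n (prod_tvs G Z) (Ck_funs \<times> \<kappa> ` U) E (\<lambda>z. rep (U, \<kappa>) (fst z) (snd z))" by simp
qed

lemma prod_chart:
  assumes "(U, \<kappa>) \<in> atlas M"
  shows "is_chart (prod_topology (vtop G) (mtop M)) (prod_tvs G Z) (Ck_funs \<times> U, map_prod id \<kappa>)"
proof -
  note ch = atlas_charts [OF assms]
  have im: "map_prod id \<kappa> ` (Ck_funs \<times> U) = Ck_funs \<times> \<kappa> ` U" by force
  have o: "openin (vtop G) Ck_funs" using openin_topspace [of "vtop G"] by (simp add: topspace_G)
  have s: "subtopology (vtop G) Ck_funs = vtop G" by (simp add: topspace_G [symmetric])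
  obtain g where "homeomorphic_maps (subtopology (mtop M) U) (subtopology (vtop Z) (\<kappa> ` U)) \<kappa> g"
    using ch by (auto simp: is_chart_def homeomorphic_map_maps)
  then have "homeomorphic_maps (prod_topology (vtop G) (subtopology (mtop M) U)) (prod_topology (vtop G) (subtopology (vtop Z) (\<kappa> ` U)))
      (\<lambda>(x, y). (id x, \<kappa> y)) (\<lambda>(x, y). (id x, g y))"
    unfolding homeomorphic_maps_prod by (simp add: homeomorphic_maps_def)
  then have "homeomorphic_map (prod_topology (vtop G) (subtopology (mtop M) U)) (prod_topology (vtop G) (subtopology (vtop Z) (\<kappa> ` U)))
      (map_prod id \<kappa>)"
    unfolding homeomorphic_map_maps map_prod_def by blast
  then show ?thesis
    using o chart_open [OF ch] chart_image_open [OF ch]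
    by (simp add: is_chart_def im openin_prod_Times_iff subtopology_Times s)
qed

text \<open>In a product of the whole function space with an atlas chart of \<open>M\<close> the
  evaluation map becomes the evaluation of \<open>rep\<close>, and it is enough to look at such
  charts.\<close>

theorem Ck_manifold_map_eval:
  "Ck_manifold_map k (prod_manifold (tvs_manifold G) M) (tvs_manifold E) (\<lambda>(\<gamma>, x). \<gamma> x)"
proof (rule Ck_manifold_map_tvsI)
  let ?N = "prod_manifold (tvs_manifold G) M"
  have N: "model ?N = prod_tvs G Z" "mtop ?N = prod_topology (vtop G) (mtop M)"
    "atlas ?N = {(Ck_funs \<times> U, map_prod id \<kappa>) | U \<kappa>. (U, \<kappa>) \<in> atlas M}"
    by (auto simp: prod_manifold_def)
  show "topological_vector_space (model ?N)" unfolding N by (intro tvs_prod tvs_G tvs_model)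
  show "topological_vector_space E" by (rule tvs_E)
  show "is_chart (mtop ?N) (model ?N) c" if "c \<in> atlas ?N" for c
    using that prod_chart unfolding N by blast
  show "\<exists>V \<mu>. (V, \<mu>) \<in> atlas ?N \<and> z \<in> V" if mem: "z \<in> topspace (mtop ?N)" for z
  proof -
    obtain \<gamma> x where z: "z = (\<gamma>, x)" "\<gamma> \<in> Ck_funs" "x \<in> pts"
      using mem by (auto simp: N topspace_G)
    then obtain U \<kappa> where "(U, \<kappa>) \<in> atlas M" "x \<in> U" using ex_chart by blast
    then show ?thesis using z unfolding N by blast
  qed
  fix V \<mu> assume "(V, \<mu>) \<in> atlas ?N"
  then obtain U \<kappa> where a: "(U, \<kappa>) \<in> atlas M" and V: "V = Ck_funs \<times> U" "\<mu> = map_prod id \<kappa>"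
    unfolding N by blast
  have inj: "inj_on \<kappa> U" by (rule chart_inj [OF atlas_charts [OF a]])
  then have inj': "inj_on (map_prod id \<kappa>) (Ck_funs \<times> U)" by (auto simp: inj_on_def)
  have im: "map_prod id \<kappa> ` (Ck_funs \<times> U) = Ck_funs \<times> \<kappa> ` U" by force
  have "Ck_map k (prod_tvs G Z) (Ck_funs \<times> \<kappa> ` U) E (\<lambda>z. (\<lambda>(\<gamma>, x). \<gamma> x) (inv_into (Ck_funs \<times> U) (map_prod id \<kappa>) z))"
  proof (rule Ck_map_cong [THEN iffD1, OF _ Ck_map_eval_rep [OF atlas_subset_charts [OF a]]])
    fix z assume "z \<in> Ck_funs \<times> \<kappa> ` U"
    then obtain \<gamma> x where z: "z = map_prod id \<kappa> (\<gamma>, x)" "\<gamma> \<in> Ck_funs" "x \<in> U" by force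
    have i: "inv_into (Ck_funs \<times> U) (map_prod id \<kappa>) z = (\<gamma>, x)"
      unfolding z(1) by (rule inv_into_f_f [OF inj']) (use z in simp)
    show "rep (U, \<kappa>) (fst z) (snd z) = (\<lambda>(\<gamma>, x). \<gamma> x) (inv_into (Ck_funs \<times> U) (map_prod id \<kappa>) z)"
      unfolding i using z by (simp add: rep_def inv_into_f_f [OF inj])
  qed
  then show "Ck_map k (model ?N) (\<mu> ` V) E (\<lambda>z. (\<lambda>(\<gamma>, x). \<gamma> x) (inv_into V \<mu> z))"
    unfolding N V im .
qed

end

theorem proposition11p1:
  fixes k :: enat
    and M :: "('k::topological_field, 'm, 'z) manifold_data"
    and E :: "('k, 'e) tvs"
  assumes "locally_compact_space (euclidean :: 'k topology)"
    and "Ck_manifold k M"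
    and "finite_dimensional_tvs (model M)"
    and "topological_vector_space E"
  shows "Ck_manifold_map k (prod_manifold (tvs_manifold (Ck_tvs k M E)) M) (tvs_manifold E)
           (\<lambda>(\<gamma>, x). \<gamma> x)"
proof -
  have "locally_compact_space (vtop (model M))"
    by (rule topological_vector_space.finite_dimensional_imp_locally_compact
        [OF Ck_manifold.tvs_model [OF assms(2)] assms(1,3)])
  then have "Ck_function_space k M E"
    using assms by (intro Ck_function_space.intro Ck_function_space_axioms.intro)
  then show ?thesis by (rule Ck_function_space.Ck_manifold_map_eval)
qed

end
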